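(* Let $\mathfrak{e}\subset\mathbb{R}$ be a Parreau--Widom set (compact and regular for potential theory), let $G_{\mathfrak{e}}$ be its Green's function, let $\alpha>0$, and let $\mathfrak{e}^\alpha=\{z\in\mathbb{C} : G_{\mathfrak{e}}(z)=\alpha\}$. Then for every $n\ge1$, $$t_n^{(\mathfrak{e}^\alpha)}\le(1+e^{-n\alpha})\exp\{PW(\mathfrak{e})\}\,C(\mathfrak{e}^\alpha)^n.$$
   Context: For a compact, not finite, set $\mathfrak{e}\subset\mathbb{C}$, $\|f\|_{\mathfrak{e}}=\sup_{z\in\mathfrak{e}}|f(z)|$; the Chebyshev polynomial $T_n^{(\mathfrak{e})}$ is the unique monic polynomial of degree $n$ minimizing $\|P\|_{\mathfrak{e}}$ over all monic polynomials $P$ of degree $n$, and $t_n^{(\mathfrak{e})}=\|T_n^{(\mathfrak{e})}\|_{\mathfrak{e}}$. $C(\mathfrak{e})$ is the logarithmic capacity. $G_{\mathfrak{e}}$ is the Green's function, with pole at infinity, of the unbounded component of $\mathbb{C}\setminus\mathfrak{e}$, set to $0$ on $\mathfrak{e}$; $\mathfrak{e}$ is regular for potential theory if it has positive capacity and $G_{\mathfrak{e}}(z)\to0$ as $z$ approaches any boundary point of this component. Let $\mathcal{C}$ be the set of critical points of $G_{\mathfrak{e}}$ on the unbounded component of $\mathbb{C}\setminus\mathfrak{e}$ and $PW(\mathfrak{e})=\sum_{w\in\mathcal{C}}G_{\mathfrak{e}}(w)$. $\mathfrak{e}$ is a Parreau--Widom (PW) set if $PW(\mathfrak{e})<\infty$.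 *)

theory Defs
  imports "HOL-Probability.Probability" "HOL-Computational_Algebra.Polynomial"
begin

section \<open>Chebyshev polynomials\<close>

definition sup_norm_on :: "complex set \<Rightarrow> (complex \<Rightarrow> complex) \<Rightarrow> real" where
  "sup_norm_on E f = (SUP z\<in>E. cmod (f z))"

definition monic_of_degree :: "nat \<Rightarrow> complex poly \<Rightarrow> bool" where
  "monic_of_degree n P \<longleftrightarrow> degree P = n \<and> lead_coeff P = 1"

text \<open>For compact infinite \<open>E\<close> the minimiser exists and is unique, so the choice made by
  \<^const>\<open>arg_min\<close> is the Chebyshev polynomial.\<close>

definition chebyshev_poly :: "complex set \<Rightarrow> nat \<Rightarrow> complex poly" where
  "chebyshev_poly E n = (ARG_MIN (\<lambda>P. sup_norm_on E (poly P)) P. monic_of_degree n P)"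

definition chebyshev_norm :: "complex set \<Rightarrow> nat \<Rightarrow> real" where
  "chebyshev_norm E n = sup_norm_on E (poly (chebyshev_poly E n))"


section \<open>Logarithmic capacity\<close>

text \<open>The kernel is \<open>log (1 / \<bar>z - w\<bar>)\<close>. The diagonal needs its own case, since \<open>ln 0 = 0\<close>.\<close>

definition log_kernel :: "complex \<Rightarrow> complex \<Rightarrow> ereal" where
  "log_kernel z w = (if z = w then \<infinity> else ereal (- ln (cmod (z - w))))"

text \<open>\<^const>\<open>e2ennreal\<close> sends negative values to \<open>0\<close>, so the two integrals below are those of the
  positive and of the negative part of the kernel. The second one is finite for probability
  measures of bounded support, so \<open>\<infinity> - \<infinity>\<close> does not arise for such measures.\<close>

definition log_energy :: "complex measure \<Rightarrow> ereal" where
  "log_energy \<mu> =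
     enn2ereal (\<integral>\<^sup>+z. (\<integral>\<^sup>+w. e2ennreal (log_kernel z w) \<partial>\<mu>) \<partial>\<mu>)
   - enn2ereal (\<integral>\<^sup>+z. (\<integral>\<^sup>+w. e2ennreal (- log_kernel z w) \<partial>\<mu>) \<partial>\<mu>)"

definition prob_measures_on :: "complex set \<Rightarrow> complex measure set" where
  "prob_measures_on E = {\<mu>. prob_space \<mu> \<and> sets \<mu> = sets borel \<and> emeasure \<mu> E = 1}"

definition robin_constant :: "complex set \<Rightarrow> ereal" where
  "robin_constant E = (INF \<mu>\<in>prob_measures_on E. log_energy \<mu>)"

text \<open>\<open>exp (- robin_constant E)\<close> with \<open>exp (-\<infinity>) = 0\<close>; for compact \<open>E\<close> the Robin constant is
  never \<open>-\<infinity>\<close>.\<close>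

definition log_capacity :: "complex set \<Rightarrow> real" where
  "log_capacity E =
     (if robin_constant E = \<infinity> then 0 else exp (- real_of_ereal (robin_constant E)))"


section \<open>Green's function with pole at infinity\<close>

text \<open>Twice continuously differentiable with vanishing Laplacian on an open set. Here \<open>ux\<close>, \<open>uy\<close>,
  \<open>uxx\<close>, \<open>uxy\<close>, \<open>uyy\<close> are the partial derivatives of \<open>u\<close> in \<open>x = Re z\<close> and \<open>y = Im z\<close>.\<close>

definition harmonic_on :: "(complex \<Rightarrow> real) \<Rightarrow> complex set \<Rightarrow> bool" where
  "harmonic_on u S \<longleftrightarrow> open S \<and>
     (\<exists>ux uy uxx uxy uyy :: complex \<Rightarrow> real.
        continuous_on S uxx \<and> continuous_on S uxy \<and> continuous_on S uyy \<and>
        (\<forall>z\<in>S. (u has_derivative (\<lambda>h. ux z * Re h + uy z * Im h)) (at z) \<and>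
               (ux has_derivative (\<lambda>h. uxx z * Re h + uxy z * Im h)) (at z) \<and>
               (uy has_derivative (\<lambda>h. uxy z * Re h + uyy z * Im h)) (at z) \<and>
               uxx z + uyy z = 0))"

text \<open>For bounded \<open>E\<close>, \<^term>\<open>outside E\<close> is the unbounded component of the complement of \<open>E\<close>.\<close>

definition positive_harmonic_log_pole :: "complex set \<Rightarrow> (complex \<Rightarrow> real) \<Rightarrow> bool" where
  "positive_harmonic_log_pole E u \<longleftrightarrow>
     harmonic_on u (outside E) \<and> (\<forall>z\<in>outside E. u z > 0) \<and>
     Bfun (\<lambda>z. u z - ln (cmod z)) at_infinity"

text \<open>The Green's function of a domain (here \<open>outside E\<close>) is the least positive harmonic function
  on it with a logarithmic pole at infinity. It is extended by \<open>0\<close>.\<close>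

definition is_greens_function :: "complex set \<Rightarrow> (complex \<Rightarrow> real) \<Rightarrow> bool" where
  "is_greens_function E G \<longleftrightarrow>
     positive_harmonic_log_pole E G \<and>
     (\<forall>u. positive_harmonic_log_pole E u \<longrightarrow> (\<forall>z\<in>outside E. G z \<le> u z)) \<and>
     (\<forall>z. z \<notin> outside E \<longrightarrow> G z = 0)"

definition greens_function :: "complex set \<Rightarrow> complex \<Rightarrow> real" where
  "greens_function E = (THE G. is_greens_function E G)"

lemma is_greens_function_unique:
  assumes "is_greens_function E G" "is_greens_function E H"
  shows "G = H"
proof
  fix z
  show "G z = H z"
    using assms unfolding is_greens_function_def
    by (cases "z \<in> outside E") (auto intro: order.antisym)
qed

lemma greens_function_eq: "is_greens_function E G \<Longrightarrow> greens_function E = G"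
  unfolding greens_function_def by (blast intro: is_greens_function_unique)

text \<open>The quantifier over \<open>G\<close> only keeps the definite description honest: by
  \<open>greens_function_eq\<close>, \<open>G\<close> is \<^term>\<open>greens_function E\<close>, which exists for every compact \<open>E\<close> of
  positive capacity.\<close>

definition regular_set :: "complex set \<Rightarrow> bool" where
  "regular_set E \<longleftrightarrow> log_capacity E > 0 \<and>
     (\<exists>G. is_greens_function E G \<and>
          (\<forall>\<zeta>\<in>frontier (outside E). (G \<longlongrightarrow> 0) (at \<zeta> within outside E)))"


section \<open>Parreau--Widom sets\<close>

definition green_critical_points :: "complex set \<Rightarrow> complex set" where
  "green_critical_points E =
     {w \<in> outside E. (greens_function E has_derivative (\<lambda>_. 0)) (at w)}"

definition PW :: "complex set \<Rightarrow> ennreal" where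
  "PW E = (\<Sum>\<^sub>\<infinity>w\<in>green_critical_points E. ennreal (greens_function E w))"

definition parreau_widom :: "complex set \<Rightarrow> bool" where
  "parreau_widom E \<longleftrightarrow> PW E < \<infinity>"

definition green_level_set :: "complex set \<Rightarrow> real \<Rightarrow> complex set" where
  "green_level_set E \<alpha> = {z. greens_function E z = \<alpha>}"

end

theory Submission
  imports Defs "HOL-Complex_Analysis.Complex_Analysis"
    "HOL-Computational_Algebra.Fundamental_Theorem_Algebra"
begin

text \<open>
  Every monic polynomial of degree \<open>n\<close> is a competitor for the Chebyshev problem on the level line
  \<open>G = \<alpha>\<close>; the competitor that gives the bound is the Chebyshev polynomial \<open>T\<close> of \<open>E\<close> itself. Let
  \<open>t\<close> be its norm on \<open>E\<close> and write \<open>T = (t/2)(w + 1/w)\<close> with \<open>\<bar>w\<bar> \<ge> 1\<close>. On \<open>E\<close> the polynomial \<open>T\<close>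
  is real and bounded by \<open>t\<close>, so \<open>\<bar>w\<bar> = 1\<close> there, and the maximum principle gives \<open>log \<bar>w\<bar> \<le> n G\<close>
  everywhere. Hence \<open>\<bar>T\<bar> \<le> (t/2) e\<^sup>n\<^sup>\<alpha> (1 + e\<^sup>-\<^sup>2\<^sup>n\<^sup>\<alpha>)\<close> on the level line
  (\<open>poly_bound_on_level_set\<close>). Let \<open>\<gamma>\<close> be the lower limit of \<open>G - log \<bar>z\<bar>\<close> at infinity, which
  plays the role of the Robin constant of \<open>E\<close>. Two estimates remain.

  The bound of Totik and Widom, \<open>log (t/2) + n \<gamma> \<le> PW\<close> (\<open>totik_widom_bound\<close>). Since \<open>T\<close> is real
  and alternates between \<open>t\<close> and \<open>-t\<close> at \<open>n + 1\<close> points of \<open>E\<close> (\<open>real_chebyshev_alternation\<close>), for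
  \<open>\<bar>s\<bar> < 1\<close> the \<open>n\<close> solutions of \<open>T(z) = t s\<close> are real and any two of them are separated by a
  point of \<open>E\<close>. A gap of \<open>E\<close> therefore contains at most one of them, where \<open>G\<close> is at most its
  maximum over the gap, which is attained at a critical point. So the sum of \<open>G\<close> over the fibre
  \<open>T(z) = t s\<close> is at most \<open>PW\<close> for \<open>-1 < s < 1\<close>. With \<open>s = (w + 1/w)/2\<close>, this sum minus \<open>log \<bar>w\<bar>\<close>
  is harmonic for \<open>\<bar>w\<bar> > 1\<close>, up to removable singularities at critical values of \<open>T\<close>. Its values
  near infinity are thus bounded by its values on \<open>\<bar>w\<bar> = 1\<close>, and near infinity it is at least
  \<open>log (t/2) + n \<gamma>\<close> up to a vanishing error, because the product of the points of the fibre is, up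
  to sign, the constant term of \<open>T - t s\<close>.

  The bound \<open>C(G = \<alpha>) \<ge> e\<^sup>\<alpha>\<^sup>-\<^sup>\<gamma>\<close> (\<open>log_capacity_level_set\<close>). By the Bernstein--Walsh inequality a
  monic polynomial of degree \<open>N\<close> has norm at least \<open>e\<^sup>N\<^sup>(\<^sup>\<alpha>\<^sup>-\<^sup>\<gamma>\<^sup>)\<close> on the level line. Choosing
  points greedily, each one where the polynomial with the previous points as zeros is large, gives
  configurations of small discrete energy, and a weak limit of their counting measures has energy
  at most \<open>\<gamma> - \<alpha>\<close>. The weak compactness of measures in the plane is reduced to Helly's theorem on
  the line by lifting the points along a space-filling curve.

  All maximum principles are instances of \<open>modulus_dominated_max_principle\<close>. It is applied to
  expressions like \<open>\<bar>P\<bar>\<^sup>k e\<^sup>-\<^sup>(\<^sup>k\<^sup>N\<^sup>+\<^sup>1\<^sup>)\<^sup>G\<close>: the one additional factor forces decay at infinity,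
  so that the principle can be applied on bounded regions; taking \<open>k\<close>-th roots and letting \<open>k\<close>
  tend to infinity removes it again. As the exponents of polynomial factors are integers, the
  expression is near a zero of \<open>P\<close>, too, the modulus of a holomorphic function.
\<close>

section \<open>Existence of Chebyshev polynomials\<close>

lemma bdd_above_cmod_on_compact:
  assumes "compact K" "continuous_on K f"
  shows "bdd_above ((\<lambda>z. cmod (f z)) ` K)"
  by (intro bounded_imp_bdd_above compact_imp_bounded compact_continuous_image assms continuous_on_norm)

lemma sup_norm_on_upper:
  assumes "compact K" "z \<in> K"
  shows "cmod (poly P z) \<le> sup_norm_on K (poly P)"
  unfolding sup_norm_on_def
  by (rule cSUP_upper[OF assms(2) bdd_above_cmod_on_compact[OF assms(1)]]) (intro continuous_intros)

lemma sup_norm_on_least: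
  assumes "K \<noteq> {}" "\<And>z. z \<in> K \<Longrightarrow> cmod (f z) \<le> M"
  shows "sup_norm_on K f \<le> M"
  unfolding sup_norm_on_def using assms by (rule cSUP_least)

text \<open>Adding one coordinate at a time, so that the number of coordinates is a parameter and not a type.\<close>

lemma convergent_subsequence_componentwise:
  fixes x :: "nat \<Rightarrow> nat \<Rightarrow> 'a :: metric_space"
  assumes S: "compact S" and x: "\<And>k i. i < n \<Longrightarrow> x k i \<in> S"
  shows "\<exists>r l. strict_mono (r :: nat \<Rightarrow> nat) \<and> (\<forall>i<n. (\<lambda>k. x (r k) i) \<longlonglongrightarrow> l i)"
  using x
proof (induction n)
  case 0
  then show ?case by (intro exI[of _ id]) (auto simp: strict_mono_id)
next
  case (Suc n)
  then obtain r l where r: "strict_mono r" "\<And>i. i < n \<Longrightarrow> (\<lambda>k. x (r k) i) \<longlonglongrightarrow> l i" by fastforce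
  obtain b s where s: "strict_mono s" "((\<lambda>k. x (r k) n) \<circ> s) \<longlonglongrightarrow> b"
    using S Suc.prems[of n] unfolding compact_def by (metis lessI)
  show ?case
  proof (intro exI[of _ "r \<circ> s"] exI[of _ "l(n := b)"] conjI allI impI)
    show "strict_mono (r \<circ> s)" using r s by (simp add: strict_mono_o)
    fix i assume "i < Suc n"
    then consider "i < n" | "i = n" by linarith
    then show "(\<lambda>k. x ((r \<circ> s) k) i) \<longlonglongrightarrow> (l(n := b)) i"
    proof cases
      case 1
      then show ?thesis using LIMSEQ_subseq_LIMSEQ[OF r(2)[OF 1] s(1)] by (simp add: comp_def)
    qed (use s(2) in \<open>simp add: comp_def\<close>)
  qed
qed

lemma monic_poly_roots:
  fixes P :: "complex poly"
  assumes "monic_of_degree n P"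
  obtains a where "P = (\<Prod>i<n. [:- a i, 1:])"
  using complex_poly_decompose'[of P] assms unfolding monic_of_degree_def by (metis smult_1_left)

lemma monic_of_degree_prod: "monic_of_degree n (\<Prod>i<n. [:- a i, 1:])"
  unfolding monic_of_degree_def
proof
  show "degree (\<Prod>i<n. [:- a i, 1:]) = n" by (subst degree_prod_sum_eq) auto
  show "lead_coeff (\<Prod>i<n. [:- a i, 1:]) = 1" by (subst lead_coeff_prod) simp
qed

text \<open>The coefficients of a minimising sequence are not bounded a priori, but its roots may be assumed
  to lie in a fixed disc containing \<open>K\<close>: projecting a root to the disc brings it closer to every
  point of \<open>K\<close>. A subsequence for which all roots converge has a minimiser as its limit.\<close>

lemma chebyshev_minimiser_exists:
  fixes K :: "complex set"
  assumes K: "compact K" "K \<noteq> {}"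
  shows "\<exists>P. monic_of_degree n P \<and> (\<forall>Q. monic_of_degree n Q \<longrightarrow> sup_norm_on K (poly P) \<le> sup_norm_on K (poly Q))"
proof -
  obtain R where R: "R > 0" "\<forall>x\<in>K. cmod x \<le> R"
    using compact_imp_bounded[OF K(1)] unfolding bounded_pos by auto
  define B where "B = cball (0::complex) R"
  define p where "p a = (\<Prod>i<n. [:- a i, 1:])" for a :: "nat \<Rightarrow> complex"
  have np: "cmod (poly (p a) z) = (\<Prod>i<n. dist z (a i))" for a z
    by (simp add: p_def poly_prod prod_norm dist_norm)
  define S where "S = {sup_norm_on K (poly Q) | Q. monic_of_degree n Q}"
  have Sne: "S \<noteq> {}" using monic_of_degree_prod unfolding S_def by blast
  have S0: "s \<ge> 0" if s: "s \<in> S" for s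
  proof -
    obtain z Q where "z \<in> K" "s = sup_norm_on K (poly Q)" using K(2) s by (auto simp: S_def)
    then show ?thesis using sup_norm_on_upper[OF K(1), of z Q] by (meson norm_ge_zero order.trans)
  qed
  then have bdd: "bdd_below S" by (auto simp: bdd_below_def)
  have "\<exists>a. (\<forall>i<n. a i \<in> B) \<and> sup_norm_on K (poly (p a)) < Inf S + inverse (real (Suc k))" for k
  proof -
    have "Inf S < Inf S + inverse (real (Suc k))" by simp
    then obtain Q where Q: "monic_of_degree n Q" "sup_norm_on K (poly Q) < Inf S + inverse (real (Suc k))"
      using cInf_lessD[OF Sne] unfolding S_def by blast
    obtain b where b: "Q = (\<Prod>i<n. [:- b i, 1:])" by (rule monic_poly_roots[OF Q(1)])
    define a where "a i = closest_point B (b i)" for i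
    have B: "convex B" "closed B" "B \<noteq> {}" using R(1) by (auto simp: B_def)
    have aB: "a i \<in> B" for i unfolding a_def by (rule closest_point_in_set[OF B(2,3)])
    have "cmod (poly (p a) z) \<le> cmod (poly Q z)" if z: "z \<in> K" for z
    proof -
      have "z \<in> B" using z R(2) by (auto simp: B_def)
      then have "dist z (a i) \<le> dist z (b i)" for i
        using closest_point_lipschitz[OF B, of z "b i"] closest_point_self[of z B] by (simp add: a_def)
      then have "(\<Prod>i<n. dist z (a i)) \<le> (\<Prod>i<n. dist z (b i))" by (intro prod_mono) auto
      then show ?thesis using np[of a z] np[of b z] unfolding b p_def by simp
    qed
    then have "sup_norm_on K (poly (p a)) \<le> sup_norm_on K (poly Q)"
      using sup_norm_on_upper[OF K(1), of _ Q] by (intro sup_norm_on_least K(2)) (meson order.trans)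
    then show ?thesis using Q(2) aB by (intro exI[of _ a]) auto
  qed
  then obtain a where a: "\<And>k i. i < n \<Longrightarrow> a k i \<in> B"
      "\<And>k. sup_norm_on K (poly (p (a k))) < Inf S + inverse (real (Suc k))" by metis
  obtain r l where r: "strict_mono r" "\<And>i. i < n \<Longrightarrow> (\<lambda>k. a (r k) i) \<longlonglongrightarrow> l i"
    using convergent_subsequence_componentwise[of B n a] a(1) by (auto simp: B_def)
  have "sup_norm_on K (poly (p l)) \<le> Inf S"
  proof (rule sup_norm_on_least[OF K(2)])
    fix z assume z: "z \<in> K"
    have "(\<lambda>k. cmod (poly (p (a (r k))) z)) \<longlonglongrightarrow> cmod (poly (p l) z)"
      unfolding np by (intro tendsto_prod tendsto_dist tendsto_const r(2)) auto
    moreover have "(\<lambda>k. Inf S + inverse (real (Suc (r k)))) \<longlonglongrightarrow> Inf S + 0"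
      using LIMSEQ_subseq_LIMSEQ[OF LIMSEQ_inverse_real_of_nat r(1)]
      by (intro tendsto_add tendsto_const) (simp add: comp_def)
    moreover have "cmod (poly (p (a (r k))) z) \<le> Inf S + inverse (real (Suc (r k)))" for k
      using sup_norm_on_upper[OF K(1) z, of "p (a (r k))"] a(2)[of "r k"] by linarith
    ultimately show "cmod (poly (p l) z) \<le> Inf S"
      using LIMSEQ_le by fastforce
  qed
  then have "sup_norm_on K (poly (p l)) \<le> sup_norm_on K (poly Q)" if "monic_of_degree n Q" for Q
    using cInf_lower[OF _ bdd, of "sup_norm_on K (poly Q)"] that unfolding S_def by fastforce
  then show ?thesis using monic_of_degree_prod unfolding p_def by blast
qed

text \<open>Existence of a minimiser is what gives \<^const>\<open>arg_min\<close> its meaning; from here on Chebyshev norms are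
  estimated by competitors alone.\<close>

lemma chebyshev_norm_le:
  assumes "compact K" "K \<noteq> {}" "monic_of_degree n Q"
  shows "chebyshev_norm K n \<le> sup_norm_on K (poly Q)"
proof -
  obtain P where P: "monic_of_degree n P"
    "\<And>Q. monic_of_degree n Q \<Longrightarrow> sup_norm_on K (poly P) \<le> sup_norm_on K (poly Q)"
    using chebyshev_minimiser_exists[OF assms(1,2)] by blast
  have "is_arg_min (\<lambda>P. sup_norm_on K (poly P)) (monic_of_degree n) P"
    unfolding is_arg_min_linorder using P by blast
  then have "is_arg_min (\<lambda>P. sup_norm_on K (poly P)) (monic_of_degree n) (chebyshev_poly K n)"
    unfolding chebyshev_poly_def arg_min_def by (rule someI)
  then show ?thesis using assms(3) unfolding is_arg_min_linorder chebyshev_norm_def by blast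
qed

section \<open>Alternation of real Chebyshev polynomials\<close>

text \<open>The sets \<open>P\<close> and \<open>N\<close> stand for the points where an extremal polynomial takes its largest and its
  smallest value. Going from right to left, each change between \<open>P\<close> and \<open>N\<close> contributes either a
  further alternation point or one root of a polynomial that is positive on \<open>P\<close> and negative on
  \<open>N\<close>. The last conjunct says that \<open>q\<close> does not change sign again to the right of \<open>P\<close>; it lets the
  induction add points there.\<close>

lemma alternation_or_separating_poly:
  fixes P N :: "real set"
  assumes "compact P" "compact N" "P \<inter> N = {}" "P \<noteq> {}" "\<And>x. x \<in> N \<Longrightarrow> \<exists>p\<in>P. x < p"
  shows "(\<exists>y. (\<forall>i<m. y i < y (Suc i)) \<and> (\<forall>i\<le>m. y i \<in> (if even (m - i) then P else N))) \<or>
    (\<exists>q :: real poly. degree q < m \<and> (\<forall>x\<in>P. poly q x > 0) \<and> (\<forall>x\<in>N. poly q x < 0) \<and>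
       (\<forall>x. (\<forall>p\<in>P. p \<le> x) \<longrightarrow> poly q x > 0))"
  using assms
proof (induction m arbitrary: P N)
  case 0
  then obtain p where "p \<in> P" by blast
  then have "\<exists>y :: nat \<Rightarrow> real. (\<forall>i<0. y i < y (Suc i)) \<and> (\<forall>i\<le>0. y i \<in> (if even (0 - i) then P else N))"
    by (intro exI[of _ "\<lambda>_. p"]) auto
  then show ?case by (rule disjI1)
next
  case (Suc m)
  show ?case
  proof (cases "N = {}")
    case True
    then have "\<exists>q :: real poly. degree q < Suc m \<and> (\<forall>x\<in>P. poly q x > 0) \<and> (\<forall>x\<in>N. poly q x < 0) \<and>
       (\<forall>x. (\<forall>p\<in>P. p \<le> x) \<longrightarrow> poly q x > 0)"
      by (intro exI[of _ 1]) auto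
    then show ?thesis by blast
  next
    case False
    obtain b where b: "b \<in> N" "\<And>x. x \<in> N \<Longrightarrow> x \<le> b"
      using compact_attains_sup[OF Suc.prems(2) False] by blast
    have bP: "b \<notin> P" using b(1) Suc.prems(3) by blast
    define P1 where "P1 = P \<inter> {..b}"
    define P2 where "P2 = P \<inter> {b..}"
    have cP: "compact P1" "compact P2"
      unfolding P1_def P2_def using Suc.prems(1) by (auto intro: compact_Int_closed)
    obtain p where p: "p \<in> P" "b < p" using Suc.prems(5)[OF b(1)] by blast
    then have "P2 \<noteq> {}" by (auto simp: P2_def)
    then obtain c where c: "c \<in> P2" "\<And>x. x \<in> P2 \<Longrightarrow> c \<le> x"
      using compact_attains_inf[OF cP(2)] by blast
    have bc: "b < c" using c(1) bP by (cases "b = c") (auto simp: P2_def)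
    \<comment> \<open>The new root lies between the largest point \<open>b\<close> of \<open>N\<close> and the smallest point \<open>c\<close> of \<open>P\<close> to the right of it.\<close>
    define d where "d = (b + c) / 2"
    have d: "b < d" "d < c" using bc by (auto simp: d_def)
    have "\<exists>n\<in>N. x < n" if "x \<in> P1" for x
      using that b(1) bP by (intro bexI[of _ b]) (auto simp: P1_def less_le)
    moreover have "N \<inter> P1 = {}" using Suc.prems(3) by (auto simp: P1_def)
    ultimately consider
      y where "\<forall>i<m. y i < y (Suc i)" "\<forall>i\<le>m. y i \<in> (if even (m - i) then N else P1)"
      | q :: "real poly" where "degree q < m" "\<forall>x\<in>N. poly q x > 0" "\<forall>x\<in>P1. poly q x < 0"
       "\<forall>x. (\<forall>p\<in>N. p \<le> x) \<longrightarrow> poly q x > 0"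
      using Suc.IH[OF Suc.prems(2) cP(1) _ False] by blast
    then show ?thesis
    proof cases
      case 1
      define v where "v = y(Suc m := p)"
      have "y m \<in> N" using 1(2) by force
      then have "y m < p" using b(2) p(2) by force
      then have "\<forall>i<Suc m. v i < v (Suc i)" using 1(1) by (auto simp: v_def less_Suc_eq)
      moreover have "\<forall>i\<le>Suc m. v i \<in> (if even (Suc m - i) then P else N)"
      proof (intro allI impI)
        fix i assume "i \<le> Suc m"
        then consider "i = Suc m" | "i \<le> m" by linarith
        then show "v i \<in> (if even (Suc m - i) then P else N)"
        proof cases
          case 2
          then have "even (Suc m - i) \<longleftrightarrow> odd (m - i)" by (simp add: Suc_diff_le)
          then show ?thesis using 1(2) 2 by (auto simp: v_def P1_def split: if_splits)
        qed (use p in \<open>auto simp: v_def\<close>)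
      qed
      ultimately show ?thesis by blast
    next
      case 2
      define r where "r = [:- d, 1:] * q"
      have pr: "poly r x = (x - d) * poly q x" for x by (simp add: r_def algebra_simps)
      have big: "poly r x > 0" if "x \<ge> c" for x
      proof -
        have "poly q x > 0" proof -
          have "\<forall>p\<in>N. p \<le> x" using b(2) that bc by force
          then show ?thesis using 2(4) by blast
        qed
        then show ?thesis unfolding pr using that d by simp
      qed
      have "degree r < Suc m"
        using 2(1) degree_mult_le[of "[:- d, 1:]" q] by (auto simp: r_def)
      moreover have "\<forall>x\<in>P. poly r x > 0"
      proof
        fix x assume x: "x \<in> P"
        show "poly r x > 0"
        proof (cases "x \<le> b")
          case True
          then have "poly q x < 0" using 2(3) x by (auto simp: P1_def)
          then show ?thesis unfolding pr using True d by (simp add: mult_neg_neg)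
        next
          case False
          then have "x \<in> P2" using x by (auto simp: P2_def)
          then show ?thesis using big c(2) by blast
        qed
      qed
      moreover have "\<forall>x\<in>N. poly r x < 0"
      proof
        fix x assume x: "x \<in> N"
        then have "poly q x > 0" "x < d" using 2(2) b(2)[OF x] d by auto
        then show "poly r x < 0" unfolding pr by (simp add: mult_neg_pos)
      qed
      moreover have "\<forall>x. (\<forall>p\<in>P. p \<le> x) \<longrightarrow> poly r x > 0"
        using big c(1) by (auto simp: P2_def)
      ultimately show ?thesis by blast
    qed
  qed
qed

text \<open>If this failed for a sequence of \<open>\<epsilon>\<close> tending to zero, the points where it fails would accumulate
  at an extremal point of \<open>f\<close>. But near such a point \<open>f g\<close> is positive, and subtracting a small
  multiple of \<open>g\<close> reduces the modulus of \<open>f\<close>.\<close>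

lemma perturbation_decreases_sup:
  fixes f g :: "real \<Rightarrow> real"
  assumes X: "compact X" and f: "continuous_on X f" and g: "continuous_on X g"
    and t: "t > 0" and le: "\<And>x. x \<in> X \<Longrightarrow> \<bar>f x\<bar> \<le> t"
    and pos: "\<And>x. x \<in> X \<Longrightarrow> \<bar>f x\<bar> = t \<Longrightarrow> f x * g x > 0"
  shows "\<exists>\<epsilon>>0. \<forall>x\<in>X. \<bar>f x - \<epsilon> * g x\<bar> < t"
proof (rule ccontr)
  assume "\<not> ?thesis"
  then have "\<exists>x\<in>X. \<bar>f x - inverse (real (Suc k)) * g x\<bar> \<ge> t" for k
    by (metis inverse_positive_iff_positive not_less of_nat_0_less_iff zero_less_Suc)
  then obtain x where x: "\<And>k. x k \<in> X" "\<And>k. \<bar>f (x k) - inverse (real (Suc k)) * g (x k)\<bar> \<ge> t"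
    by metis
  obtain l r where l: "l \<in> X" "strict_mono (r :: nat \<Rightarrow> nat)" "(x \<circ> r) \<longlonglongrightarrow> l"
    using X x(1) unfolding compact_def by metis
  have flim: "(\<lambda>k. f (x (r k))) \<longlonglongrightarrow> f l"
    using continuous_on_tendsto_compose[OF f l(3) l(1)] x(1) by (simp add: comp_def)
  have glim: "(\<lambda>k. g (x (r k))) \<longlonglongrightarrow> g l"
    using continuous_on_tendsto_compose[OF g l(3) l(1)] x(1) by (simp add: comp_def)
  have inv: "(\<lambda>k. inverse (real (Suc (r k)))) \<longlonglongrightarrow> 0"
    using LIMSEQ_subseq_LIMSEQ[OF LIMSEQ_inverse_real_of_nat l(2)] by (simp add: comp_def)
  have "(\<lambda>k. \<bar>f (x (r k)) - inverse (real (Suc (r k))) * g (x (r k))\<bar>) \<longlonglongrightarrow> \<bar>f l - 0 * g l\<bar>"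
    by (intro tendsto_intros flim glim inv)
  then have "t \<le> \<bar>f l\<bar>" using x(2) by (intro LIMSEQ_le_const) auto
  then have fl: "f l * g l > 0" using pos[OF l(1)] le[OF l(1)] by simp
  have "(\<lambda>k. 2 * (f (x (r k)) * g (x (r k))) - inverse (real (Suc (r k))) * (g (x (r k)))\<^sup>2)
      \<longlonglongrightarrow> 2 * (f l * g l) - 0 * (g l)\<^sup>2"
    by (intro tendsto_intros flim glim inv)
  then have "\<forall>\<^sub>F k in sequentially. 2 * (f (x (r k)) * g (x (r k))) - inverse (real (Suc (r k))) * (g (x (r k)))\<^sup>2 > 0"
    by (rule order_tendstoD(1)) (use fl in simp)
  then obtain k where k: "2 * (f (x (r k)) * g (x (r k))) - inverse (real (Suc (r k))) * (g (x (r k)))\<^sup>2 > 0"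
    using eventually_happens'[OF sequentially_bot] by blast
  define e where "e = inverse (real (Suc (r k)))"
  have e: "e > 0" by (simp add: e_def)
  define F where "F = f (x (r k))"
  define H where "H = g (x (r k))"
  have "(F - e * H)\<^sup>2 = F\<^sup>2 - e * (2 * (F * H) - e * H\<^sup>2)" by (simp add: power2_eq_square algebra_simps)
  also have "\<dots> < F\<^sup>2" using k e by (simp add: F_def H_def e_def)
  finally have "\<bar>F - e * H\<bar> < \<bar>F\<bar>" by (metis abs_ge_zero power2_abs power_less_imp_less_base)
  also have "\<dots> \<le> t" using le[OF x(1)] by (simp add: F_def)
  finally show False using x(2)[of "r k"] by (simp add: F_def H_def e_def)
qed

lemma poly_map_poly_of_real: "poly (map_poly complex_of_real Q) (of_real x) = of_real (poly Q x)"
  by (induction Q) (auto simp: map_poly_pCons)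

lemma Re_poly_of_real: "poly (map_poly Re P) x = Re (poly P (of_real x))"
  by (induction P) (auto simp: map_poly_pCons)

text \<open>The real part of the coefficients of a complex minimiser is again a minimiser, as \<open>X\<close> is real. If
  its extremal points did not alternate, there would be a polynomial of smaller degree with the
  same signs at all of them, and subtracting a multiple of it would decrease the norm.\<close>

lemma real_chebyshev_alternation:
  fixes X :: "real set"
  assumes X: "compact X" "infinite X" and n: "n \<ge> 1"
  obtains T :: "real poly" and t y where "degree T = n" "lead_coeff T = 1" "t > 0"
    "\<And>x. x \<in> X \<Longrightarrow> \<bar>poly T x\<bar> \<le> t"
    "\<And>i. i \<le> n \<Longrightarrow> y i \<in> X" "\<And>i. i < n \<Longrightarrow> y i < y (Suc i)"
    "\<And>i. i \<le> n \<Longrightarrow> \<bar>poly T (y i)\<bar> = t" "\<And>i. i < n \<Longrightarrow> poly T (y (Suc i)) = - poly T (y i)"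
proof -
  define K where "K = complex_of_real ` X"
  have K: "compact K" "K \<noteq> {}"
    unfolding K_def using X by (auto intro!: compact_continuous_image continuous_intros)
  obtain P where P: "monic_of_degree n P"
    "\<And>Q. monic_of_degree n Q \<Longrightarrow> sup_norm_on K (poly P) \<le> sup_norm_on K (poly Q)"
    using chebyshev_minimiser_exists[OF K] by blast
  define t where "t = sup_norm_on K (poly P)"
  define T where "T = map_poly Re P"
  have T: "degree T = n" "lead_coeff T = 1"
  proof -
    have c: "coeff T i = Re (coeff P i)" for i unfolding T_def by (simp add: coeff_map_poly)
    have "degree T \<le> n" using P(1) by (intro degree_le) (auto simp: c monic_of_degree_def coeff_eq_0)
    moreover have "coeff T n = 1" using c[of n] P(1) by (auto simp: monic_of_degree_def)
    ultimately show "degree T = n" using le_degree[of T n] by simp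
    with \<open>coeff T n = 1\<close> show "lead_coeff T = 1" by simp
  qed
  have le: "\<bar>poly T x\<bar> \<le> t" if "x \<in> X" for x
  proof -
    have "\<bar>poly T x\<bar> \<le> cmod (poly P (of_real x))"
      unfolding T_def Re_poly_of_real by (rule abs_Re_le_cmod)
    also have "\<dots> \<le> t" unfolding t_def by (rule sup_norm_on_upper[OF K(1)]) (use that in \<open>auto simp: K_def\<close>)
    finally show ?thesis .
  qed
  have "t > 0"
  proof (rule ccontr)
    assume "\<not> t > 0"
    then have "X \<subseteq> {x. poly T x = 0}" using le by force
    moreover have "T \<noteq> 0" using T(2) by auto
    ultimately show False using poly_roots_finite X(2) finite_subset by blast
  qed
  have minimal: "\<exists>x\<in>X. t \<le> \<bar>poly Q x\<bar>" if Q: "degree Q = n" "lead_coeff Q = 1" for Q :: "real poly"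
  proof -
    have "monic_of_degree n (map_poly complex_of_real Q)"
      using Q by (simp add: monic_of_degree_def degree_map_poly coeff_map_poly)
    then have *: "t \<le> sup_norm_on K (poly (map_poly complex_of_real Q))" unfolding t_def by (rule P(2))
    have "X \<noteq> {}" using X(2) by auto
    moreover have "continuous_on X (\<lambda>x. \<bar>poly Q x\<bar>)" by (intro continuous_intros)
    ultimately obtain x where x: "x \<in> X" "\<And>y. y \<in> X \<Longrightarrow> \<bar>poly Q y\<bar> \<le> \<bar>poly Q x\<bar>"
      using continuous_attains_sup[OF X(1)] by blast
    have "sup_norm_on K (poly (map_poly complex_of_real Q)) \<le> \<bar>poly Q x\<bar>"
      by (rule sup_norm_on_least[OF K(2)]) (use x(2) in \<open>auto simp: K_def poly_map_poly_of_real\<close>)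
    then show ?thesis using * x(1) by force
  qed
  have no_sep: False if q: "degree q < n" "\<And>x. x \<in> X \<Longrightarrow> \<bar>poly T x\<bar> = t \<Longrightarrow> poly T x * poly q x > 0" for q :: "real poly"
  proof -
    have "continuous_on X (poly T)" "continuous_on X (poly q)" by (intro continuous_intros)+
    from perturbation_decreases_sup[OF X(1) this \<open>t > 0\<close> le q(2)]
    obtain \<epsilon> where \<epsilon>: "\<epsilon> > 0" "\<forall>x\<in>X. \<bar>poly T x - \<epsilon> * poly q x\<bar> < t" by blast
    have "degree (T - smult \<epsilon> q) = n" "lead_coeff (T - smult \<epsilon> q) = 1"
    proof -
      have d: "degree (smult \<epsilon> q) < degree T" using q(1) T(1) \<epsilon>(1) by simp
      then show "degree (T - smult \<epsilon> q) = n"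
        using T(1) degree_add_eq_left[of "- smult \<epsilon> q" T] by simp
      then show "lead_coeff (T - smult \<epsilon> q) = 1" using d T coeff_eq_0[OF d] by simp
    qed
    from minimal[OF this] show False using \<epsilon>(2) by force
  qed
  define A where "A s = X \<inter> {x. poly T x = s * t}" for s :: real
  have comp: "compact (A s)" for s
    unfolding A_def by (intro compact_Int_closed X(1) closed_Collect_eq continuous_intros)
  have cover: "x \<in> A 1 \<union> A (- 1)" if "x \<in> X" "\<bar>poly T x\<bar> = t" for x
    using that by (auto simp: A_def abs_if split: if_splits)
  have "A 1 \<union> A (- 1) \<noteq> {}"
  proof
    assume "A 1 \<union> A (- 1) = {}"
    then show False using no_sep[of 1] n cover by fastforce
  qed
  then obtain b where b: "b \<in> A 1 \<union> A (- 1)" "\<And>x. x \<in> A 1 \<union> A (- 1) \<Longrightarrow> x \<le> b"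
    using compact_attains_sup[OF compact_Un[OF comp comp]] by blast
  then obtain s where s: "s = 1 \<or> s = - 1" "b \<in> A s" by blast
  have disj: "A s \<inter> A (- s) = {}" using s(1) \<open>t > 0\<close> by (auto simp: A_def)
  have Un: "A s \<union> A (- s) = A 1 \<union> A (- 1)" using s(1) by auto
  have "\<exists>p\<in>A s. x < p" if "x \<in> A (- s)" for x
    using b(2)[of x] that s(2) disj Un by (intro bexI[of _ b]) (auto simp: less_le)
  with alternation_or_separating_poly[OF comp comp disj, of n] s(2) consider
    y where "\<forall>i<n. y i < y (Suc i)" "\<forall>i\<le>n. y i \<in> (if even (n - i) then A s else A (- s))"
    | q :: "real poly" where "degree q < n" "\<forall>x\<in>A s. poly q x > 0" "\<forall>x\<in>A (- s). poly q x < 0" by blast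
  then have "\<exists>y. (\<forall>i<n. y i < y (Suc i)) \<and> (\<forall>i\<le>n. y i \<in> X \<and> poly T (y i) = (if even (n - i) then s * t else - s * t))"
  proof cases
    case 1
    have "y i \<in> X \<and> poly T (y i) = (if even (n - i) then s * t else - s * t)" if "i \<le> n" for i
      using 1(2)[rule_format, OF that] by (auto simp: A_def split: if_splits)
    then show ?thesis using 1(1) by blast
  next
    case 2
    have "poly T x * poly (smult s q) x > 0" if "x \<in> X" "\<bar>poly T x\<bar> = t" for x
    proof -
      have "x \<in> A s \<or> x \<in> A (- s)" using cover[OF that] Un by blast
      then show ?thesis using 2(2,3) s(1) \<open>t > 0\<close> by (auto simp: A_def mult_pos_neg)
    qed
    then show ?thesis using no_sep[of "smult s q"] 2(1) s(1) by auto
  qed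
  then obtain y where y: "\<And>i. i < n \<Longrightarrow> y i < y (Suc i)"
    "\<And>i. i \<le> n \<Longrightarrow> y i \<in> X" "\<And>i. i \<le> n \<Longrightarrow> poly T (y i) = (if even (n - i) then s * t else - s * t)" by blast
  show ?thesis
  proof (rule that[of T t y])
    show "\<bar>poly T (y i)\<bar> = t" if "i \<le> n" for i
      using s(1) y(3)[OF that] \<open>t > 0\<close> by auto
    show "poly T (y (Suc i)) = - poly T (y i)" if "i < n" for i
    proof -
      have "even (n - Suc i) \<longleftrightarrow> odd (n - i)" using that by (metis Suc_diff_Suc even_Suc)
      then show ?thesis using y(3)[of i] y(3)[of "Suc i"] that by auto
    qed
  qed (use T \<open>t > 0\<close> le y(1,2) in auto)
qed

section \<open>Schoenberg's space-filling curve\<close>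

text \<open>An even function of period 2 that is 0 on \<open>[0, 1/3]\<close> and 1 on \<open>[2/3, 1]\<close>; only these values matter
  for the curve. The truncated cosine makes continuity and periodicity immediate.\<close>

definition schoenberg_wave :: "real \<Rightarrow> real" where
  "schoenberg_wave x = max 0 (min 1 (1 / 2 - cos (pi * x)))"

definition schoenberg_curve :: "real \<Rightarrow> complex" where
  "schoenberg_curve t =
     Complex (\<Sum>k. (1 / 2) ^ Suc k * schoenberg_wave (3 ^ (2 * k) * t))
             (\<Sum>k. (1 / 2) ^ Suc k * schoenberg_wave (3 ^ (2 * k + 1) * t))"

lemma schoenberg_wave_bounds: "0 \<le> schoenberg_wave x" "schoenberg_wave x \<le> 1"
  by (auto simp: schoenberg_wave_def)

lemma continuous_schoenberg_series:
  "continuous_on UNIV (\<lambda>t. \<Sum>k. (1 / 2) ^ Suc k * schoenberg_wave (c k * t))"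
proof (rule uniform_limit_theorem)
  show "uniform_limit UNIV (\<lambda>n t. \<Sum>k<n. (1 / 2) ^ Suc k * schoenberg_wave (c k * t))
     (\<lambda>t. \<Sum>k. (1 / 2) ^ Suc k * schoenberg_wave (c k * t)) sequentially"
    by (rule Weierstrass_m_test[where M = "\<lambda>k. (1 / 2) ^ Suc k"])
       (use schoenberg_wave_bounds in \<open>auto intro!: summable_mult simp: abs_mult mult_left_le\<close>)
  show "\<forall>\<^sub>F n in sequentially. continuous_on UNIV (\<lambda>t. \<Sum>k<n. (1 / 2) ^ Suc k * schoenberg_wave (c k * t))"
    unfolding schoenberg_wave_def by (intro always_eventually allI continuous_intros)
qed simp

lemma continuous_schoenberg_curve: "continuous_on UNIV schoenberg_curve"
proof -
  have "schoenberg_curve = (\<lambda>t. of_real (\<Sum>k. (1 / 2) ^ Suc k * schoenberg_wave (3 ^ (2 * k) * t))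
     + \<i> * of_real (\<Sum>k. (1 / 2) ^ Suc k * schoenberg_wave (3 ^ (2 * k + 1) * t)))"
    by (auto simp: schoenberg_curve_def complex_eq_iff)
  moreover have "continuous_on UNIV \<dots>"
    by (intro continuous_on_add continuous_on_mult continuous_on_const continuous_on_of_real
        continuous_schoenberg_series)
  ultimately show ?thesis by (simp only:)
qed

text \<open>Multiplying by \<open>3\<^sup>k\<close> shifts the ternary digits. Since the digits are 0 or 2, the integer part that
  appears is even and disappears by periodicity, while the following digits change the argument by
  at most \<open>1/3\<close>. So the wave reads off the digit number \<open>k\<close>.\<close>

lemma schoenberg_wave_ternary:
  fixes a :: "nat \<Rightarrow> nat"
  assumes a: "\<And>j. a j \<le> 1"
  defines "t \<equiv> (\<Sum>j. 2 * real (a j) / 3 ^ Suc j)"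
  shows "schoenberg_wave (3 ^ k * t) = real (a k)"
proof -
  define f where "f j = 2 * real (a j) / 3 ^ Suc j" for j
  have le: "f j \<le> (2 / 3) * (1 / 3) ^ j" and f0: "f j \<ge> 0" for j
    using a[of j] by (auto simp: f_def power_one_over divide_simps)
  have sg: "summable (\<lambda>j. (2 / 3) * (1 / 3 :: real) ^ j)" by (intro summable_mult) auto
  have summ: "summable f"
    by (rule summable_comparison_test[OF _ sg]) (use le f0 in auto)
  define r where "r = 3 ^ k * (\<Sum>j. f (j + Suc k))"
  have r0: "0 \<le> r" unfolding r_def by (intro mult_nonneg_nonneg suminf_nonneg summable_ignore_initial_segment summ f0) auto
  have "(\<Sum>j. f (j + Suc k)) \<le> (\<Sum>j. (2 / 3) * (1 / 3) ^ j * (1 / 3) ^ Suc k)"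
    using sg
    by (intro suminf_le summable_ignore_initial_segment summ summable_mult2)
       (use le[of "_ + Suc k"] in \<open>auto simp: power_add mult_ac\<close>)
  also have "\<dots> = (\<Sum>j. (2 / 3) * (1 / 3) ^ j) * (1 / 3) ^ Suc k"
    by (rule suminf_mult2[symmetric, OF sg])
  also have "(\<Sum>j. (2 / 3) * (1 / 3 :: real) ^ j) = 1"
    by (subst suminf_mult) (auto simp: suminf_geometric)
  finally have r1: "r \<le> 1 / 3" unfolding r_def by (simp add: power_one_over field_simps)
  define m where "m = (\<Sum>j<k. a j * 3 ^ (k - Suc j))"
  have "t = (\<Sum>j<Suc k. f j) + (\<Sum>j. f (j + Suc k))"
    using suminf_split_initial_segment[OF summ, of "Suc k"] by (simp add: t_def f_def[abs_def])
  then have "3 ^ k * t = (\<Sum>j<k. 3 ^ k * f j) + 3 ^ k * f k + r"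
    by (simp add: r_def distrib_left sum_distrib_left[symmetric])
  also have "(\<Sum>j<k. 3 ^ k * f j) = real (2 * m)"
  proof -
    have "3 ^ k * f j = 2 * (real (a j) * 3 ^ (k - Suc j))" if "j < k" for j
    proof -
      have "(3::real) ^ k = 3 ^ (k - Suc j) * 3 ^ Suc j" using that by (metis power_add le_add_diff_inverse2 Suc_leI)
      then show ?thesis by (simp add: f_def)
    qed
    then show ?thesis by (simp add: m_def sum_distrib_left)
  qed
  finally have "pi * (3 ^ k * t) = pi * (2 * real (a k) / 3 + r) + real m * (2 * pi)"
    by (simp add: f_def algebra_simps)
  then have cos: "cos (pi * (3 ^ k * t)) = cos (pi * (2 * real (a k) / 3 + r))"
    using cos.plus_of_nat[of "pi * (2 * real (a k) / 3 + r)" m] by simp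
  consider "a k = 0" | "a k = 1" using a[of k] by linarith
  then show ?thesis
  proof cases
    case 1
    have "cos (pi * r) \<ge> cos (pi / 3)"
      using r0 r1 by (intro cos_monotone_0_pi_le) auto
    then show ?thesis using cos 1 by (simp add: schoenberg_wave_def cos_60)
  next
    case 2
    have "cos (pi * (2 / 3 + r)) \<le> cos (2 * pi / 3)"
      using r0 r1 by (intro cos_monotone_0_pi_le) (auto simp: field_simps)
    then show ?thesis using cos 2 by (simp add: schoenberg_wave_def cos_120)
  qed
qed

lemma binary_expansion_exists:
  fixes x :: real
  assumes "0 \<le> x" "x < 1"
  obtains a :: "nat \<Rightarrow> nat" where "\<And>k. a k \<le> 1" "(\<lambda>k. (1 / 2) ^ Suc k * real (a k)) sums x"
proof -
  define b where "b k = \<lfloor>2 ^ Suc k * x\<rfloor> - 2 * \<lfloor>2 ^ k * x\<rfloor>" for k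
  have b: "0 \<le> b k" "b k \<le> 1" for k
  proof -
    define y where "y = 2 ^ k * x"
    have "b k = \<lfloor>2 * y\<rfloor> - 2 * \<lfloor>y\<rfloor>" by (simp add: b_def y_def mult.assoc)
    then show "0 \<le> b k" "b k \<le> 1" by linarith+
  qed
  have partial: "(\<Sum>k<n. (1 / 2) ^ Suc k * real (nat (b k))) = \<lfloor>2 ^ n * x\<rfloor> / 2 ^ n" for n
  proof (induction n)
    case 0
    have "\<lfloor>x\<rfloor> = 0" using assms by linarith
    then show ?case by simp
  next
    case (Suc n)
    have "real (nat (b n)) = real_of_int \<lfloor>2 ^ Suc n * x\<rfloor> - 2 * real_of_int \<lfloor>2 ^ n * x\<rfloor>"
      using b[of n] by (simp add: b_def)
    then show ?case using Suc by (simp add: power_one_over field_simps)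
  qed
  have "(\<lambda>n. \<lfloor>2 ^ n * x\<rfloor> / 2 ^ n) \<longlonglongrightarrow> x"
  proof (rule tendsto_sandwich)
    show "\<forall>\<^sub>F n in sequentially. x - (1 / 2) ^ n \<le> \<lfloor>2 ^ n * x\<rfloor> / 2 ^ n"
    proof (intro always_eventually allI)
      fix n :: nat
      have "2 ^ n * x - 1 \<le> \<lfloor>2 ^ n * x\<rfloor>" by linarith
      then have "(2 ^ n * x - 1) / 2 ^ n \<le> \<lfloor>2 ^ n * x\<rfloor> / 2 ^ n" by (intro divide_right_mono) auto
      then show "x - (1 / 2) ^ n \<le> \<lfloor>2 ^ n * x\<rfloor> / 2 ^ n" by (simp add: power_one_over diff_divide_distrib)
    qed
    show "\<forall>\<^sub>F n in sequentially. \<lfloor>2 ^ n * x\<rfloor> / 2 ^ n \<le> x"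
    proof (intro always_eventually allI)
      fix n :: nat
      have "\<lfloor>2 ^ n * x\<rfloor> \<le> 2 ^ n * x" by linarith
      then show "\<lfloor>2 ^ n * x\<rfloor> / 2 ^ n \<le> x" by (simp add: field_simps)
    qed
    have "(\<lambda>n. x - (1 / 2) ^ n) \<longlonglongrightarrow> x - 0"
      by (intro tendsto_intros LIMSEQ_power_zero) auto
    then show "(\<lambda>n. x - (1 / 2) ^ n) \<longlonglongrightarrow> x" by simp
  qed auto
  then have "(\<lambda>k. (1 / 2) ^ Suc k * real (nat (b k))) sums x"
    unfolding sums_def partial .
  then show ?thesis by (rule that[rotated]) (use b(2) in \<open>simp add: nat_le_iff\<close>)
qed

text \<open>The two coordinates of the curve use the digits with even and with odd index. Interleaving the
  binary digits of the coordinates of a point therefore gives a parameter that is mapped to this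
  point.\<close>

lemma schoenberg_curve_covers_square:
  assumes "0 \<le> Re z" "Re z < 1" "0 \<le> Im z" "Im z < 1"
  shows "z \<in> schoenberg_curve ` {0..1}"
proof -
  obtain a :: "nat \<Rightarrow> nat" where a: "\<And>k. a k \<le> 1" "(\<lambda>k. (1 / 2) ^ Suc k * real (a k)) sums Re z"
    using binary_expansion_exists[OF assms(1,2)] by blast
  obtain b :: "nat \<Rightarrow> nat" where b: "\<And>k. b k \<le> 1" "(\<lambda>k. (1 / 2) ^ Suc k * real (b k)) sums Im z"
    using binary_expansion_exists[OF assms(3,4)] by blast
  define c where "c j = (if even j then a (j div 2) else b (j div 2))" for j
  have c: "c j \<le> 1" for j using a(1) b(1) by (simp add: c_def)
  define t where "t = (\<Sum>j. 2 * real (c j) / 3 ^ Suc j)"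
  have wave: "schoenberg_wave (3 ^ k * t) = real (c k)" for k
    unfolding t_def by (rule schoenberg_wave_ternary[OF c])
  have "schoenberg_curve t = z"
  proof (rule complex_eqI)
    show "Re (schoenberg_curve t) = Re z"
      using sums_unique[OF a(2)] by (simp only: schoenberg_curve_def wave complex.sel) (simp add: c_def)
    show "Im (schoenberg_curve t) = Im z"
      using sums_unique[OF b(2)] by (simp only: schoenberg_curve_def wave complex.sel) (simp add: c_def)
  qed
  moreover have "t \<in> {0..1}"
  proof -
    have sg: "summable (\<lambda>j. (2 / 3) * (1 / 3 :: real) ^ j)" by (intro summable_mult) auto
    have le: "2 * real (c j) / 3 ^ Suc j \<le> (2 / 3) * (1 / 3) ^ j" for j
      using c[of j] by (auto simp: power_one_over divide_simps)
    have summ: "summable (\<lambda>j. 2 * real (c j) / 3 ^ Suc j)"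
      by (rule summable_comparison_test[OF _ sg]) (use le in auto)
    have "t \<le> (\<Sum>j. (2 / 3) * (1 / 3) ^ j)"
      unfolding t_def by (intro suminf_le le summ sg)
    also have "(\<Sum>j. (2 / 3) * (1 / 3 :: real) ^ j) = 1"
      by (subst suminf_mult) (auto simp: suminf_geometric)
    finally show ?thesis using suminf_nonneg[OF summ] by (simp add: t_def)
  qed
  ultimately show ?thesis by blast
qed

lemma bounded_subset_curve_image:
  fixes L :: "complex set"
  assumes "bounded L"
  obtains \<phi> :: "real \<Rightarrow> complex" where "continuous_on UNIV \<phi>" "L \<subseteq> \<phi> ` {0..1}"
proof -
  obtain B where B: "B > 0" "\<And>z. z \<in> L \<Longrightarrow> cmod z \<le> B"
    using assms bounded_pos by metis
  \<comment> \<open>Scaling moves the bounded set into \<open>[1/4, 3/4]\<^sup>2\<close>, inside the half-open unit square.\<close>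
  define s where "s = Complex (1/2) (1/2)"
  define \<phi> where "\<phi> t = of_real (4 * B) * (schoenberg_curve t - s)" for t
  show ?thesis
  proof
    show "continuous_on UNIV \<phi>"
      unfolding \<phi>_def by (intro continuous_intros continuous_schoenberg_curve)
    show "L \<subseteq> \<phi> ` {0..1}"
    proof
      fix z assume z: "z \<in> L"
      define v where "v = z / of_real (4 * B) + s"
      have "\<bar>Re z\<bar> \<le> B" "\<bar>Im z\<bar> \<le> B"
        using B(2)[OF z] abs_Re_le_cmod[of z] abs_Im_le_cmod[of z] by linarith+
      then have "\<bar>Re z / (4 * B)\<bar> \<le> 1 / 4" "\<bar>Im z / (4 * B)\<bar> \<le> 1 / 4"
        using B(1) by (auto simp: abs_divide field_simps)
      moreover have "Re v = Re z / (4 * B) + 1 / 2" "Im v = Im z / (4 * B) + 1 / 2"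
        unfolding v_def s_def by (simp_all del: of_real_mult)
      ultimately have "0 \<le> Re v" "Re v < 1" "0 \<le> Im v" "Im v < 1" by linarith+
      then obtain t where t: "t \<in> {0..1}" "v = schoenberg_curve t"
        using schoenberg_curve_covers_square by blast
      have "\<phi> t = z"
        using B(1) unfolding \<phi>_def t(2)[symmetric] v_def by (simp add: field_simps)
      then show "z \<in> \<phi> ` {0..1}" using t(1) by blast
    qed
  qed
qed

section \<open>Capacity from point configurations\<close>

text \<open>Weak sequential compactness for counting measures on a compact plane set, tested on functions of
  two variables. The points are lifted to \<open>[0, 1]\<close> along the curve, where Helly's theorem applies;
  Skorohod's theorem then replaces weak convergence by pointwise convergence of random variables,
  which passes to products and allows dominated convergence in both variables.\<close>

lemma empirical_measures_weak_limit:
  fixes L :: "complex set" and z :: "nat \<Rightarrow> nat \<Rightarrow> complex"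
  assumes L: "compact L" and z: "\<And>n i. i \<le> n \<Longrightarrow> z n i \<in> L"
  obtains \<mu> r where "\<mu> \<in> prob_measures_on L" "strict_mono r"
    "\<And>f B. continuous_on UNIV (\<lambda>p. f (fst p) (snd p)) \<Longrightarrow> (\<And>x y. \<bar>f x y\<bar> \<le> B) \<Longrightarrow>
       (\<lambda>n. (\<Sum>i\<le>r n. \<Sum>j\<le>r n. f (z (r n) i) (z (r n) j)) / real (Suc (r n)) ^ 2)
          \<longlonglongrightarrow> (\<integral>x. (\<integral>y. f x y \<partial>\<mu>) \<partial>\<mu>)"
proof -
  obtain \<phi> :: "real \<Rightarrow> complex" where \<phi>: "continuous_on UNIV \<phi>" "L \<subseteq> \<phi> ` {0..1}"
    using bounded_subset_curve_image compact_imp_bounded[OF L] by blast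
  have "\<exists>t\<in>{0..1}. i \<le> n \<longrightarrow> \<phi> t = z n i" for n i
  proof (cases "i \<le> n")
    case True
    then obtain t where "t \<in> {0..1}" "z n i = \<phi> t" using z[OF True] \<phi>(2) by blast
    then show ?thesis by auto
  qed (auto intro: bexI[of _ 0])
  then obtain s where s: "\<And>n i. s n i \<in> {0..1}" "\<And>n i. i \<le> n \<Longrightarrow> \<phi> (s n i) = z n i"
  proof -
    assume *: "\<And>s. (\<And>n i. s n i \<in> {0..1}) \<Longrightarrow> (\<And>n i. i \<le> n \<Longrightarrow> \<phi> (s n i) = z n i) \<Longrightarrow> thesis"
    have "\<exists>s. \<forall>n i. s n i \<in> {0..1} \<and> (i \<le> n \<longrightarrow> \<phi> (s n i) = z n i)"
      using \<open>\<And>n i. \<exists>t\<in>{0..1}. i \<le> n \<longrightarrow> \<phi> t = z n i\<close> unfolding Bex_def by (intro choice allI) blast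
    with * show thesis by blast
  qed
  define P where "P n = measure_pmf (pmf_of_set {..n::nat})" for n
  define \<nu> where "\<nu> n = distr (P n) borel (s n)" for n
  have sm [measurable]: "s n \<in> borel_measurable (P n)" for n by (simp add: P_def)
  have \<phi>m [measurable]: "\<phi> \<in> borel_measurable borel"
    using \<phi>(1) by (simp add: borel_measurable_continuous_onI)
  have int\<nu>: "(\<integral>t. g (\<phi> t) \<partial>\<nu> n) = (\<Sum>i\<le>n. g (z n i)) / real (Suc n)"
    if [measurable]: "g \<in> borel_measurable borel" for g :: "complex \<Rightarrow> real" and n
  proof -
    have "(\<integral>t. g (\<phi> t) \<partial>\<nu> n) = (\<integral>i. g (\<phi> (s n i)) \<partial>P n)"
      unfolding \<nu>_def by (intro integral_distr) measurable
    also have "\<dots> = (\<Sum>i\<le>n. g (\<phi> (s n i))) / real (Suc n)"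
      unfolding P_def by (subst integral_pmf_of_set) auto
    also have "(\<Sum>i\<le>n. g (\<phi> (s n i))) = (\<Sum>i\<le>n. g (z n i))"
      by (intro sum.cong) (auto simp: s(2))
    finally show ?thesis .
  qed
  have prob\<nu>: "prob_space (\<nu> n)" for n
    unfolding \<nu>_def P_def by (intro measure_pmf.prob_space_distr) simp
  have rd: "real_distribution (\<nu> n)" for n
    using prob\<nu>[of n] by (auto simp: real_distribution_def real_distribution_axioms_def \<nu>_def)
  have AE\<nu>: "AE t in \<nu> n. \<phi> t \<in> L" for n
  proof -
    have "AE i in P n. \<phi> (s n i) \<in> L"
      unfolding P_def by (subst AE_measure_pmf_iff) (use s(2) z in auto)
    moreover have "{t. \<phi> t \<in> L} \<in> sets borel"
      using measurable_sets[OF \<phi>m, of L] compact_imp_closed[OF L] by (simp add: vimage_def)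
    ultimately show ?thesis
      unfolding \<nu>_def by (subst AE_distr_iff) auto
  qed
  have "tight \<nu>"
    unfolding tight_def
  proof (intro conjI allI impI)
    fix \<epsilon> :: real assume \<epsilon>: "0 < \<epsilon>"
    have "measure (\<nu> n) {- 1<..2} = 1" for n
    proof -
      have s2: "- 1 < s n i" "s n i \<le> 2" for i using s(1)[of n i] by auto
      have "measure (\<nu> n) {- 1<..2} = measure (P n) (s n -` {- 1<..2} \<inter> space (P n))"
        unfolding \<nu>_def by (rule measure_distr) auto
      also have "s n -` {- 1<..2} \<inter> space (P n) = space (P n)" using s2 by auto
      finally show ?thesis by (simp add: P_def)
    qed
    then show "\<exists>a b. a < b \<and> (\<forall>n. 1 - \<epsilon> < measure (\<nu> n) {a<..b})"
      using \<epsilon> by (intro exI[of _ "-1"] exI[of _ 2]) auto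
  qed (rule rd)
  then obtain r M where r: "strict_mono (r :: nat \<Rightarrow> nat)" "real_distribution M"
      "weak_conv_m (\<nu> \<circ> id \<circ> r) M"
    using tight_imp_convergent_subsubsequence[of \<nu> id] by (auto simp: strict_mono_id)
  then have wc: "weak_conv_m (\<lambda>n. \<nu> (r n)) M" by (simp add: comp_def)
  obtain \<Omega> :: "real measure" and Y :: "nat \<Rightarrow> real \<Rightarrow> real" and Ylim :: "real \<Rightarrow> real" where
    \<Omega>: "prob_space \<Omega>" and Y [measurable]: "\<And>n. Y n \<in> borel_measurable \<Omega>"
    and dY: "\<And>n. distr \<Omega> borel (Y n) = \<nu> (r n)" and Yi: "Ylim \<in> measurable \<Omega> lborel"
    and lim: "\<And>x. x \<in> space \<Omega> \<Longrightarrow> (\<lambda>n. Y n x) \<longlonglongrightarrow> Ylim x"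
    using Skorohod[OF rd r(2) wc] by blast
  have Yi' [measurable]: "Ylim \<in> borel_measurable \<Omega>" using Yi by simp
  interpret \<Omega>: prob_space \<Omega> by fact
  define Z where "Z n x = \<phi> (Y n x)" for n x
  define Zi where "Zi x = \<phi> (Ylim x)" for x
  have [measurable]: "Z n \<in> borel_measurable \<Omega>" "Zi \<in> borel_measurable \<Omega>" for n
    unfolding Z_def[abs_def] Zi_def[abs_def] by measurable
  have limZ: "(\<lambda>n. Z n x) \<longlonglongrightarrow> Zi x" if "x \<in> space \<Omega>" for x
    unfolding Z_def Zi_def
    by (rule continuous_on_tendsto_compose[OF \<phi>(1) lim[OF that]]) auto
  have "AE x in \<Omega>. Z n x \<in> L" for n
    using AE\<nu>[of "r n"] unfolding dY[symmetric] Z_def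
    by (rule AE_distrD[rotated]) measurable
  then have "AE x in \<Omega>. \<forall>n. Z n x \<in> L" by (simp add: AE_all_countable)
  then have AEL: "AE x in \<Omega>. Zi x \<in> L"
    using AE_space
  proof eventually_elim
    case (elim x)
    then show ?case
      using closed_sequentially[OF compact_imp_closed[OF L], of "\<lambda>n. Z n x"] limZ[of x] by auto
  qed
  define \<mu> where "\<mu> = distr \<Omega> borel Zi"
  have p\<mu>: "prob_space \<mu>" unfolding \<mu>_def by (rule \<Omega>.prob_space_distr) measurable
  have LB: "L \<in> sets borel" using compact_imp_closed[OF L] by simp
  have intZ: "(\<integral>x. g (Z n x) \<partial>\<Omega>) = (\<Sum>i\<le>r n. g (z (r n) i)) / real (Suc (r n))"
    if [measurable]: "g \<in> borel_measurable borel" for g :: "complex \<Rightarrow> real" and n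
  proof -
    have "(\<integral>t. g (\<phi> t) \<partial>distr \<Omega> borel (Y n)) = (\<integral>x. g (\<phi> (Y n x)) \<partial>\<Omega>)"
      by (intro integral_distr) measurable
    then show ?thesis using int\<nu>[OF that, of "r n"] by (simp add: dY Z_def)
  qed
  show ?thesis
  proof (rule that[OF _ r(1)])
    have "emeasure \<mu> L = 1"
      unfolding \<mu>_def using AEL
      by (subst emeasure_distr) (auto intro!: \<Omega>.emeasure_eq_1_AE measurable_sets[where A = borel] simp: LB)
    then show "\<mu> \<in> prob_measures_on L"
      unfolding prob_measures_on_def using p\<mu> by (simp add: \<mu>_def)
    fix f :: "complex \<Rightarrow> complex \<Rightarrow> real" and B
    assume f: "continuous_on UNIV (\<lambda>p. f (fst p) (snd p))" and B: "\<And>x y. \<bar>f x y\<bar> \<le> B"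
    have fm: "(\<lambda>p. f (fst p) (snd p)) \<in> borel_measurable (borel \<Otimes>\<^sub>M borel)"
      using borel_measurable_continuous_onI[OF f] by (simp add: borel_prod)
    have fm2 [measurable (raw)]: "(\<lambda>x. f (g x) (h x)) \<in> borel_measurable N"
      if "g \<in> borel_measurable N" "h \<in> borel_measurable N" for g h and N :: "'c measure"
      using measurable_compose[OF measurable_Pair[OF that] fm] by simp
    have f1: "(\<lambda>n. f (u n) (v n)) \<longlonglongrightarrow> f a b" if "u \<longlonglongrightarrow> a" "v \<longlonglongrightarrow> b" for u v a b
      using continuous_on_tendsto_compose[OF f tendsto_Pair[OF that]] by simp
    have inner: "(\<lambda>n. \<integral>y. f (Z n x) (Z n y) \<partial>\<Omega>) \<longlonglongrightarrow> (\<integral>y. f (Zi x) (Zi y) \<partial>\<Omega>)"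
      if x: "x \<in> space \<Omega>" for x
    proof (rule integral_dominated_convergence[where w = "\<lambda>_. B"])
      show "AE y in \<Omega>. (\<lambda>n. f (Z n x) (Z n y)) \<longlonglongrightarrow> f (Zi x) (Zi y)"
        by (intro AE_I2 f1 limZ x)
    qed (use B in auto)
    have "0 \<le> B" using B[of 0 0] by linarith
    have bd: "\<bar>\<integral>y. f a (Z n y) \<partial>\<Omega>\<bar> \<le> B" for a n
    proof -
      have "\<bar>\<integral>y. f a (Z n y) \<partial>\<Omega>\<bar> \<le> (\<integral>y. \<bar>f a (Z n y)\<bar> \<partial>\<Omega>)" by (rule integral_abs_bound)
      also have "\<dots> \<le> (\<integral>y. B \<partial>\<Omega>)"
        by (intro integral_mono \<Omega>.integrable_const_bound[where B = B]) (use B \<open>0 \<le> B\<close> in auto)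
      finally show ?thesis by (simp add: \<Omega>.prob_space)
    qed
    have outer: "(\<lambda>n. \<integral>x. (\<integral>y. f (Z n x) (Z n y) \<partial>\<Omega>) \<partial>\<Omega>) \<longlonglongrightarrow> (\<integral>x. (\<integral>y. f (Zi x) (Zi y) \<partial>\<Omega>) \<partial>\<Omega>)"
    proof (rule integral_dominated_convergence[where w = "\<lambda>_. B"])
      show "AE x in \<Omega>. (\<lambda>n. \<integral>y. f (Z n x) (Z n y) \<partial>\<Omega>) \<longlonglongrightarrow> (\<integral>y. f (Zi x) (Zi y) \<partial>\<Omega>)"
        using inner by (intro AE_I2)
    qed (use bd in auto)
    have lhs: "(\<integral>x. (\<integral>y. f (Z n x) (Z n y) \<partial>\<Omega>) \<partial>\<Omega>)
        = (\<Sum>i\<le>r n. \<Sum>j\<le>r n. f (z (r n) i) (z (r n) j)) / real (Suc (r n)) ^ 2" for n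
    proof -
      have "(\<integral>y. f (Z n x) (Z n y) \<partial>\<Omega>) = (\<Sum>j\<le>r n. f (Z n x) (z (r n) j)) / real (Suc (r n))" for x
        by (rule intZ[of "f (Z n x)"]) measurable
      moreover have "(\<integral>x. (\<Sum>j\<le>r n. f (Z n x) (z (r n) j)) / real (Suc (r n)) \<partial>\<Omega>) =
         (\<Sum>i\<le>r n. (\<Sum>j\<le>r n. f (z (r n) i) (z (r n) j)) / real (Suc (r n))) / real (Suc (r n))"
        by (rule intZ[of "\<lambda>w. (\<Sum>j\<le>r n. f w (z (r n) j)) / real (Suc (r n))"]) measurable
      ultimately show ?thesis by (simp add: sum_divide_distrib[symmetric] power2_eq_square)
    qed
    have "(\<integral>x. (\<integral>y. f x y \<partial>\<mu>) \<partial>\<mu>) = (\<integral>x. (\<integral>y. f (Zi x) y \<partial>\<mu>) \<partial>\<Omega>)"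
    proof -
      interpret \<mu>: prob_space \<mu> by (rule p\<mu>)
      have "sets \<mu> = sets borel" by (simp add: \<mu>_def)
      then have [measurable_cong]: "sets \<mu> = sets borel" .
      define g where "g x = (\<integral>y. f x y \<partial>\<mu>)" for x
      have "g \<in> borel_measurable borel" unfolding g_def[abs_def] by measurable
      then have "(\<integral>x. g x \<partial>\<mu>) = (\<integral>x. g (Zi x) \<partial>\<Omega>)"
        unfolding \<mu>_def by (intro integral_distr) measurable
      then show ?thesis by (simp add: g_def)
    qed
    also have "\<dots> = (\<integral>x. (\<integral>y. f (Zi x) (Zi y) \<partial>\<Omega>) \<partial>\<Omega>)"
      unfolding \<mu>_def by (intro Bochner_Integration.integral_cong refl integral_distr) measurable
    finally show "(\<lambda>n. (\<Sum>i\<le>r n. \<Sum>j\<le>r n. f (z (r n) i) (z (r n) j)) / real (Suc (r n)) ^ 2)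
          \<longlonglongrightarrow> (\<integral>x. (\<integral>y. f x y \<partial>\<mu>) \<partial>\<mu>)"
      using outer unfolding lhs by simp
  qed
qed

text \<open>Monotone convergence applied to the truncations of the positive part of the kernel; the truncation
  at \<open>D\<close> has no effect on \<open>L\<close> and only keeps the integrands bounded on the whole plane.\<close>

lemma log_energy_le_of_truncated:
  fixes \<mu> :: "complex measure"
  assumes \<mu>: "\<mu> \<in> prob_measures_on L" and L: "compact L"
    and D: "D \<ge> 1" "\<And>z w. z \<in> L \<Longrightarrow> w \<in> L \<Longrightarrow> dist z w \<le> D"
    and le: "\<And>m::nat. (\<integral>z. (\<integral>w. - ln (max (exp (- real m)) (min D (dist z w))) \<partial>\<mu>) \<partial>\<mu>) \<le> V"
  shows "log_energy \<mu> \<le> ereal V"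
proof -
  interpret \<mu>: prob_space \<mu> using \<mu> by (simp add: prob_measures_on_def)
  have [measurable_cong]: "sets \<mu> = sets borel" using \<mu> by (simp add: prob_measures_on_def)
  have AEL: "AE z in \<mu>. z \<in> L"
  proof (rule \<mu>.AE_prob_1)
    show "\<mu>.prob L = 1" using \<mu> by (simp add: prob_measures_on_def measure_def)
  qed
  define \<kappa> where "\<kappa> m d = - ln (max (exp (- real m)) (min D d))" for m :: nat and d :: real
  have \<kappa>_bounds: "- ln D \<le> \<kappa> m d" "\<kappa> m d \<le> real m" for m d
  proof -
    have "max (exp (- real m)) (min D d) \<le> D" using D(1) by (auto simp: order.trans[of _ 1])
    then show "- ln D \<le> \<kappa> m d" unfolding \<kappa>_def using D(1)
      by (subst neg_le_iff_le, subst ln_le_cancel_iff) (simp_all add: less_max_iff_disj)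
    have "ln (exp (- real m)) \<le> ln (max (exp (- real m)) (min D d))" by (subst ln_le_cancel_iff) (simp_all add: less_max_iff_disj)
    then show "\<kappa> m d \<le> real m" unfolding \<kappa>_def by simp
  qed
  have \<kappa>m [measurable]: "\<kappa> m \<in> borel_measurable borel" for m unfolding \<kappa>_def[abs_def] by measurable
  \<comment> \<open>The lower truncation affects only values of the distance below 1, so the negative part does not depend on \<open>m\<close>.\<close>
  have neg: "max 0 (- \<kappa> m d) = max 0 (- \<kappa> 0 d)" for m d
  proof (cases "min D d \<ge> 1")
    case True
    moreover have "exp (- real m) \<le> 1" by simp
    moreover have "exp (- real 0) = 1" by simp
    ultimately have "max (exp (- real m)) (min D d) = min D d" "max (exp (- real 0)) (min D d) = min D d"
      by - (rule max_absorb2, linarith)+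
    then show ?thesis by (simp add: \<kappa>_def)
  next
    case False
    have "exp (- real m) \<le> 1" by simp
    moreover have "min D d \<le> 1" using False by linarith
    ultimately have "max (exp (- real m)) (min D d) \<le> 1" "max (exp (- real 0)) (min D d) \<le> 1"
      by simp_all
    then have "ln (max (exp (- real m)) (min D d)) \<le> 0" "ln (max (exp (- real 0)) (min D d)) \<le> 0"
      by (simp_all add: ln_le_zero_iff less_max_iff_disj)
    then show ?thesis by (simp add: \<kappa>_def)
  qed
  let ?p = "\<lambda>m z w. max 0 (\<kappa> m (dist z w))" and ?q = "\<lambda>z w. max 0 (- \<kappa> 0 (dist z w))"
  define A where "A m = (\<integral>z. (\<integral>w. ?p m z w \<partial>\<mu>) \<partial>\<mu>)" for m
  define B where "B = (\<integral>z. (\<integral>w. ?q z w \<partial>\<mu>) \<partial>\<mu>)"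
  have int_in: "integrable \<mu> f" if "f \<in> borel_measurable borel" "\<And>w. \<bar>f w\<bar> \<le> c" for f :: "complex \<Rightarrow> real" and c
    by (rule \<mu>.integrable_const_bound[where B = c]) (use that in auto)
  have bd_in: "\<bar>\<integral>w. f w \<partial>\<mu>\<bar> \<le> c" if "f \<in> borel_measurable borel" "\<And>w. \<bar>f w\<bar> \<le> c" for f :: "complex \<Rightarrow> real" and c
  proof -
    have "\<bar>\<integral>w. f w \<partial>\<mu>\<bar> \<le> (\<integral>w. \<bar>f w\<bar> \<partial>\<mu>)" by (rule integral_abs_bound)
    also have "\<dots> \<le> (\<integral>w. c \<partial>\<mu>)"
      using that by (intro integral_mono int_in integrable_abs) auto
    finally show ?thesis by (simp add: \<mu>.prob_space)
  qed
  have posb: "\<bar>max 0 (\<kappa> m d)\<bar> \<le> real m" for m d using \<kappa>_bounds[of m d] by auto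
  have negb: "\<bar>max 0 (- \<kappa> m d)\<bar> \<le> ln D" for m d using \<kappa>_bounds(1)[of m d] D(1) by auto
  have I1: "integrable \<mu> (\<lambda>w. ?p m z w)" for m z
    by (rule int_in[OF _ posb]) measurable
  have I2: "integrable \<mu> (\<lambda>w. ?q z w)" for z
    by (rule int_in[OF _ negb]) measurable
  have J1: "integrable \<mu> (\<lambda>z. \<integral>w. ?p m z w \<partial>\<mu>)" for m
    by (rule int_in[OF _ bd_in[OF _ posb]]) measurable
  have J2: "integrable \<mu> (\<lambda>z. \<integral>w. ?q z w \<partial>\<mu>)"
    by (rule int_in[OF _ bd_in[OF _ negb]]) measurable
  have AB: "A m - B \<le> V" for m
  proof -
    have "(\<integral>z. (\<integral>w. \<kappa> m (dist z w) \<partial>\<mu>) \<partial>\<mu>)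
        = (\<integral>z. (\<integral>w. ?p m z w \<partial>\<mu>) - (\<integral>w. ?q z w \<partial>\<mu>) \<partial>\<mu>)"
    proof (intro Bochner_Integration.integral_cong refl)
      fix z
      have "(\<integral>w. \<kappa> m (dist z w) \<partial>\<mu>) = (\<integral>w. ?p m z w - ?q z w \<partial>\<mu>)"
        unfolding neg[of m, symmetric] by (intro Bochner_Integration.integral_cong) auto
      also have "\<dots> = (\<integral>w. ?p m z w \<partial>\<mu>) - (\<integral>w. ?q z w \<partial>\<mu>)"
        by (rule Bochner_Integration.integral_diff[OF I1 I2])
      finally show "(\<integral>w. \<kappa> m (dist z w) \<partial>\<mu>) = \<dots>" .
    qed
    also have "\<dots> = A m - B"
      unfolding A_def B_def
      by (rule Bochner_Integration.integral_diff[OF J1 J2])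
    finally show ?thesis using le[of m] by (simp add: \<kappa>_def)
  qed
  have nnA: "(\<integral>\<^sup>+z. (\<integral>\<^sup>+w. ennreal (?p m z w) \<partial>\<mu>) \<partial>\<mu>) = ennreal (A m)" for m
  proof -
    have "(\<integral>\<^sup>+w. ennreal (?p m z w) \<partial>\<mu>) = ennreal (\<integral>w. ?p m z w \<partial>\<mu>)" for z
      by (intro nn_integral_eq_integral I1) auto
    moreover have "(\<integral>\<^sup>+z. ennreal (\<integral>w. ?p m z w \<partial>\<mu>) \<partial>\<mu>) = ennreal (A m)"
      unfolding A_def by (intro nn_integral_eq_integral J1) auto
    ultimately show ?thesis by simp
  qed
  have nnB: "(\<integral>\<^sup>+z. (\<integral>\<^sup>+w. ennreal (?q z w) \<partial>\<mu>) \<partial>\<mu>) = ennreal B"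
  proof -
    have "(\<integral>\<^sup>+w. ennreal (?q z w) \<partial>\<mu>) = ennreal (\<integral>w. ?q z w \<partial>\<mu>)" for z
      by (intro nn_integral_eq_integral I2) auto
    moreover have "(\<integral>\<^sup>+z. ennreal (\<integral>w. ?q z w \<partial>\<mu>) \<partial>\<mu>) = ennreal B"
      unfolding B_def by (intro nn_integral_eq_integral J2) auto
    ultimately show ?thesis by simp
  qed
  have B0: "B \<ge> 0" unfolding B_def by (intro Bochner_Integration.integral_nonneg) auto
  have BD: "B \<le> ln D"
  proof -
    have "\<bar>B\<bar> \<le> ln D" unfolding B_def by (rule bd_in[OF _ bd_in[OF _ negb]]) measurable
    then show ?thesis by simp
  qed
  have kneg: "(\<integral>\<^sup>+z. (\<integral>\<^sup>+w. e2ennreal (- log_kernel z w) \<partial>\<mu>) \<partial>\<mu>) = ennreal B"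
    unfolding nnB[symmetric]
  proof (rule nn_integral_cong_AE, use AEL in eventually_elim, rule nn_integral_cong_AE, use AEL in eventually_elim)
    fix z w assume zw: "z \<in> L" "w \<in> L"
    show "e2ennreal (- log_kernel z w) = ennreal (max 0 (- \<kappa> 0 (dist z w)))"
    proof (cases "z = w")
      case True
      then show ?thesis using D(1) by (simp add: log_kernel_def \<kappa>_def e2ennreal_neg)
    next
      case False
      then have d: "dist z w > 0" "dist z w \<le> D" using D(2)[OF zw] by auto
      have "max 0 (- \<kappa> 0 (dist z w)) = max 0 (ln (dist z w))"
        using d by (cases "dist z w \<ge> 1") (auto simp: \<kappa>_def max_def min_def)
      then show ?thesis using False by (simp add: log_kernel_def dist_norm max_def ennreal_neg)
    qed
  qed
  have kpos: "(\<integral>\<^sup>+z. (\<integral>\<^sup>+w. e2ennreal (log_kernel z w) \<partial>\<mu>) \<partial>\<mu>) \<le> ennreal (V + B)"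
  proof -
    have le_SUP: "e2ennreal (log_kernel z w) \<le> (SUP m. ennreal (?p m z w))"
      if zw: "z \<in> L" "w \<in> L" for z w
    proof (cases "z = w")
      case True
      have "\<kappa> m 0 = real m" for m using D(1) by (simp add: \<kappa>_def max_def min_def)
      then have "(SUP m. ennreal (?p m z w)) = (SUP m::nat. of_nat m)"
        using True by (simp add: ennreal_of_nat_eq_real_of_nat)
      then have "(SUP m. ennreal (?p m z w)) = top"
        by (simp only: ennreal_SUP_of_nat_eq_top)
      then show ?thesis by (simp only: top_greatest)
    next
      case False
      then have d: "dist z w > 0" "dist z w \<le> D" using D(2)[OF zw] by auto
      define m where "m = nat \<lceil>- ln (dist z w)\<rceil>"
      have "- real m \<le> ln (dist z w)" unfolding m_def by linarith
      then have "exp (- real m) \<le> dist z w" using d(1) by (metis exp_le_cancel_iff exp_ln)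
      then have "\<kappa> m (dist z w) = - ln (dist z w)" using d by (simp add: \<kappa>_def max_def min_def)
      then have "e2ennreal (log_kernel z w) \<le> ennreal (?p m z w)"
        using False by (auto simp: log_kernel_def dist_norm intro!: ennreal_leI)
      then show ?thesis by (rule SUP_upper2[OF UNIV_I])
    qed
    have \<kappa>_mono: "\<kappa> m d \<le> \<kappa> n d" if "m \<le> n" for m n d
    proof -
      have "max (exp (- real n)) (min D d) \<le> max (exp (- real m)) (min D d)"
        using that by (intro max.mono) auto
      then show ?thesis unfolding \<kappa>_def by (simp add: less_max_iff_disj)
    qed
    have "(\<integral>\<^sup>+z. (\<integral>\<^sup>+w. e2ennreal (log_kernel z w) \<partial>\<mu>) \<partial>\<mu>)
        \<le> (\<integral>\<^sup>+z. (\<integral>\<^sup>+w. (SUP m. ennreal (?p m z w)) \<partial>\<mu>) \<partial>\<mu>)"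
      by (rule nn_integral_mono_AE, use AEL in eventually_elim, rule nn_integral_mono_AE, use AEL in eventually_elim)
         (rule le_SUP)
    also have "\<dots> = (\<integral>\<^sup>+z. (SUP m. \<integral>\<^sup>+w. ennreal (?p m z w) \<partial>\<mu>) \<partial>\<mu>)"
      by (intro nn_integral_cong nn_integral_monotone_convergence_SUP)
         (auto simp: incseq_def le_fun_def intro!: ennreal_leI max.mono \<kappa>_mono)
    also have "\<dots> = (SUP m. \<integral>\<^sup>+z. (\<integral>\<^sup>+w. ennreal (?p m z w) \<partial>\<mu>) \<partial>\<mu>)"
      by (intro nn_integral_monotone_convergence_SUP)
         (auto simp: incseq_def le_fun_def intro!: nn_integral_mono ennreal_leI max.mono \<kappa>_mono)
    also have "\<dots> \<le> ennreal (V + B)"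
      unfolding nnA by (intro SUP_least ennreal_leI) (use AB in \<open>simp add: algebra_simps\<close>)
    finally show ?thesis .
  qed
  have "A 0 \<ge> 0" unfolding A_def by (intro Bochner_Integration.integral_nonneg) auto
  then have VB: "V + B \<ge> 0" using AB[of 0] by simp
  have "enn2ereal (\<integral>\<^sup>+z. (\<integral>\<^sup>+w. e2ennreal (log_kernel z w) \<partial>\<mu>) \<partial>\<mu>) \<le> ereal (V + B)"
    using kpos VB by (metis enn2ereal_ennreal less_eq_ennreal.rep_eq)
  then have "log_energy \<mu> \<le> ereal (V + B) - ereal B"
    unfolding log_energy_def kneg using B0 by (intro ereal_minus_mono) (auto simp: enn2ereal_ennreal)
  then show "log_energy \<mu> \<le> ereal V" by simp
qed

text \<open>This excludes the value \<open>-\<infinity>\<close> of the Robin constant, for which \<^const>\<open>log_capacity\<close> would not be the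
  exponential.\<close>

lemma log_energy_ge:
  assumes \<mu>: "\<mu> \<in> prob_measures_on L"
    and D: "D \<ge> 1" "\<And>z w. z \<in> L \<Longrightarrow> w \<in> L \<Longrightarrow> dist z w \<le> D"
  shows "ereal (- ln D) \<le> log_energy \<mu>"
proof -
  interpret \<mu>: prob_space \<mu> using \<mu> by (simp add: prob_measures_on_def)
  have AEL: "AE z in \<mu>. z \<in> L"
  proof (rule \<mu>.AE_prob_1)
    show "\<mu>.prob L = 1" using \<mu> by (simp add: prob_measures_on_def measure_def)
  qed
  have "(\<integral>\<^sup>+z. (\<integral>\<^sup>+w. e2ennreal (- log_kernel z w) \<partial>\<mu>) \<partial>\<mu>)
      \<le> (\<integral>\<^sup>+z. (\<integral>\<^sup>+w. ennreal (ln D) \<partial>\<mu>) \<partial>\<mu>)"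
  proof (rule nn_integral_mono_AE, use AEL in eventually_elim, rule nn_integral_mono_AE, use AEL in eventually_elim)
    fix z w assume zw: "z \<in> L" "w \<in> L"
    show "e2ennreal (- log_kernel z w) \<le> ennreal (ln D)"
      using D(2)[OF zw] D(1) by (auto simp: log_kernel_def e2ennreal_neg dist_norm intro!: ennreal_leI)
  qed
  also have "\<dots> = ennreal (ln D)" by (simp add: \<mu>.emeasure_space_1)
  finally have "enn2ereal (\<integral>\<^sup>+z. (\<integral>\<^sup>+w. e2ennreal (- log_kernel z w) \<partial>\<mu>) \<partial>\<mu>) \<le> ereal (ln D)"
    using D(1) by (simp add: enn2ereal_ennreal less_eq_ennreal.rep_eq)
  then have "0 - ereal (ln D) \<le> log_energy \<mu>"
    unfolding log_energy_def by (intro ereal_minus_mono) auto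
  then show ?thesis by simp
qed

text \<open>A truncated kernel is continuous, so its double integral against a weak limit is the limit of the
  discrete energies; the diagonal terms, absent from the hypothesis, contribute only \<open>m / N\<close> for
  \<open>N\<close> points.\<close>

lemma log_capacity_ge_of_points:
  fixes L :: "complex set"
  assumes L: "compact L"
    and pts: "\<And>N. \<exists>z :: nat \<Rightarrow> complex. (\<forall>i<N. z i \<in> L) \<and> inj_on z {..<N} \<and>
       (\<Sum>i<N. \<Sum>j\<in>{..<N} - {i}. - ln (dist (z i) (z j))) \<le> real N * (real N - 1) * V"
  shows "exp (- V) \<le> log_capacity L"
proof -
  define Q where "Q n z \<longleftrightarrow> (\<forall>i\<le>n. z i \<in> L) \<and> inj_on z {..n} \<and>
       (\<Sum>i\<le>n. \<Sum>j\<in>{..n} - {i}. - ln (dist (z i) (z j))) \<le> real (Suc n) * real n * V"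
    for n and z :: "nat \<Rightarrow> complex"
  have "\<exists>z. Q n z" for n
    using pts[of "Suc n"] unfolding Q_def by (simp only: lessThan_Suc_atMost less_Suc_eq_le) simp
  then obtain z where "\<And>n. Q n (z n)" by metis
  then have z: "\<And>n i. i \<le> n \<Longrightarrow> z n i \<in> L" "\<And>n. inj_on (z n) {..n}"
    and energy: "\<And>n. (\<Sum>i\<le>n. \<Sum>j\<in>{..n} - {i}. - ln (dist (z n i) (z n j))) \<le> real (Suc n) * real n * V"
    unfolding Q_def by auto
  define D where "D = max 1 (diameter L)"
  have D: "D \<ge> 1" "\<And>z w. z \<in> L \<Longrightarrow> w \<in> L \<Longrightarrow> dist z w \<le> D"
    using diameter_bounded_bound[OF compact_imp_bounded[OF L]] by (force simp: D_def)+
  obtain \<mu> r where \<mu>: "\<mu> \<in> prob_measures_on L" and r: "strict_mono r" and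
    lim: "\<And>f B. continuous_on UNIV (\<lambda>p. f (fst p) (snd p)) \<Longrightarrow> (\<And>x y. \<bar>f x y\<bar> \<le> B) \<Longrightarrow>
       (\<lambda>n. (\<Sum>i\<le>r n. \<Sum>j\<le>r n. f (z (r n) i) (z (r n) j)) / real (Suc (r n)) ^ 2)
          \<longlonglongrightarrow> (\<integral>x. (\<integral>y. f x y \<partial>\<mu>) \<partial>\<mu>)"
    using empirical_measures_weak_limit[OF L, of z] z(1) by blast
  have "log_energy \<mu> \<le> ereal V"
  proof (rule log_energy_le_of_truncated[OF \<mu> L D])
    fix m :: nat
    define f where "f x y = - ln (max (exp (- real m)) (min D (dist x y)))" for x y :: complex
    have pos: "max (exp (- real m)) t > 0" for t :: real by (simp add: less_max_iff_disj)
    have cont: "continuous_on UNIV (\<lambda>p. f (fst p) (snd p))"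
      unfolding f_def by (intro continuous_intros ballI) (use pos in \<open>metis less_irrefl\<close>)
    have bd: "\<bar>f x y\<bar> \<le> real m + ln D" for x y
    proof -
      let ?t = "max (exp (- real m)) (min D (dist x y))"
      have "exp (- real m) \<le> 1" by simp
      then have "?t \<le> D" using D(1) by (intro max.boundedI) linarith+
      then have "ln ?t \<le> ln D"
        using pos[of "min D (dist x y)"] D(1) by (subst ln_le_cancel_iff) linarith+
      moreover have "ln (exp (- real m)) \<le> ln ?t" using pos by (subst ln_le_cancel_iff) auto
      moreover have "ln D \<ge> 0" using D(1) by simp
      ultimately show ?thesis unfolding f_def by (simp add: abs_le_iff)
    qed
    have sum_le: "(\<Sum>i\<le>n. \<Sum>j\<le>n. f (z n i) (z n j)) / real (Suc n) ^ 2
        \<le> (real m - V) * inverse (real (Suc n)) + V" for n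
    proof -
      have off: "f (z n i) (z n j) \<le> - ln (dist (z n i) (z n j))" if "i \<le> n" "j \<in> {..n} - {i}" for i j
      proof -
        have "z n i \<noteq> z n j" using z(2)[of n] that by (auto simp: inj_on_def)
        moreover have "dist (z n i) (z n j) \<le> D" using D(2) z(1) that by auto
        ultimately show ?thesis unfolding f_def using pos by simp
      qed
      have "(\<Sum>i\<le>n. \<Sum>j\<le>n. f (z n i) (z n j)) = (\<Sum>i\<le>n. f (z n i) (z n i) + (\<Sum>j\<in>{..n} - {i}. f (z n i) (z n j)))"
        by (intro sum.cong refl sum.remove) auto
      also have "\<dots> \<le> (\<Sum>i\<le>n. real m + (\<Sum>j\<in>{..n} - {i}. - ln (dist (z n i) (z n j))))"
        using off D(1) by (intro sum_mono add_mono) (auto simp: f_def max_def min_def)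
      also have "\<dots> \<le> real (Suc n) * real m + real (Suc n) * real n * V"
        using energy[of n] by (simp add: sum.distrib)
      finally have "(\<Sum>i\<le>n. \<Sum>j\<le>n. f (z n i) (z n j)) / real (Suc n) ^ 2
         \<le> (real (Suc n) * real m + real (Suc n) * real n * V) / real (Suc n) ^ 2"
        by (intro divide_right_mono) auto
      also have "real (Suc n) * real m + real (Suc n) * real n * V = real (Suc n) * (real m - V + real (Suc n) * V)"
        by (simp add: algebra_simps)
      also have "\<dots> / real (Suc n) ^ 2 = (real m - V + real (Suc n) * V) / real (Suc n)"
        by (simp add: power2_eq_square del: of_nat_Suc)
      also have "\<dots> = (real m - V) * inverse (real (Suc n)) + V"
        by (simp add: distrib_right divide_inverse del: of_nat_Suc)
      finally show ?thesis .
    qed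
    have "(\<lambda>n. (real m - V) * inverse (real (Suc n)) + V) \<longlonglongrightarrow> (real m - V) * 0 + V"
      by (intro tendsto_intros LIMSEQ_inverse_real_of_nat)
    from LIMSEQ_subseq_LIMSEQ[OF this r]
    have "(\<lambda>n. (real m - V) * inverse (real (Suc (r n))) + V) \<longlonglongrightarrow> V" by (simp add: comp_def)
    then show "(\<integral>z. (\<integral>w. - ln (max (exp (- real m)) (min D (dist z w))) \<partial>\<mu>) \<partial>\<mu>) \<le> V"
      using LIMSEQ_le[OF lim[OF cont bd]] sum_le unfolding f_def by blast
  qed
  then have up: "robin_constant L \<le> ereal V"
    unfolding robin_constant_def by (rule INF_lower2[OF \<mu>])
  have low: "ereal (- ln D) \<le> robin_constant L"
    unfolding robin_constant_def by (intro INF_greatest log_energy_ge[OF _ D]) auto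
  obtain v where v: "robin_constant L = ereal v"
    using up low by (cases "robin_constant L") auto
  then show ?thesis using up by (simp add: log_capacity_def)
qed

section \<open>Harmonic functions and the maximum principle\<close>

text \<open>The function \<open>u\<^sub>x - \<i> u\<^sub>y\<close> satisfies the Cauchy--Riemann equations, and the real part of its
  primitive on a disc differs from \<open>u\<close> by a constant.\<close>

lemma harmonic_on_local_Re_holomorphic:
  assumes "harmonic_on u S" "ball z0 r \<subseteq> S"
  obtains f where "f holomorphic_on ball z0 r" "\<And>z. z \<in> ball z0 r \<Longrightarrow> Re (f z) = u z"
proof (cases "r > 0")
  case False
  then have "ball z0 r = {}" by auto
  then show ?thesis using that[of "\<lambda>_. 0"] by (metis empty_iff holomorphic_on_const)
next
  case True
  obtain ux uy uxx uxy uyy where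
    u: "\<And>z. z \<in> S \<Longrightarrow> (u has_derivative (\<lambda>h. ux z * Re h + uy z * Im h)) (at z)" and
    ux: "\<And>z. z \<in> S \<Longrightarrow> (ux has_derivative (\<lambda>h. uxx z * Re h + uxy z * Im h)) (at z)" and
    uy: "\<And>z. z \<in> S \<Longrightarrow> (uy has_derivative (\<lambda>h. uxy z * Re h + uyy z * Im h)) (at z)" and
    lap: "\<And>z. z \<in> S \<Longrightarrow> uxx z + uyy z = 0"
    using assms(1) unfolding harmonic_on_def by blast
  define g where "g z = Complex (ux z) (- uy z)" for z
  have g': "(g has_field_derivative Complex (uxx z) (- uxy z)) (at z)" if "z \<in> S" for z
  proof -
    have eq: "g = (\<lambda>z. of_real (ux z) - \<i> * of_real (uy z))"
      by (auto simp: g_def complex_eq_iff)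
    have uyy: "uyy z = - uxx z" using lap[OF that] by simp
    have "(g has_derivative (\<lambda>h. of_real (uxx z * Re h + uxy z * Im h)
        - \<i> * of_real (uxy z * Re h + uyy z * Im h))) (at z)"
      unfolding eq
      by (intro derivative_intros bounded_linear.has_derivative[OF bounded_linear_of_real]
            ux[OF that] uy[OF that])
    moreover have "(\<lambda>h. of_real (uxx z * Re h + uxy z * Im h)
        - \<i> * of_real (uxy z * Re h + uyy z * Im h)) = (*) (Complex (uxx z) (- uxy z))"
      by (auto simp: complex_eq_iff uyy algebra_simps)
    ultimately show ?thesis by (simp add: has_field_derivative_def)
  qed
  have holg: "g holomorphic_on ball z0 r"
    using g' assms(2)
    by (intro holomorphic_onI) (metis subsetD field_differentiable_at_within field_differentiable_def)
  obtain f where f: "\<And>z. z \<in> ball z0 r \<Longrightarrow> (f has_field_derivative g z) (at z)"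
    using holomorphic_convex_primitive'[OF _ _ holg] by (auto simp: at_within_open[of _ "ball z0 r"])
  have "((\<lambda>z. Re (f z) - u z) has_derivative (\<lambda>h. 0)) (at z within ball z0 r)" if z: "z \<in> ball z0 r" for z
  proof -
    have "((\<lambda>z. Re (f z) - u z) has_derivative (\<lambda>h. Re (g z * h) - (ux z * Re h + uy z * Im h))) (at z)"
      using f[OF z] u z assms(2)
      by (intro derivative_intros) (auto simp: has_field_derivative_def)
    moreover have "(\<lambda>h. Re (g z * h) - (ux z * Re h + uy z * Im h)) = (\<lambda>h. 0)"
      by (auto simp: g_def)
    ultimately show ?thesis by (simp add: has_derivative_at_withinI)
  qed
  then obtain c where c: "\<And>z. z \<in> ball z0 r \<Longrightarrow> Re (f z) - u z = c"
    using has_derivative_zero_constant[OF convex_ball, of z0 r "\<lambda>z. Re (f z) - u z"] by blast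
  show ?thesis
  proof (rule that)
    show "(\<lambda>z. f z - of_real c) holomorphic_on ball z0 r"
      using f by (intro holomorphic_intros holomorphic_onI)
        (metis field_differentiable_at_within field_differentiable_def)
    show "Re (f z - of_real c) = u z" if "z \<in> ball z0 r" for z
      using c[OF that] by simp
  qed
qed

text \<open>A maximum principle for functions that are, at each point of a large value, touched from below by
  the modulus of a holomorphic function. Where the maximum is attained this holomorphic function
  is constant, so \<open>V\<close> is locally constant. The set of maximum points would be compact, open and
  nonempty if the maximum exceeded \<open>m\<close>.\<close>

lemma modulus_dominated_max_principle:
  fixes V :: "complex \<Rightarrow> real"
  assumes K: "compact K" and V: "continuous_on K V"
    and loc: "\<And>z0. z0 \<in> K \<Longrightarrow> V z0 > m \<Longrightarrow>
       \<exists>r>0. \<exists>F. ball z0 r \<subseteq> K \<and> F holomorphic_on ball z0 r \<and> cmod (F z0) = V z0 \<and>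
          (\<forall>z\<in>ball z0 r. cmod (F z) \<le> V z)"
    and z: "z \<in> K"
  shows "V z \<le> m"
proof (rule ccontr)
  assume "\<not> V z \<le> m"
  obtain x where x: "x \<in> K" "\<And>y. y \<in> K \<Longrightarrow> V y \<le> V x"
    using continuous_attains_sup[OF K _ V] z by blast
  have xm: "V x > m" using x(2)[OF z] \<open>\<not> V z \<le> m\<close> by simp
  define A where "A = {y\<in>K. V y = V x}"
  have "closedin (top_of_set K) A"
    unfolding A_def by (rule continuous_closedin_preimage_constant[OF V])
  then have "compact A" using K closedin_compact by blast
  have "open A"
    unfolding open_contains_ball
  proof
    fix y assume "y \<in> A"
    then have y: "y \<in> K" "V y = V x" by (auto simp: A_def)
    with loc[of y] xm obtain r F where rF: "r > 0" "ball y r \<subseteq> K" "F holomorphic_on ball y r"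
      "cmod (F y) = V y" "\<And>z. z \<in> ball y r \<Longrightarrow> cmod (F z) \<le> V z" by auto
    have "F constant_on ball y r"
    proof (rule maximum_modulus_principle[OF rF(3)])
      show "cmod (F z) \<le> cmod (F y)" if "z \<in> ball y r" for z
        using rF(5)[OF that] x(2)[of z] rF(2) that y rF(4) by fastforce
    qed (use rF(1) in auto)
    then have const: "F z = F y" if "z \<in> ball y r" for z
      using that rF(1) unfolding constant_on_def by (metis centre_in_ball)
    have "ball y r \<subseteq> A"
    proof
      fix z assume z: "z \<in> ball y r"
      then have "V z \<ge> V x" using rF(5)[OF z] const[OF z] rF(4) y by simp
      moreover have "z \<in> K" using z rF(2) by blast
      ultimately show "z \<in> A" using x(2)[of z] by (auto simp: A_def)
    qed
    then show "\<exists>e>0. ball y e \<subseteq> A" using rF(1) by blast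
  qed
  have "A = {} \<or> A = UNIV"
    using \<open>open A\<close> \<open>compact A\<close> compact_imp_closed clopen by blast
  moreover have "x \<in> A" using x by (auto simp: A_def)
  moreover have "A \<noteq> UNIV" using compact_imp_bounded[OF \<open>compact A\<close>] not_bounded_UNIV by metis
  ultimately show False by blast
qed

section \<open>The Green's function of a regular real set\<close>

text \<open>The properties of the Green's function that the estimates use, for a real set that is regular.\<close>

locale real_green =
  fixes E :: "complex set" and G :: "complex \<Rightarrow> real"
  assumes E_real: "E \<subseteq> \<real>" and compact_E: "compact E"
    and harmonic_G: "harmonic_on G (- E)"
    and G_pos: "z \<notin> E \<Longrightarrow> G z > 0" and G_zero: "z \<in> E \<Longrightarrow> G z = 0"
    and cont_G: "continuous_on UNIV G"
    and G_pole: "Bfun (\<lambda>z. G z - ln (cmod z)) at_infinity"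
    and G_cnj: "G (cnj z) = G z"
begin

lemma G_nonneg: "G z \<ge> 0"
  using G_pos[of z] G_zero[of z] by (cases "z \<in> E") auto

lemma G_log_bounds:
  obtains c where "c > 0" "\<forall>\<^sub>F z in at_infinity. \<bar>G z - ln (cmod z)\<bar> \<le> c"
  using G_pole unfolding Bfun_def by (auto simp: real_norm_def)

lemma G_at_infinity: "filterlim G at_top at_infinity"
proof -
  obtain c where c: "\<forall>\<^sub>F z in at_infinity. \<bar>G z - ln (cmod z)\<bar> \<le> c" by (rule G_log_bounds)
  have ev: "\<forall>\<^sub>F z in at_infinity. - c + ln (cmod z) \<le> G z"
    using c by eventually_elim auto
  have "filterlim (\<lambda>z::complex. - c + ln (cmod z)) at_top at_infinity"
    by (rule filterlim_tendsto_add_at_top[OF tendsto_const])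
       (rule filterlim_compose[OF ln_at_top filterlim_norm_at_top])
  then show ?thesis by (rule filterlim_at_top_mono[OF _ ev])
qed

lemma local_completion:
  assumes "open U" "z0 \<in> U" "z0 \<notin> E"
  obtains r f where "r > 0" "ball z0 r \<subseteq> U" "ball z0 r \<subseteq> - E" "f holomorphic_on ball z0 r"
    "\<And>z. z \<in> ball z0 r \<Longrightarrow> Re (f z) = G z"
proof -
  have "open (U \<inter> - E)" using assms(1) compact_E by (simp add: compact_imp_closed open_Int open_Compl)
  then obtain r where r: "r > 0" "ball z0 r \<subseteq> U \<inter> - E"
    using assms by (meson ComplI IntI open_contains_ball_eq)
  then have "ball z0 r \<subseteq> - E" by blast
  then obtain f where "f holomorphic_on ball z0 r" "\<And>z. z \<in> ball z0 r \<Longrightarrow> Re (f z) = G z"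
    using harmonic_on_local_Re_holomorphic[OF harmonic_G] by blast
  then show ?thesis using that r by blast
qed

end

text \<open>A closed half plane without \<open>E\<close> is connected, and the two halves meet on the real line outside of
  \<open>E\<close>.\<close>

lemma outside_of_compact_real:
  fixes E :: "complex set"
  assumes "E \<subseteq> \<real>" "compact E"
  shows "outside E = - E"
proof -
  define P where "P = {z::complex. z \<notin> E \<and> Im z \<ge> 0}"
  define Q where "Q = {z::complex. z \<notin> E \<and> Im z \<le> 0}"
  have ImE: "Im z = 0" if "z \<in> E" for z using that assms(1) complex_is_Real_iff by blast
  have "connected P"
  proof (rule connected_intermediate_closure[of "{z. Im z > 0}"])
    show "connected {z. Im z > 0}" by (simp add: convex_halfspace_Im_gt convex_connected)
    show "{z. Im z > 0} \<subseteq> P" using ImE by (auto simp: P_def)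
    have "closure {z. Im z > 0} = {z. Im z \<ge> 0}"
      using closure_halfspace_gt[of "\<i>" 0] by (simp add: inner_complex_def)
    then show "P \<subseteq> closure {z. Im z > 0}" by (auto simp: P_def)
  qed
  moreover have "connected Q"
  proof (rule connected_intermediate_closure[of "{z. Im z < 0}"])
    show "connected {z. Im z < 0}" by (simp add: convex_halfspace_Im_lt convex_connected)
    show "{z. Im z < 0} \<subseteq> Q" using ImE by (auto simp: Q_def)
    have "closure {z. Im z < 0} = {z. Im z \<le> 0}"
      using closure_halfspace_lt[of "\<i>" 0] by (simp add: inner_complex_def)
    then show "Q \<subseteq> closure {z. Im z < 0}" by (auto simp: Q_def)
  qed
  moreover have "P \<inter> Q \<noteq> {}"
  proof -
    obtain B where B: "\<And>z. z \<in> E \<Longrightarrow> norm z \<le> B"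
      using compact_imp_bounded[OF assms(2)] bounded_iff by blast
    have "of_real (\<bar>B\<bar> + 1) \<notin> E" using B[of "of_real (\<bar>B\<bar>+1)"]
      by (auto simp del: of_real_add)
    then have "of_real (\<bar>B\<bar> + 1) \<in> P \<inter> Q" unfolding P_def Q_def by (auto simp del: of_real_add)
    then show ?thesis by blast
  qed
  ultimately have "connected (P \<union> Q)" by (intro connected_Un)
  moreover have "P \<union> Q = - E" unfolding P_def Q_def by auto
  ultimately have con: "connected (- E)" by simp
  have "\<not> bounded (- E)"
    using compact_imp_bounded[OF assms(2)] cobounded_imp_unbounded by blast
  then have "\<not> bounded (connected_component_set (- E) z)" if "z \<notin> E" for z
    using con that by (simp add: connected_iff_connected_component_eq connected_component_eq_self)
  then show ?thesis unfolding outside_def by auto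
qed

lemma harmonic_on_cnj:
  assumes "harmonic_on u S" "cnj ` S = S"
  shows "harmonic_on (\<lambda>z. u (cnj z)) S"
proof -
  have S: "open S" using assms(1) by (simp add: harmonic_on_def)
  have cS: "cnj z \<in> S" if "z \<in> S" for z using that assms(2) by blast
  obtain ux uy uxx uxy uyy where c: "continuous_on S uxx" "continuous_on S uxy" "continuous_on S uyy" and
    u: "\<And>z. z \<in> S \<Longrightarrow> (u has_derivative (\<lambda>h. ux z * Re h + uy z * Im h)) (at z)" and
    ux: "\<And>z. z \<in> S \<Longrightarrow> (ux has_derivative (\<lambda>h. uxx z * Re h + uxy z * Im h)) (at z)" and
    uy: "\<And>z. z \<in> S \<Longrightarrow> (uy has_derivative (\<lambda>h. uxy z * Re h + uyy z * Im h)) (at z)" and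
    lap: "\<And>z. z \<in> S \<Longrightarrow> uxx z + uyy z = 0"
    using assms(1) unfolding harmonic_on_def by blast
  have comp: "((\<lambda>z. v (cnj z)) has_derivative (\<lambda>h. D (cnj h))) (at z)"
    if "(v has_derivative D) (at (cnj z))" for v :: "complex \<Rightarrow> real" and D z
    using has_derivative_compose[OF bounded_linear.has_derivative[OF bounded_linear_cnj has_derivative_ident] that]
    by simp
  have cc: "continuous_on S (\<lambda>z. f (cnj z))" if "continuous_on S f" for f :: "complex \<Rightarrow> real"
    by (rule continuous_on_compose2[OF that]) (use cS in \<open>auto intro: continuous_intros\<close>)
  show ?thesis
    unfolding harmonic_on_def
  proof (intro conjI S exI ballI)
    show "continuous_on S (\<lambda>z. uxx (cnj z))" "continuous_on S (\<lambda>z. - uxy (cnj z))"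
      "continuous_on S (\<lambda>z. uyy (cnj z))"
      using c cc by (auto intro: continuous_on_minus)
    fix z assume z: "z \<in> S"
    show "((\<lambda>z. u (cnj z)) has_derivative (\<lambda>h. ux (cnj z) * Re h + - uy (cnj z) * Im h)) (at z)"
      using comp[OF u[OF cS[OF z]]] by simp
    show "((\<lambda>z. ux (cnj z)) has_derivative (\<lambda>h. uxx (cnj z) * Re h + - uxy (cnj z) * Im h)) (at z)"
      using comp[OF ux[OF cS[OF z]]] by simp
    show "((\<lambda>z. - uy (cnj z)) has_derivative (\<lambda>h. - uxy (cnj z) * Re h + uyy (cnj z) * Im h)) (at z)"
      using has_derivative_minus[OF comp[OF uy[OF cS[OF z]]]] by simp
    show "uxx (cnj z) + uyy (cnj z) = 0" using lap[OF cS[OF z]] .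
  qed
qed

text \<open>Symmetry comes from minimality: \<open>G \<circ> cnj\<close> is another positive harmonic function with a logarithmic
  pole. Continuity on \<open>E\<close> is regularity, since \<open>E\<close> has no interior and is its own boundary.\<close>

lemma real_green_greens_function:
  assumes E: "E \<subseteq> \<real>" "compact E" and reg: "regular_set E"
  shows "real_green E (greens_function E)"
proof -
  obtain G where G: "is_greens_function E G"
      "\<And>\<zeta>. \<zeta> \<in> frontier (outside E) \<Longrightarrow> (G \<longlongrightarrow> 0) (at \<zeta> within outside E)"
    using reg unfolding regular_set_def by blast
  have out: "outside E = - E" by (rule outside_of_compact_real[OF E])
  have gf: "greens_function E = G" by (rule greens_function_eq[OF G(1)])
  have pole: "positive_harmonic_log_pole E G"
    and least: "\<And>u z. positive_harmonic_log_pole E u \<Longrightarrow> z \<notin> E \<Longrightarrow> G z \<le> u z"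
    and zero: "\<And>z. z \<in> E \<Longrightarrow> G z = 0"
    using G(1) unfolding is_greens_function_def out by auto
  have harm: "harmonic_on G (- E)" and pos: "\<And>z. z \<notin> E \<Longrightarrow> G z > 0"
    and bf: "Bfun (\<lambda>z. G z - ln (cmod z)) at_infinity"
    using pole unfolding positive_harmonic_log_pole_def out by auto
  have cnjE: "cnj z = z" if "z \<in> E" for z using that E(1) by (auto simp: Reals_cnj_iff)
  have cnj_notin: "cnj z \<notin> E" if "z \<notin> E" for z
    using that cnjE[of "cnj z"] by auto
  have "cnj ` (- E) = - E"
  proof
    show "cnj ` (- E) \<subseteq> - E" using cnj_notin by auto
    show "- E \<subseteq> cnj ` (- E)"
    proof
      fix z assume "z \<in> - E"
      then show "z \<in> cnj ` (- E)" using cnj_notin[of z] by (intro image_eqI[of _ _ "cnj z"]) auto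
    qed
  qed
  then have "harmonic_on (\<lambda>z. G (cnj z)) (- E)" by (rule harmonic_on_cnj[OF harm])
  moreover have "Bfun (\<lambda>z. G (cnj z) - ln (cmod z)) at_infinity"
  proof -
    obtain K b where K: "K > 0" "\<And>z. b \<le> norm z \<Longrightarrow> norm (G z - ln (cmod z)) \<le> K"
      using bf unfolding Bfun_def eventually_at_infinity by blast
    have "norm (G (cnj z) - ln (cmod z)) \<le> K" if "b \<le> norm z" for z
      using K(2)[of "cnj z"] that by simp
    then show ?thesis using K(1) unfolding Bfun_def eventually_at_infinity by blast
  qed
  ultimately have "positive_harmonic_log_pole E (\<lambda>z. G (cnj z))"
    unfolding positive_harmonic_log_pole_def out using pos cnj_notin by auto
  then have le: "G z \<le> G (cnj z)" if "z \<notin> E" for z using least that by blast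
  have sym: "G (cnj z) = G z" for z
  proof (cases "z \<in> E")
    case False
    then show ?thesis using le[of z] le[of "cnj z"] cnj_notin[of z] by simp
  qed (simp add: cnjE)
  have int: "interior E = {}"
  proof (rule ccontr)
    assume "interior E \<noteq> {}"
    then obtain z r where r: "r > 0" "ball z r \<subseteq> E" by (auto simp: mem_interior)
    then have "z + \<i> * of_real (r / 2) \<in> E" "z \<in> E"
      by (auto simp: dist_norm norm_mult)
    then have "Im (z + \<i> * of_real (r / 2)) = 0" "Im z = 0"
      using E(1) complex_is_Real_iff by blast+
    then show False using r(1) by simp
  qed
  have "closed E" using E(2) by (rule compact_imp_closed)
  then have fr: "frontier (outside E) = E"
    unfolding out frontier_complement using int by (simp add: frontier_def)
  have "isCont G z" for z
  proof (cases "z \<in> E")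
    case True
    have "(G \<longlongrightarrow> 0) (at z within - E)" using G(2)[of z] True unfolding fr by (simp add: out)
    moreover have "(G \<longlongrightarrow> 0) (at z within E)"
      by (rule tendsto_eventually) (auto simp: eventually_at_filter zero)
    ultimately have "(G \<longlongrightarrow> 0) (at z within (- E \<union> E))" by (rule Lim_Un)
    then show ?thesis using zero[OF True] by (simp add: isCont_def)
  next
    case False
    then obtain D where "(G has_derivative D) (at z)" using harm unfolding harmonic_on_def by blast
    then show ?thesis by (rule has_derivative_continuous)
  qed
  then have "continuous_on UNIV G" by (simp add: continuous_on_eq_continuous_at)
  then show ?thesis
    unfolding gf using E harm pos zero bf sym by unfold_locales auto
qed

section \<open>The Bernstein--Walsh inequality\<close>

context real_green
begin

text \<open>The maximum principle for \<open>\<Phi> e\<^sup>-\<^sup>N\<^sup>G\<close> on \<open>G \<ge> a\<close>. It is stated for \<open>\<Phi>\<close> locally dominating moduli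
  of holomorphic functions, because it is used both for the modulus of a polynomial and for the
  modulus of an algebraic function.\<close>

lemma bernstein_walsh:
  fixes \<Phi> :: "complex \<Rightarrow> real"
  assumes a: "a \<ge> 0" and M: "M \<ge> 0"
    and cont: "continuous_on UNIV \<Phi>" and nonneg: "\<And>z. \<Phi> z \<ge> 0"
    and loc: "\<And>z0. G z0 > a \<Longrightarrow> \<exists>r>0. \<exists>F. F holomorphic_on ball z0 r \<and> cmod (F z0) = \<Phi> z0 \<and>
       (\<forall>z\<in>ball z0 r. cmod (F z) \<le> \<Phi> z)"
    and growth: "\<forall>\<^sub>F z in at_infinity. \<Phi> z \<le> C * cmod z ^ N"
    and bd: "\<And>z. G z = a \<Longrightarrow> \<Phi> z \<le> M"
    and z: "G z \<ge> a"
  shows "\<Phi> z \<le> M * exp (real N * (G z - a))"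
proof -
  have step: "\<Phi> z ^ k * exp (- (real (k * N + 1) * G z)) \<le> M ^ k * exp (- (real (k * N + 1) * a))"
    if z: "G z \<ge> a" for k z
  proof (rule field_le_epsilon)
    fix \<eta> :: real assume "\<eta> > 0"
    define p where "p = k * N + 1"
    define V where "V z = \<Phi> z ^ k * exp (- (real p * G z))" for z
    \<comment> \<open>The slack \<open>\<eta>\<close> makes the bound positive even for \<open>M = 0\<close>, so that the decay at infinity
      can be used.\<close>
    define m where "m = M ^ k * exp (- (real p * a)) + \<eta>"
    have m: "m \<ge> \<eta>" using M by (simp add: m_def)
    obtain c where c: "\<forall>\<^sub>F z in at_infinity. \<bar>G z - ln (cmod z)\<bar> \<le> c" by (rule G_log_bounds)
    have "\<forall>\<^sub>F z in at_infinity. V z \<le> C ^ k * exp (real p * c) * inverse (cmod z)"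
      using c growth eventually_not_equal_at_infinity[of 0]
    proof eventually_elim
      case (elim z)
      have "\<Phi> z ^ k \<le> (C * cmod z ^ N) ^ k"
        using elim(2) nonneg by (intro power_mono) auto
      moreover have "exp (- (real p * G z)) \<le> exp (real p * c) * inverse (cmod z) ^ p"
      proof -
        have "- (real p * G z) \<le> real p * c + real p * (- ln (cmod z))"
          using elim(1) mult_left_mono[of "- G z" "c - ln (cmod z)" "real p"] by (simp add: algebra_simps)
        then have "exp (- (real p * G z)) \<le> exp (real p * c) * exp (real p * (- ln (cmod z)))"
          by (simp add: mult_exp_exp)
        also have "exp (real p * (- ln (cmod z))) = inverse (cmod z) ^ p"
          using elim(3) by (subst exp_of_nat_mult) (simp add: exp_minus)
        finally show ?thesis .
      qed
      ultimately have "V z \<le> (C * cmod z ^ N) ^ k * (exp (real p * c) * inverse (cmod z) ^ p)"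
        unfolding V_def using zero_le_power[OF nonneg[of z], of k] by (intro mult_mono) auto
      also have "\<dots> = C ^ k * exp (real p * c) * inverse (cmod z)"
        using elim(3) by (simp add: p_def power_mult_distrib power_mult[symmetric] field_simps mult.commute)
      finally show ?case .
    qed
    moreover have "((\<lambda>z::complex. C ^ k * exp (real p * c) * inverse (cmod z)) \<longlongrightarrow> C ^ k * exp (real p * c) * 0) at_infinity"
      by (intro tendsto_intros tendsto_inverse_0_at_top filterlim_norm_at_top)
    then have "\<forall>\<^sub>F z::complex in at_infinity. C ^ k * exp (real p * c) * inverse (cmod z) < \<eta>"
      using order_tendstoD(2) \<open>\<eta> > 0\<close> by fastforce
    ultimately have "\<forall>\<^sub>F z in at_infinity. V z \<le> \<eta>"
      by eventually_elim auto
    then obtain R where R: "\<And>z. cmod z \<ge> R \<Longrightarrow> V z \<le> m"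
      using m unfolding eventually_at_infinity by (meson order.trans)
    define K where "K = {z. G z \<ge> a} \<inter> cball 0 R"
    have cV: "continuous_on A V" for A
      unfolding V_def by (intro continuous_intros continuous_on_subset[OF cont] continuous_on_subset[OF cont_G]) auto
    have "V z \<le> m"
    proof (cases "cmod z \<le> R")
      case True
      have "closed {z. G z \<ge> a}"
        using closed_Collect_le[OF continuous_on_const cont_G] by simp
      then have "compact K" unfolding K_def by (intro closed_Int_compact) auto
      then show ?thesis
      proof (rule modulus_dominated_max_principle[OF _ cV])
        show "z \<in> K" using True z by (auto simp: K_def)
        fix z0 assume z0: "z0 \<in> K" "V z0 > m"
        have "G z0 \<noteq> a"
        proof
          assume "G z0 = a"
          then have "V z0 \<le> M ^ k * exp (- (real p * a))"
            unfolding V_def using bd[of z0] nonneg by (auto intro!: mult_right_mono power_mono)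
          then show False using z0(2) \<open>\<eta> > 0\<close> by (simp add: m_def)
        qed
        then have Ga: "G z0 > a" using z0 by (auto simp: K_def)
        then have nE: "z0 \<notin> E" using G_zero[of z0] a by auto
        have "cmod z0 < R" using R[of z0] z0(2) by force
        obtain r1 F where F: "r1 > 0" "F holomorphic_on ball z0 r1" "cmod (F z0) = \<Phi> z0"
            "\<And>z. z \<in> ball z0 r1 \<Longrightarrow> cmod (F z) \<le> \<Phi> z" using loc[OF Ga] by blast
        have "open ({z. a < G z} \<inter> ball 0 R \<inter> ball z0 r1)"
          using open_Collect_less[OF continuous_on_const cont_G] by (intro open_Int) auto
        then obtain r f where r: "r > 0" "ball z0 r \<subseteq> {z. a < G z} \<inter> ball 0 R \<inter> ball z0 r1"
           "f holomorphic_on ball z0 r" "\<And>z. z \<in> ball z0 r \<Longrightarrow> Re (f z) = G z"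
        proof (rule local_completion)
          show "z0 \<in> {z. a < G z} \<inter> ball 0 R \<inter> ball z0 r1"
            using Ga \<open>cmod z0 < R\<close> F(1) by simp
        qed (use nE in \<open>blast+\<close>)
        define H where "H z = F z ^ k * exp (- (of_nat p * f z))" for z
        have nH: "cmod (H z) = cmod (F z) ^ k * exp (- (real p * G z))" if "z \<in> ball z0 r" for z
          using r(4)[OF that] by (simp add: H_def norm_mult norm_power)
        show "\<exists>r>0. \<exists>F. ball z0 r \<subseteq> K \<and> F holomorphic_on ball z0 r \<and> cmod (F z0) = V z0 \<and>
           (\<forall>z\<in>ball z0 r. cmod (F z) \<le> V z)"
        proof (intro exI[of _ r] exI[of _ H] conjI ballI)
          show "H holomorphic_on ball z0 r" unfolding H_def
            using r(2) by (intro holomorphic_intros holomorphic_on_subset[OF F(2)] r(3)) auto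
          show "ball z0 r \<subseteq> K" using r(2) by (force simp: K_def)
          show "cmod (H z0) = V z0" using nH[of z0] r(1) F(3) by (simp add: V_def)
          show "cmod (H z) \<le> V z" if z: "z \<in> ball z0 r" for z
            unfolding nH[OF z] V_def using F(4)[of z] z r(2) by (intro mult_right_mono power_mono) auto
        qed (use r(1) in auto)
      qed
    qed (use R[of z] in auto)
    then show "\<Phi> z ^ k * exp (- (real (k * N + 1) * G z)) \<le> M ^ k * exp (- (real (k * N + 1) * a)) + \<eta>"
      by (simp add: V_def m_def p_def)
  qed
  define d where "d = G z - a"
  have "\<Phi> z \<le> M * exp (real N * d + d / real k)" if k: "k \<ge> 1" for k
  proof -
    have "\<Phi> z ^ k = (\<Phi> z ^ k * exp (- (real (k * N + 1) * G z))) * exp (real (k * N + 1) * G z)"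
      by (simp add: exp_minus)
    also have "\<dots> \<le> (M ^ k * exp (- (real (k * N + 1) * a))) * exp (real (k * N + 1) * G z)"
      by (intro mult_right_mono step z) auto
    also have "\<dots> = M ^ k * exp (real k * (real N * d + d / real k))"
    proof -
      have "real k * (real N * d + d / real k) = - (real (k * N + 1) * a) + real (k * N + 1) * G z"
        using k by (simp add: d_def field_simps)
      then show ?thesis by (simp only: mult.assoc mult_exp_exp)
    qed
    also have "\<dots> = (M * exp (real N * d + d / real k)) ^ k"
      by (simp add: exp_of_nat_mult power_mult_distrib)
    finally show ?thesis
      using k M by (subst (asm) power_mono_iff) (auto simp: nonneg)
  qed
  moreover have "(\<lambda>k. M * exp (real N * d + d / real k)) \<longlonglongrightarrow> M * exp (real N * d + 0)"
    by (intro tendsto_intros tendsto_divide_0[OF tendsto_const] filterlim_real_sequentially filterlim_at_top_imp_at_infinity)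
  ultimately show ?thesis
    unfolding d_def by (intro LIMSEQ_le_const[of _ "M * exp (real N * (G z - a))"]) auto
qed

text \<open>Both halves concern the same number \<open>\<gamma>\<close>, the lower limit of \<open>G - log \<bar>z\<bar>\<close> at infinity: estimates
  of the capacity from below use the second half, estimates of norms from above use the first.\<close>

lemma green_liminf:
  obtains \<gamma> where "\<And>\<delta>. \<delta> > 0 \<Longrightarrow> \<forall>\<^sub>F z in at_infinity. ln (cmod z) + \<gamma> - \<delta> \<le> G z"
    "\<And>\<delta>. \<delta> > 0 \<Longrightarrow> \<exists>\<^sub>F z in at_infinity. G z \<le> ln (cmod z) + \<gamma> + \<delta>"
proof -
  define S where "S = {g. \<forall>\<^sub>F z in at_infinity. ln (cmod z) + g \<le> G z}"
  obtain c where c: "\<forall>\<^sub>F z in at_infinity. \<bar>G z - ln (cmod z)\<bar> \<le> c" by (rule G_log_bounds)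
  have "\<forall>\<^sub>F z in at_infinity. ln (cmod z) + - c \<le> G z" using c by eventually_elim auto
  then have "- c \<in> S" unfolding S_def by (rule CollectI)
  then have ne: "S \<noteq> {}" by blast
  have "g \<le> c" if "g \<in> S" for g
  proof -
    have "\<forall>\<^sub>F z::complex in at_infinity. g \<le> c"
      using that c unfolding S_def mem_Collect_eq by eventually_elim auto
    then show ?thesis by (metis eventually_happens trivial_limit_at_infinity)
  qed
  then have bdd: "bdd_above S" by (auto simp: bdd_above_def)
  show ?thesis
  proof (rule that[of "Sup S"])
    fix \<delta> :: real assume \<delta>: "\<delta> > 0"
    obtain g where "g \<in> S" "g > Sup S - \<delta>"
      using less_cSup_iff[OF ne bdd, of "Sup S - \<delta>"] \<delta> by auto
    then show "\<forall>\<^sub>F z in at_infinity. ln (cmod z) + Sup S - \<delta> \<le> G z"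
      unfolding S_def mem_Collect_eq by (elim eventually_mono) auto
    show "\<exists>\<^sub>F z in at_infinity. G z \<le> ln (cmod z) + Sup S + \<delta>"
    proof (rule ccontr)
      assume "\<not> ?thesis"
      then have "\<forall>\<^sub>F z in at_infinity. ln (cmod z) + Sup S + \<delta> < G z"
        by (simp add: not_frequently not_le)
      then have "Sup S + \<delta> \<in> S" unfolding S_def mem_Collect_eq by (elim eventually_mono) auto
      then show False using cSup_upper[OF _ bdd] \<delta> by fastforce
    qed
  qed
qed

lemma monic_poly_growth:
  fixes P :: "complex poly"
  assumes "lead_coeff P = 1" "\<delta> > 0"
  shows "\<forall>\<^sub>F z in at_infinity. (1 - \<delta>) * cmod z ^ degree P \<le> cmod (poly P z)"
    and "\<forall>\<^sub>F z in at_infinity. cmod (poly P z) \<le> (1 + \<delta>) * cmod z ^ degree P"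
proof -
  have t: "((\<lambda>z. cmod (poly P z / z ^ degree P)) \<longlongrightarrow> cmod 1) at_infinity"
    using poly_divide_tendsto_aux[of P] assms(1) by (intro tendsto_norm) simp
  show "\<forall>\<^sub>F z in at_infinity. (1 - \<delta>) * cmod z ^ degree P \<le> cmod (poly P z)"
    using order_tendstoD(1)[OF t, of "1 - \<delta>"] assms(2) eventually_not_equal_at_infinity[of 0]
    by (auto elim!: eventually_elim2 simp: norm_divide norm_power field_simps)
  show "\<forall>\<^sub>F z in at_infinity. cmod (poly P z) \<le> (1 + \<delta>) * cmod z ^ degree P"
    using order_tendstoD(2)[OF t, of "1 + \<delta>"] assms(2) eventually_not_equal_at_infinity[of 0]
    by (auto elim!: eventually_elim2 simp: norm_divide norm_power field_simps)
qed

lemma poly_bernstein_walsh: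
  fixes P :: "complex poly"
  assumes P: "lead_coeff P = 1" and a: "a \<ge> 0" and M: "M \<ge> 0"
    and bd: "\<And>z. G z = a \<Longrightarrow> cmod (poly P z) \<le> M" and z: "G z \<ge> a"
  shows "cmod (poly P z) \<le> M * exp (real (degree P) * (G z - a))"
proof (rule bernstein_walsh[OF a M _ _ _ _ bd z])
  show "continuous_on UNIV (\<lambda>z. cmod (poly P z))" by (intro continuous_intros)
  show "\<forall>\<^sub>F z in at_infinity. cmod (poly P z) \<le> (1 + 1) * cmod z ^ degree P"
    by (rule monic_poly_growth[OF P]) simp
  show "\<exists>r>0. \<exists>F. F holomorphic_on ball z0 r \<and> cmod (F z0) = cmod (poly P z0) \<and>
       (\<forall>z\<in>ball z0 r. cmod (F z) \<le> cmod (poly P z))" for z0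
    by (intro exI[of _ 1] exI[of _ "poly P"]) (auto intro!: holomorphic_intros)
qed auto

text \<open>The Bernstein--Walsh inequality evaluated near infinity, where \<open>\<bar>P(z)\<bar>\<close> is asymptotic to \<open>\<bar>z\<bar>\<^sup>N\<close>
  and \<open>e\<^sup>N\<^sup>G\<close> is, along suitable points, at most about \<open>e\<^sup>N\<^sup>\<gamma> \<bar>z\<bar>\<^sup>N\<close>.\<close>

lemma level_set_poly_lower_bound:
  fixes P :: "complex poly"
  assumes P: "lead_coeff P = 1" and a: "a \<ge> 0" and M: "M \<ge> 0"
    and bd: "\<And>z. G z = a \<Longrightarrow> cmod (poly P z) \<le> M"
    and \<gamma>: "\<And>\<delta>. \<delta> > 0 \<Longrightarrow> \<exists>\<^sub>F z in at_infinity. G z \<le> ln (cmod z) + \<gamma> + \<delta>"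
  shows "exp (real (degree P) * (a - \<gamma>)) \<le> M"
proof -
  define N where "N = degree P"
  have main: "1 - \<delta> \<le> M * exp (real N * (\<gamma> + \<delta> - a))" if \<delta>: "\<delta> > 0" for \<delta>
  proof -
    have "\<forall>\<^sub>F z in at_infinity. G z \<ge> a" using G_at_infinity by (simp add: filterlim_at_top)
    then have "\<forall>\<^sub>F z in at_infinity. z \<noteq> 0 \<and> (1 - \<delta>) * cmod z ^ N \<le> M * exp (real N * (G z - a))"
      using monic_poly_growth(1)[OF P \<delta>] eventually_not_equal_at_infinity[of 0]
    proof eventually_elim
      case (elim z)
      then show ?case using poly_bernstein_walsh[OF P a M bd elim(1)] by (simp add: N_def)
    qed
    then have "\<exists>\<^sub>F z in at_infinity. G z \<le> ln (cmod z) + \<gamma> + \<delta> \<and> z \<noteq> 0 \<and> (1 - \<delta>) * cmod z ^ N \<le> M * exp (real N * (G z - a))"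
      using frequently_eventually_frequently[OF \<gamma>[OF \<delta>]] by simp
    then obtain z where z: "G z \<le> ln (cmod z) + \<gamma> + \<delta>" "z \<noteq> 0" "(1 - \<delta>) * cmod z ^ N \<le> M * exp (real N * (G z - a))"
      using frequently_ex by blast
    have "real N * (G z - a) \<le> real N * (\<gamma> + \<delta> - a) + real N * ln (cmod z)"
      using mult_left_mono[of "G z - a" "\<gamma> + \<delta> - a + ln (cmod z)" "real N"] z(1) by (simp add: algebra_simps)
    then have "exp (real N * (G z - a)) \<le> exp (real N * (\<gamma> + \<delta> - a)) * exp (real N * ln (cmod z))"
      by (simp add: mult_exp_exp)
    also have "exp (real N * ln (cmod z)) = cmod z ^ N" using z(2) by (simp add: exp_of_nat_mult)
    finally have "(1 - \<delta>) * cmod z ^ N \<le> M * (exp (real N * (\<gamma> + \<delta> - a)) * cmod z ^ N)"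
      using z(3) M by (meson mult_left_mono order.trans)
    then show ?thesis using z(2) by (simp add: mult.assoc[symmetric])
  qed
  have "((\<lambda>\<delta>. 1 - \<delta>) \<longlongrightarrow> 1 - 0) (at_right (0::real))"
    by (intro tendsto_intros)
  moreover have "((\<lambda>\<delta>. M * exp (real N * (\<gamma> + \<delta> - a))) \<longlongrightarrow> M * exp (real N * (\<gamma> + 0 - a))) (at_right (0::real))"
    by (intro tendsto_intros)
  moreover have "\<forall>\<^sub>F \<delta> in at_right (0::real). 1 - \<delta> \<le> M * exp (real N * (\<gamma> + \<delta> - a))"
    unfolding eventually_at_right_field using main by (intro exI[of _ 1]) auto
  ultimately have "1 - 0 \<le> M * exp (real N * (\<gamma> + 0 - a))"
    using tendsto_le[OF trivial_limit_at_right_real] by blast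
  then have "exp (real N * (a - \<gamma>)) * 1 \<le> exp (real N * (a - \<gamma>)) * (M * exp (real N * (\<gamma> - a)))"
    by (intro mult_left_mono) auto
  also have "\<dots> = M * exp (real N * (a - \<gamma>) + real N * (\<gamma> - a))" by (simp add: exp_add)
  also have "real N * (a - \<gamma>) + real N * (\<gamma> - a) = 0" by (simp add: algebra_simps)
  finally show ?thesis by (simp add: N_def)
qed

end

section \<open>Capacity of the level lines\<close>

context real_green
begin

lemma compact_level_set: "compact {z. G z = a}"
proof -
  have "closed {z. G z = a}" using closed_Collect_eq[OF cont_G continuous_on_const] by simp
  moreover have "bounded {z. G z = a}"
  proof -
    have "\<forall>\<^sub>F z in at_infinity. G z > a" using G_at_infinity by (simp add: filterlim_at_top_dense)
    then obtain R where "\<And>z. cmod z \<ge> R \<Longrightarrow> G z > a" unfolding eventually_at_infinity by auto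
    then have "cmod z \<le> R" if "G z = a" for z using that by (metis less_irrefl nle_le)
    then show ?thesis by (auto simp: bounded_iff)
  qed
  ultimately show ?thesis by (simp add: compact_eq_bounded_closed)
qed

lemma level_set_exists_large:
  fixes P :: "complex poly"
  assumes P: "lead_coeff P = 1" and a: "a \<ge> 0"
    and \<gamma>: "\<And>\<delta>. \<delta> > 0 \<Longrightarrow> \<exists>\<^sub>F z in at_infinity. G z \<le> ln (cmod z) + \<gamma> + \<delta>"
  shows "\<exists>z. G z = a \<and> exp (real (degree P) * (a - \<gamma>)) \<le> cmod (poly P z)"
proof -
  let ?L = "{z. G z = a}"
  have "?L \<noteq> {}"
  proof
    assume "?L = {}"
    then have "exp (real (degree P) * (a - \<gamma>)) \<le> 0"
      by (intro level_set_poly_lower_bound[OF P a _ _ \<gamma>]) auto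
    then show False by simp
  qed
  moreover have "continuous_on ?L (\<lambda>z. cmod (poly P z))" by (intro continuous_intros)
  ultimately obtain z where z: "G z = a" "\<And>y. G y = a \<Longrightarrow> cmod (poly P y) \<le> cmod (poly P z)"
    using continuous_attains_sup[OF compact_level_set] by blast
  have "exp (real (degree P) * (a - \<gamma>)) \<le> cmod (poly P z)"
    by (rule level_set_poly_lower_bound[OF P a _ _ \<gamma>]) (use z(2) in auto)
  then show ?thesis using z(1) by blast
qed

text \<open>The next point is placed where the polynomial with the previous points as roots is large on the
  level line, as for Leja sequences; the energies of the new point with the old ones then add up
  to at most \<open>N (\<gamma> - a)\<close>.\<close>

lemma leja_points:
  assumes a: "a \<ge> 0"
    and \<gamma>: "\<And>\<delta>. \<delta> > 0 \<Longrightarrow> \<exists>\<^sub>F z in at_infinity. G z \<le> ln (cmod z) + \<gamma> + \<delta>"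
  shows "\<exists>z :: nat \<Rightarrow> complex. (\<forall>i<N. z i \<in> {z. G z = a}) \<and> inj_on z {..<N} \<and>
       (\<Sum>i<N. \<Sum>j\<in>{..<N} - {i}. - ln (dist (z i) (z j))) \<le> real N * (real N - 1) * (\<gamma> - a)"
proof (induction N)
  case 0
  then show ?case by simp
next
  case (Suc N)
  then obtain z where z: "\<And>i. i < N \<Longrightarrow> G (z i) = a" "inj_on z {..<N}"
    "(\<Sum>i<N. \<Sum>j\<in>{..<N} - {i}. - ln (dist (z i) (z j))) \<le> real N * (real N - 1) * (\<gamma> - a)" by auto
  define P where "P = (\<Prod>i<N. [:- z i, 1:])"
  have degP: "degree P = N" unfolding P_def by (subst degree_prod_sum_eq) auto
  have lcP: "lead_coeff P = 1" unfolding P_def by (subst lead_coeff_prod) simp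
  obtain w where w: "G w = a" "exp (real N * (a - \<gamma>)) \<le> cmod (poly P w)"
    using level_set_exists_large[OF lcP a \<gamma>] degP by auto
  have cP: "cmod (poly P w) = (\<Prod>i<N. dist w (z i))"
    by (simp add: P_def poly_prod prod_norm dist_norm)
  have "cmod (poly P w) > 0" using w(2) by (metis exp_gt_zero less_le_trans)
  then have ne: "dist w (z i) \<noteq> 0" if "i < N" for i
    using that unfolding cP by (metis finite_lessThan less_irrefl lessThan_iff prod_zero_iff)
  have "real N * (a - \<gamma>) \<le> ln (cmod (poly P w))"
    using w(2) \<open>cmod (poly P w) > 0\<close> by (simp add: ln_ge_iff)
  also have "\<dots> = (\<Sum>i<N. ln (dist w (z i)))"
    unfolding cP by (rule ln_prod) (use ne in \<open>auto simp: zero_less_dist_iff\<close>)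
  finally have new: "(\<Sum>i<N. - ln (dist w (z i))) \<le> real N * (\<gamma> - a)"
    by (simp add: sum_negf algebra_simps)
  let ?e = "\<lambda>x y. - ln (dist x y)"
  define v where "v = z(N := w)"
  have "inj_on v {..<Suc N}"
  proof -
    have "inj_on v {..<N}" using z(2) by (auto simp: v_def inj_on_def)
    moreover have "v N \<notin> v ` {..<N}" using ne by (auto simp: v_def)
    ultimately show ?thesis by (simp add: lessThan_Suc)
  qed
  moreover have "(\<Sum>i<Suc N. \<Sum>j\<in>{..<Suc N} - {i}. ?e (v i) (v j)) \<le> real (Suc N) * (real (Suc N) - 1) * (\<gamma> - a)"
  proof -
    have "(\<Sum>i<Suc N. \<Sum>j\<in>{..<Suc N} - {i}. ?e (v i) (v j))
       = (\<Sum>i<N. \<Sum>j\<in>{..<Suc N} - {i}. ?e (v i) (v j)) + (\<Sum>j\<in>{..<Suc N} - {N}. ?e (v N) (v j))"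
      by simp
    also have "(\<Sum>j\<in>{..<Suc N} - {N}. ?e (v N) (v j)) = (\<Sum>j<N. ?e w (z j))"
      by (rule sum.cong) (auto simp: v_def)
    also have "(\<Sum>i<N. \<Sum>j\<in>{..<Suc N} - {i}. ?e (v i) (v j))
       = (\<Sum>i<N. ?e w (z i) + (\<Sum>j\<in>{..<N} - {i}. ?e (z i) (z j)))"
    proof (rule sum.cong[OF refl])
      fix i assume i: "i \<in> {..<N}"
      then have "{..<Suc N} - {i} = insert N ({..<N} - {i})" by auto
      then have "(\<Sum>j\<in>{..<Suc N} - {i}. ?e (v i) (v j)) = ?e (v i) (v N) + (\<Sum>j\<in>{..<N} - {i}. ?e (v i) (v j))"
        by simp
      also have "(\<Sum>j\<in>{..<N} - {i}. ?e (v i) (v j)) = (\<Sum>j\<in>{..<N} - {i}. ?e (z i) (z j))"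
        using i by (intro sum.cong) (auto simp: v_def)
      finally show "(\<Sum>j\<in>{..<Suc N} - {i}. ?e (v i) (v j)) = ?e w (z i) + (\<Sum>j\<in>{..<N} - {i}. ?e (z i) (z j))"
        using i by (simp add: v_def dist_commute)
    qed
    finally have "(\<Sum>i<Suc N. \<Sum>j\<in>{..<Suc N} - {i}. ?e (v i) (v j)) =
       2 * (\<Sum>i<N. ?e w (z i)) + (\<Sum>i<N. \<Sum>j\<in>{..<N} - {i}. ?e (z i) (z j))"
      by (simp add: sum.distrib sum_negf sum_subtractf)
    also have "\<dots> \<le> 2 * (real N * (\<gamma> - a)) + real N * (real N - 1) * (\<gamma> - a)"
      using new z(3) by simp
    also have "\<dots> = real (Suc N) * (real (Suc N) - 1) * (\<gamma> - a)" by (simp add: algebra_simps)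
    finally show ?thesis .
  qed
  moreover have "\<forall>i<Suc N. v i \<in> {z. G z = a}" using z(1) w(1) by (auto simp: v_def less_Suc_eq)
  ultimately show ?case by (intro exI[of _ v] conjI)
qed

lemma log_capacity_level_set:
  assumes a: "a \<ge> 0"
    and \<gamma>: "\<And>\<delta>. \<delta> > 0 \<Longrightarrow> \<exists>\<^sub>F z in at_infinity. G z \<le> ln (cmod z) + \<gamma> + \<delta>"
  shows "exp (a - \<gamma>) \<le> log_capacity {z. G z = a}"
  using log_capacity_ge_of_points[OF compact_level_set leja_points[OF a \<gamma>]] by simp

end

section \<open>The Joukowsky map\<close>

text \<open>The larger of the moduli of the two solutions \<open>w\<close> of \<open>s = (w + 1/w)/2\<close>. The number \<open>a\<close> is the
  major semi-axis of the ellipse through \<open>s\<close> with foci \<open>1\<close> and \<open>-1\<close>; written in this way the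
  function is visibly continuous on the whole plane.\<close>

definition joukowsky_modulus :: "complex \<Rightarrow> real" where
  "joukowsky_modulus s =
     (let a = (cmod (s - 1) + cmod (s + 1)) / 2 in a + sqrt (a\<^sup>2 - 1))"

lemma ellipse_parameter_ge_1: "(cmod (s - 1) + cmod (s + 1)) / 2 \<ge> 1"
proof -
  have "2 = cmod ((s + 1) - (s - 1))" by simp
  also have "\<dots> \<le> cmod (s + 1) + cmod (s - 1)" by (rule norm_triangle_ineq4)
  finally show ?thesis by simp
qed

lemma joukowsky_modulus_ge_1: "joukowsky_modulus s \<ge> 1"
proof -
  have "sqrt (((cmod (s - 1) + cmod (s + 1)) / 2)\<^sup>2 - 1) \<ge> 0"
    using ellipse_parameter_ge_1[of s] by simp
  then show ?thesis
    unfolding joukowsky_modulus_def Let_def using ellipse_parameter_ge_1[of s] by linarith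
qed

lemma continuous_joukowsky_modulus: "continuous_on UNIV joukowsky_modulus"
  unfolding joukowsky_modulus_def[abs_def] Let_def by (intro continuous_intros) auto

lemma joukowsky_modulus_param:
  assumes "w \<noteq> 0" "s = (w + 1 / w) / 2"
  shows "joukowsky_modulus s = max (cmod w) (1 / cmod w)"
proof -
  have "s - 1 = (w - 1)\<^sup>2 / (2 * w)" "s + 1 = (w + 1)\<^sup>2 / (2 * w)"
    using assms by (simp_all add: field_simps power2_eq_square)
  then have "cmod (s - 1) + cmod (s + 1) = ((cmod (w - 1))\<^sup>2 + (cmod (w + 1))\<^sup>2) / (2 * cmod w)"
    by (simp add: norm_divide norm_mult norm_power add_divide_distrib)
  also have "(cmod (w - 1))\<^sup>2 + (cmod (w + 1))\<^sup>2 = 2 * (cmod w)\<^sup>2 + 2"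
    by (simp add: cmod_power2) (simp add: power2_eq_square algebra_simps)
  finally have a: "(cmod (s - 1) + cmod (s + 1)) / 2 = (cmod w + 1 / cmod w) / 2"
    using assms(1) by (simp add: field_simps power2_eq_square)
  have "((cmod w + 1 / cmod w) / 2)\<^sup>2 - 1 = ((cmod w - 1 / cmod w) / 2)\<^sup>2"
    using assms(1) by (simp add: field_simps power2_eq_square)
  then have "joukowsky_modulus s = (cmod w + 1 / cmod w) / 2 + \<bar>(cmod w - 1 / cmod w) / 2\<bar>"
    unfolding joukowsky_modulus_def Let_def a by simp
  moreover have "max u v = (u + v) / 2 + \<bar>(u - v) / 2\<bar>" for u v :: real
    by (simp add: max_def abs_if field_simps)
  ultimately show ?thesis by (simp only:)
qed

lemma joukowsky_modulus_eq_1: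
  assumes "\<bar>x\<bar> \<le> 1"
  shows "joukowsky_modulus (of_real x) = 1"
proof -
  have "cmod (of_real x - 1) = 1 - x" "cmod (of_real x + 1) = 1 + x"
    using assms norm_of_real[of "x - 1"] norm_of_real[of "x + 1"] by (simp_all del: norm_of_real)
  then show ?thesis by (simp add: joukowsky_modulus_def)
qed

lemma joukowsky_modulus_sum:
  "2 * cmod s \<le> joukowsky_modulus s + 1 / joukowsky_modulus s"
proof -
  define a where "a = (cmod (s - 1) + cmod (s + 1)) / 2"
  have a: "a \<ge> 1" unfolding a_def by (rule ellipse_parameter_ge_1)
  have J: "joukowsky_modulus s = a + sqrt (a\<^sup>2 - 1)" by (simp add: joukowsky_modulus_def a_def Let_def)
  have "(a + sqrt (a\<^sup>2 - 1)) * (a - sqrt (a\<^sup>2 - 1)) = 1"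
    using a by (simp add: algebra_simps power2_eq_square[symmetric])
  then have "1 / joukowsky_modulus s = a - sqrt (a\<^sup>2 - 1)"
    using joukowsky_modulus_ge_1[of s] unfolding J by (simp add: field_simps)
  then have "joukowsky_modulus s + 1 / joukowsky_modulus s = cmod (s - 1) + cmod (s + 1)"
    unfolding J by (simp add: a_def)
  moreover have "2 * cmod s = cmod ((s - 1) + (s + 1))"
    by (simp add: norm_mult flip: mult_2)
  ultimately show ?thesis using norm_triangle_ineq[of "s - 1" "s + 1"] by linarith
qed

lemma joukowsky_modulus_upper: "joukowsky_modulus s \<le> 2 * cmod s + 2"
proof -
  define a where "a = (cmod (s - 1) + cmod (s + 1)) / 2"
  have a: "a \<ge> 1" unfolding a_def by (rule ellipse_parameter_ge_1)
  have "sqrt (a\<^sup>2 - 1) \<le> a" using a by (intro real_le_lsqrt) auto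
  moreover have "a \<le> cmod s + 1"
    using norm_triangle_ineq4[of s 1] norm_triangle_ineq[of s 1] by (simp add: a_def)
  ultimately show ?thesis by (simp add: joukowsky_modulus_def a_def[symmetric])
qed

text \<open>Away from the branch points both solutions \<open>s \<plusminus> q\<close> are holomorphic, and the modulus is their
  maximum; at the branch points the constant 1 touches it from below.\<close>

lemma joukowsky_modulus_locally_dominates:
  "\<exists>r>0. \<exists>F. F holomorphic_on ball s0 r \<and> cmod (F s0) = joukowsky_modulus s0 \<and>
     (\<forall>s\<in>ball s0 r. cmod (F s) \<le> joukowsky_modulus s)"
proof (cases "s0 = 1 \<or> s0 = - 1")
  case True
  then have "joukowsky_modulus s0 = 1"
    using joukowsky_modulus_eq_1[of 1] joukowsky_modulus_eq_1[of "- 1"] by auto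
  then show ?thesis
    using joukowsky_modulus_ge_1
    by (metis holomorphic_on_const norm_one zero_less_one)
next
  case False
  define r where "r = min (dist s0 1) (dist s0 (- 1))"
  have r: "r > 0" using False by (simp add: r_def)
  have ne: "s\<^sup>2 - 1 \<noteq> 0" if "s \<in> ball s0 r" for s
  proof
    assume "s\<^sup>2 - 1 = 0"
    then have "s = 1 \<or> s = - 1" by (metis eq_iff_diff_eq_0 power2_eq_1_iff)
    then show False using that by (auto simp: r_def)
  qed
  obtain g where g: "g holomorphic_on ball s0 r" "\<And>s. s \<in> ball s0 r \<Longrightarrow> exp (g s) = s\<^sup>2 - 1"
  proof (rule holomorphic_logarithm_exists[of "ball s0 r" "\<lambda>s. s\<^sup>2 - 1" s0])
    show "(\<lambda>s. s\<^sup>2 - 1) holomorphic_on ball s0 r" by (intro holomorphic_intros)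
  qed (use ne r in auto)
  define q where "q s = exp (g s / 2)" for s
  have q: "q holomorphic_on ball s0 r" unfolding q_def by (intro holomorphic_intros g(1)) auto
  have q2: "q s * q s = s\<^sup>2 - 1" if "s \<in> ball s0 r" for s
    using g(2)[OF that] by (simp add: q_def flip: exp_add)
  have prod: "(s + q s) * (s - q s) = 1" if "s \<in> ball s0 r" for s
    using q2[OF that] by (simp add: algebra_simps power2_eq_square)
  have J: "joukowsky_modulus s = max (cmod (s + q s)) (cmod (s - q s))" if "s \<in> ball s0 r" for s
  proof -
    have nz: "s + q s \<noteq> 0" using prod[OF that] by (metis mult_zero_left zero_neq_one)
    then have inv: "s - q s = 1 / (s + q s)"
      using prod[OF that] by (simp add: nonzero_eq_divide_eq mult.commute)
    have "s = ((s + q s) + (s - q s)) / 2" by simp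
    then have "s = ((s + q s) + 1 / (s + q s)) / 2" unfolding inv .
    then show ?thesis using joukowsky_modulus_param[OF nz] unfolding inv norm_divide norm_one by blast
  qed
  have dom: ?thesis if F: "F holomorphic_on ball s0 r" "cmod (F s0) = joukowsky_modulus s0"
    "\<And>s. s \<in> ball s0 r \<Longrightarrow> cmod (F s) \<le> joukowsky_modulus s" for F
    using r F by blast
  have s0: "s0 \<in> ball s0 r" using r by simp
  show ?thesis
  proof (cases "cmod (s0 + q s0) \<ge> cmod (s0 - q s0)")
    case True
    show ?thesis
    proof (rule dom)
      show "(\<lambda>s. s + q s) holomorphic_on ball s0 r" by (intro holomorphic_intros q)
    qed (use J[OF s0] True in \<open>simp_all add: J\<close>)
  next
    case False
    show ?thesis
    proof (rule dom)
      show "(\<lambda>s. s - q s) holomorphic_on ball s0 r" by (intro holomorphic_intros q)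
    qed (use J[OF s0] False in \<open>simp_all add: J\<close>)
  qed
qed

text \<open>With \<open>T = t (w + 1/w)/2\<close> the Bernstein--Walsh inequality for \<open>\<bar>w\<bar>\<close> gives \<open>1 \<le> \<bar>w\<bar> \<le> e\<^sup>n\<^sup>G\<close>, and
  \<open>x + 1/x\<close> is increasing for \<open>x \<ge> 1\<close>.\<close>

lemma (in real_green) poly_bound_on_level_set:
  fixes T :: "complex poly"
  assumes T: "lead_coeff T = 1" and t: "t > 0"
    and E: "\<And>z. z \<in> E \<Longrightarrow> poly T z \<in> \<real> \<and> cmod (poly T z) \<le> t"
  shows "cmod (poly T z) \<le> t / 2 * (exp (real (degree T) * G z) + exp (- (real (degree T) * G z)))"
proof -
  define n where "n = degree T"
  define \<Phi> where "\<Phi> z = joukowsky_modulus (poly T z / of_real t)" for z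
  have "\<Phi> z \<le> 1 * exp (real n * (G z - 0))"
  proof (rule bernstein_walsh[where C = "4 / t + 2"])
    show "continuous_on UNIV \<Phi>"
      unfolding \<Phi>_def using t
      by (intro continuous_on_compose2[OF continuous_joukowsky_modulus] continuous_intros) auto
    show "\<Phi> z \<ge> 0" for z using joukowsky_modulus_ge_1[of "poly T z / of_real t"] by (simp add: \<Phi>_def)
    show "\<exists>r>0. \<exists>F. F holomorphic_on ball z0 r \<and> cmod (F z0) = \<Phi> z0 \<and> (\<forall>z\<in>ball z0 r. cmod (F z) \<le> \<Phi> z)" for z0
    proof -
      let ?h = "\<lambda>z. poly T z / of_real t"
      obtain r F where F: "r > 0" "F holomorphic_on ball (?h z0) r" "cmod (F (?h z0)) = joukowsky_modulus (?h z0)"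
        "\<And>s. s \<in> ball (?h z0) r \<Longrightarrow> cmod (F s) \<le> joukowsky_modulus s"
        using joukowsky_modulus_locally_dominates[of "?h z0"] by blast
      have "isCont ?h z0" using t by (intro continuous_intros) auto
      then obtain d where d: "d > 0" "?h ` ball z0 d \<subseteq> ball (?h z0) r"
        unfolding continuous_at_ball using F(1) by blast
      have "(F \<circ> ?h) holomorphic_on ball z0 d"
        by (rule holomorphic_on_compose_gen[OF _ F(2)]) (use d t in \<open>auto intro!: holomorphic_intros\<close>)
      moreover have "cmod ((F \<circ> ?h) z) \<le> \<Phi> z" if "z \<in> ball z0 d" for z
      proof -
        have "?h z \<in> ball (?h z0) r" using d(2) that by blast
        from F(4)[OF this] show ?thesis by (simp add: \<Phi>_def)
      qed
      ultimately show ?thesis using d(1) F(3) by (intro exI[of _ d] conjI exI[of _ "F \<circ> ?h"]) (auto simp: \<Phi>_def)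
    qed
    have "\<forall>\<^sub>F z::complex in at_infinity. cmod z \<ge> 1" unfolding eventually_at_infinity by blast
    then show "\<forall>\<^sub>F z in at_infinity. \<Phi> z \<le> (4 / t + 2) * cmod z ^ n"
      using monic_poly_growth(2)[OF T zero_less_one]
    proof eventually_elim
      case (elim z)
      have "\<Phi> z \<le> 2 * (cmod (poly T z) / t) + 2"
        using joukowsky_modulus_upper[of "poly T z / of_real t"] t by (simp add: \<Phi>_def norm_divide)
      also have "\<dots> \<le> 2 * (2 * cmod z ^ n / t) + 2 * cmod z ^ n"
        using elim t by (intro add_mono mult_left_mono divide_right_mono) (auto simp: n_def)
      finally show ?case by (simp add: algebra_simps)
    qed
    show "\<Phi> z \<le> 1" if "G z = 0" for z
    proof -
      have "z \<in> E" using that G_pos[of z] by force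
      then obtain x where "poly T z = of_real x" "\<bar>x\<bar> \<le> t" using E[of z] by (auto simp: Reals_def)
      then have "\<Phi> z = joukowsky_modulus (of_real (x / t))" by (simp add: \<Phi>_def)
      then show ?thesis using joukowsky_modulus_eq_1[of "x / t"] \<open>\<bar>x\<bar> \<le> t\<close> t by (simp add: abs_divide)
    qed
  qed (use G_nonneg in auto)
  then have up: "\<Phi> z \<le> exp (real n * G z)" by simp
  define J where "J = \<Phi> z"
  define e where "e = exp (real n * G z)"
  have J: "1 \<le> J" "J \<le> e" using up joukowsky_modulus_ge_1 by (auto simp: J_def \<Phi>_def e_def)
  have "J + 1 / J \<le> e + 1 / e"
  proof -
    have "(e - J) * (J * e - 1) \<ge> 0" using J mult_mono[of 1 J 1 e] by (intro mult_nonneg_nonneg) auto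
    moreover have "e + 1 / e - (J + 1 / J) = (e - J) * (J * e - 1) / (J * e)"
      using J by (simp add: field_simps)
    ultimately show ?thesis using J by (metis diff_ge_0_iff_ge divide_nonneg_nonneg mult_nonneg_nonneg order.trans zero_le_one)
  qed
  moreover have "2 * (cmod (poly T z) / t) \<le> J + 1 / J"
    using joukowsky_modulus_sum[of "poly T z / of_real t"] t by (simp add: J_def \<Phi>_def norm_divide)
  ultimately have "2 * (cmod (poly T z) / t) \<le> e + 1 / e" by linarith
  then have "cmod (poly T z) \<le> t / 2 * (e + 1 / e)" using t by (simp add: field_simps)
  then show ?thesis by (simp add: e_def n_def exp_minus inverse_eq_divide)
qed

section \<open>Sums of the Green's function over fibres of a polynomial\<close>

locale real_green_poly = real_green +
  fixes T :: "complex poly" and t :: real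
  assumes monic: "lead_coeff T = 1" and deg: "degree T \<ge> 1" and t_pos: "t > 0"
    and T_on_E: "z \<in> E \<Longrightarrow> poly T z \<in> \<real> \<and> cmod (poly T z) \<le> t"
begin

definition fibre :: "complex \<Rightarrow> complex set" where
  "fibre s = {z. poly T z = of_real t * s}"

text \<open>The sum is over the set of solutions, without multiplicities, so it may jump at critical values of
  \<open>T\<close>. There \<open>branch_poly\<close> vanishes, and the values of the sum are used only where it does not
  vanish, or multiplied by it.\<close>

definition fibre_sum :: "complex \<Rightarrow> real" where
  "fibre_sum s = (\<Sum>z\<in>fibre s. G z)"

definition critical :: "complex set" where
  "critical = {z. poly (pderiv T) z = 0}"

text \<open>The factor \<open>s\<^sup>2 - 1\<close> adds the end points \<open>\<plusminus>1\<close> to the exceptional values: over them two points of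
  the fibre may lie in the same gap.\<close>

definition branch_poly :: "complex \<Rightarrow> complex" where
  "branch_poly s = (s\<^sup>2 - 1) * (\<Prod>z\<in>critical. s - poly T z / of_real t)"

lemma finite_critical: "finite critical"
  and card_critical: "card critical < degree T"
proof -
  have "pderiv T \<noteq> 0" using deg by (metis degree_0 not_one_le_zero pderiv_eq_0_iff)
  then show "finite critical" unfolding critical_def by (rule poly_roots_finite)
  have "card critical \<le> degree (pderiv T)"
    unfolding critical_def by (rule card_poly_roots_bound) fact
  then show "card critical < degree T" using deg by (simp add: degree_pderiv)
qed

lemma fibre_poly: "fibre s = {z. poly (T - [:of_real t * s:]) z = 0}"
  by (auto simp: fibre_def)

lemma fibre_poly_lead: "degree (T - [:of_real t * s:]) = degree T" "lead_coeff (T - [:of_real t * s:]) = 1"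
proof -
  have d: "degree [:of_real t * s:] < degree T" using deg by simp
  then show *: "degree (T - [:of_real t * s:]) = degree T"
    unfolding diff_conv_add_uminus by (intro degree_add_eq_left) simp
  show "lead_coeff (T - [:of_real t * s:]) = 1"
    unfolding * using coeff_eq_0[OF d] monic by simp
qed

lemma finite_fibre: "finite (fibre s)" and card_fibre_le: "card (fibre s) \<le> degree T"
proof -
  have ne: "T - [:of_real t * s:] \<noteq> 0" using fibre_poly_lead(2)[of s] by (metis coeff_0 zero_neq_one)
  show "finite (fibre s)" unfolding fibre_poly by (rule poly_roots_finite[OF ne])
  show "card (fibre s) \<le> degree T"
    unfolding fibre_poly using card_poly_roots_bound[OF ne] fibre_poly_lead(1) by simp
qed

lemma noncritical_fibre:
  assumes "branch_poly s \<noteq> 0"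
  shows "T - [:of_real t * s:] = (\<Prod>z\<in>fibre s. [:- z, 1:])" "card (fibre s) = degree T"
    "z \<in> fibre s \<Longrightarrow> poly (pderiv T) z \<noteq> 0"
proof -
  show nz: "poly (pderiv T) z \<noteq> 0" if "z \<in> fibre s" for z
  proof
    assume "poly (pderiv T) z = 0"
    then have "z \<in> critical" by (simp add: critical_def)
    moreover have "s - poly T z / of_real t = 0" using that t_pos by (simp add: fibre_def)
    ultimately have "(\<Prod>z\<in>critical. s - poly T z / of_real t) = 0"
      using finite_critical by (intro prod_zero) auto
    then show False using assms by (simp add: branch_poly_def)
  qed
  have "rsquarefree (T - [:of_real t * s:])"
    unfolding rsquarefree_roots
  proof (intro allI notI)
    fix a assume "poly (T - [:of_real t * s:]) a = 0 \<and> poly (pderiv (T - [:of_real t * s:])) a = 0"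
    then show False using nz[of a] by (simp add: fibre_def pderiv_diff pderiv_pCons)
  qed
  from complex_poly_decompose_rsquarefree[OF this]
  show eq: "T - [:of_real t * s:] = (\<Prod>z\<in>fibre s. [:- z, 1:])"
    unfolding fibre_poly_lead(2) fibre_poly[symmetric] by simp
  have "degree T = degree (\<Prod>z\<in>fibre s. [:- z, 1:])" using fibre_poly_lead(1)[of s] eq by simp
  also have "\<dots> = (\<Sum>z\<in>fibre s. 1)" by (subst degree_prod_sum_eq) auto
  finally show "card (fibre s) = degree T" by simp
qed

text \<open>Over a noncritical value all \<open>n\<close> solutions are simple and continue holomorphically in disjoint
  discs. As a fibre has at most \<open>n\<close> points, there are no others nearby.\<close>

lemma fibre_branches:
  assumes "branch_poly s0 \<noteq> 0"
  shows "\<exists>r \<phi>. r > 0 \<and> (\<forall>z\<in>fibre s0. \<phi> z holomorphic_on ball s0 r \<and> \<phi> z s0 = z) \<and>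
    (\<forall>s\<in>ball s0 r. fibre_sum s = (\<Sum>z\<in>fibre s0. G (\<phi> z s)))"
proof -
  define Q where "Q z d e g \<longleftrightarrow> d > 0 \<and> (\<forall>z'\<in>fibre s0. z' \<noteq> z \<longrightarrow> 2 * d \<le> dist z z') \<and> e > 0 \<and>
     g holomorphic_on ball (of_real t * s0) e \<and> g (of_real t * s0) = z \<and>
     (\<forall>u\<in>ball (of_real t * s0) e. g u \<in> ball z d \<and> poly T (g u) = u)"
    for z :: complex and d e :: real and g
  have "\<exists>d e g. Q z d e g" if z: "z \<in> fibre s0" for z
  proof -
    obtain d where d: "d > 0" "\<forall>z'\<in>fibre s0. z' \<noteq> z \<longrightarrow> d \<le> dist z z'"
      using finite_set_avoid[OF finite_fibre] by blast
    have "deriv (poly T) z \<noteq> 0"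
      using noncritical_fibre(3)[OF assms z] by (simp add: DERIV_imp_deriv[OF poly_DERIV])
    moreover have "poly T holomorphic_on ball z (d / 2)" by (intro holomorphic_intros)
    ultimately obtain r where r: "r > 0" "ball z r \<subseteq> ball z (d / 2)" "open (poly T ` ball z r)" "inj_on (poly T) (ball z r)"
      using has_complex_derivative_locally_invertible[of "poly T" "ball z (d / 2)" z] d(1) by auto
    obtain g where g: "g holomorphic_on (poly T ` ball z r)" "\<And>y. y \<in> ball z r \<Longrightarrow> g (poly T y) = y"
    proof (rule holomorphic_has_inverse[of "poly T" "ball z r"])
      show "poly T holomorphic_on ball z r" by (intro holomorphic_intros)
    qed (use r(4) in auto)
    have "of_real t * s0 \<in> poly T ` ball z r" using z r(1) by (intro image_eqI[of _ _ z]) (auto simp: fibre_def)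
    then obtain e where e: "e > 0" "ball (of_real t * s0) e \<subseteq> poly T ` ball z r"
      using r(3) open_contains_ball by blast
    have "g (of_real t * s0) = z" using g(2)[of z] r(1) z by (simp add: fibre_def)
    moreover have "g u \<in> ball z (d / 2) \<and> poly T (g u) = u" if "u \<in> ball (of_real t * s0) e" for u
    proof -
      have "u \<in> poly T ` ball z r" using that e(2) by blast
      then obtain y where "y \<in> ball z r" "u = poly T y" by blast
      then show ?thesis using g(2)[of y] r(2) by auto
    qed
    moreover have "g holomorphic_on ball (of_real t * s0) e" using g(1) e(2) by (rule holomorphic_on_subset)
    ultimately have "Q z (d / 2) e g" unfolding Q_def using d e(1) by auto
    then show ?thesis by blast
  qed
  then obtain d e g where Q: "\<And>z. z \<in> fibre s0 \<Longrightarrow> Q z (d z) (e z) (g z)" by metis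
  have d: "2 * d z \<le> dist z z'" if "z \<in> fibre s0" "z' \<in> fibre s0" "z' \<noteq> z" for z z'
    using Q[OF that(1)] that(2,3) unfolding Q_def by blast
  have e: "e z > 0" and g: "g z holomorphic_on ball (of_real t * s0) (e z)" "g z (of_real t * s0) = z"
      "u \<in> ball (of_real t * s0) (e z) \<Longrightarrow> g z u \<in> ball z (d z) \<and> poly T (g z u) = u"
    if "z \<in> fibre s0" for z u
    using Q[OF that] unfolding Q_def by blast+
  have ne: "fibre s0 \<noteq> {}" using noncritical_fibre(2)[OF assms] deg by auto
  define r where "r = Min (e ` fibre s0) / t"
  have r: "r > 0" unfolding r_def using e ne finite_fibre t_pos by simp
  have r_le: "of_real t * s \<in> ball (of_real t * s0) (e z)" if "s \<in> ball s0 r" "z \<in> fibre s0" for s z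
  proof -
    have "dist (of_real t * s0) (of_real t * s) = t * dist s0 s"
      using t_pos by (simp add: dist_norm norm_mult flip: right_diff_distrib)
    also have "\<dots> < t * r" using that(1) t_pos by simp
    also have "\<dots> \<le> e z" unfolding r_def using t_pos finite_fibre that(2) by simp
    finally show ?thesis by simp
  qed
  define \<phi> where "\<phi> z s = g z (of_real t * s)" for z s
  show ?thesis
  proof (intro exI[of _ r] exI[of _ \<phi>] conjI ballI r)
    fix z assume z: "z \<in> fibre s0"
    have "(g z \<circ> (\<lambda>s. of_real t * s)) holomorphic_on ball s0 r"
      by (rule holomorphic_on_compose_gen[OF _ g(1)[OF z]]) (use r_le z in \<open>auto intro!: holomorphic_intros\<close>)
    then show "\<phi> z holomorphic_on ball s0 r" by (simp add: \<phi>_def[abs_def] comp_def)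
    show "\<phi> z s0 = z" using g(2)[OF z] by (simp add: \<phi>_def)
  next
    fix s assume s: "s \<in> ball s0 r"
    have \<phi>: "\<phi> z s \<in> ball z (d z)" "\<phi> z s \<in> fibre s" if "z \<in> fibre s0" for z
      using g(3)[OF that r_le[OF s that]] by (auto simp: \<phi>_def fibre_def)
    have inj: "inj_on (\<lambda>z. \<phi> z s) (fibre s0)"
    proof (rule inj_onI, rule ccontr)
      fix x y assume xy: "x \<in> fibre s0" "y \<in> fibre s0" "\<phi> x s = \<phi> y s" "x \<noteq> y"
      have "dist x y < d x + d y"
        using \<phi>(1)[OF xy(1)] \<phi>(1)[OF xy(2)] xy(3) dist_triangle2[of x y "\<phi> x s"] by (simp add: dist_commute)
      moreover have "2 * d x \<le> dist x y" "2 * d y \<le> dist x y"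
        using d[OF xy(1,2)] d[OF xy(2,1)] xy(4) by (auto simp: dist_commute)
      ultimately show False by linarith
    qed
    have "(\<lambda>z. \<phi> z s) ` fibre s0 = fibre s"
    proof (rule card_seteq[OF finite_fibre])
      show "card (fibre s) \<le> card ((\<lambda>z. \<phi> z s) ` fibre s0)"
        using card_image[OF inj] noncritical_fibre(2)[OF assms] card_fibre_le[of s] by simp
    qed (use \<phi>(2) in auto)
    then show "fibre_sum s = (\<Sum>z\<in>fibre s0. G (\<phi> z s))"
      by (simp add: fibre_sum_def sum.reindex[OF inj] flip: \<open>_ = fibre s\<close>)
  qed
qed

lemma isCont_fibre_sum:
  assumes "branch_poly s0 \<noteq> 0"
  shows "isCont fibre_sum s0"
proof -
  obtain r \<phi> where r: "r > 0" and \<phi>: "\<And>z. z \<in> fibre s0 \<Longrightarrow> \<phi> z holomorphic_on ball s0 r"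
    "\<And>z. z \<in> fibre s0 \<Longrightarrow> \<phi> z s0 = z"
    "\<And>s. s \<in> ball s0 r \<Longrightarrow> fibre_sum s = (\<Sum>z\<in>fibre s0. G (\<phi> z s))"
    using fibre_branches[OF assms] by blast
  have "continuous_on (ball s0 r) (\<lambda>s. \<Sum>z\<in>fibre s0. G (\<phi> z s))"
    by (intro continuous_on_sum continuous_on_compose2[OF cont_G] holomorphic_on_imp_continuous_on \<phi>(1)) auto
  then have "continuous_on (ball s0 r) fibre_sum"
    by (rule continuous_on_eq) (simp add: \<phi>(3))
  then show ?thesis using r by (simp add: continuous_on_eq_continuous_at)
qed

lemma fibre_sum_local_completion:
  assumes "branch_poly s0 \<noteq> 0" "fibre s0 \<inter> E = {}"
  shows "\<exists>r f. r > 0 \<and> f holomorphic_on ball s0 r \<and> (\<forall>s\<in>ball s0 r. Re (f s) = fibre_sum s)"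
proof -
  obtain r \<phi> where r: "r > 0" and \<phi>: "\<And>z. z \<in> fibre s0 \<Longrightarrow> \<phi> z holomorphic_on ball s0 r"
    "\<And>z. z \<in> fibre s0 \<Longrightarrow> \<phi> z s0 = z"
    "\<And>s. s \<in> ball s0 r \<Longrightarrow> fibre_sum s = (\<Sum>z\<in>fibre s0. G (\<phi> z s))"
    using fibre_branches[OF assms(1)] by blast
  define Q where "Q z d h \<longleftrightarrow> d > 0 \<and> d \<le> r \<and> h holomorphic_on ball s0 d \<and> (\<forall>s\<in>ball s0 d. Re (h s) = G (\<phi> z s))"
    for z d h
  have "\<exists>d h. Q z d h" if z: "z \<in> fibre s0" for z
  proof -
    have "z \<notin> E" using assms(2) z by blast
    obtain \<rho> f where f: "\<rho> > 0" "f holomorphic_on ball z \<rho>" "\<And>y. y \<in> ball z \<rho> \<Longrightarrow> Re (f y) = G y"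
    proof (rule local_completion[of UNIV z])
      show "z \<notin> E" by fact
    qed blast+
    have "isCont (\<phi> z) s0"
      using holomorphic_on_imp_continuous_on[OF \<phi>(1)[OF z]] r
      by (simp add: continuous_on_eq_continuous_at)
    then obtain d where d: "d > 0" "\<phi> z ` ball s0 d \<subseteq> ball z \<rho>"
      unfolding continuous_at_ball using f(1) \<phi>(2)[OF z] by metis
    have sub: "ball s0 (min d r) \<subseteq> ball s0 r" by auto
    have im: "\<phi> z ` ball s0 (min d r) \<subseteq> ball z \<rho>" using d(2) by (auto simp: image_subset_iff)
    have "(f \<circ> \<phi> z) holomorphic_on ball s0 (min d r)"
      by (rule holomorphic_on_compose_gen[OF holomorphic_on_subset[OF \<phi>(1)[OF z] sub] f(2) im])
    moreover have "Re ((f \<circ> \<phi> z) s) = G (\<phi> z s)" if "s \<in> ball s0 (min d r)" for s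
      using f(3)[of "\<phi> z s"] im that by (simp add: image_subset_iff)
    ultimately have "Q z (min d r) (f \<circ> \<phi> z)" unfolding Q_def using d(1) r by auto
    then show ?thesis by blast
  qed
  then obtain d h where Q: "\<And>z. z \<in> fibre s0 \<Longrightarrow> Q z (d z) (h z)" by metis
  have d: "d z > 0" "d z \<le> r" and h: "h z holomorphic_on ball s0 (d z)"
      "s \<in> ball s0 (d z) \<Longrightarrow> Re (h z s) = G (\<phi> z s)" if "z \<in> fibre s0" for z s
    using Q[OF that] unfolding Q_def by blast+
  have ne: "fibre s0 \<noteq> {}" using noncritical_fibre(2)[OF assms(1)] deg by auto
  define \<rho> where "\<rho> = Min (d ` fibre s0)"
  have \<rho>: "\<rho> > 0" unfolding \<rho>_def using d ne finite_fibre by simp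
  have \<rho>_le: "\<rho> \<le> d z" if "z \<in> fibre s0" for z unfolding \<rho>_def using that finite_fibre by simp
  show ?thesis
  proof (intro exI[of _ \<rho>] exI[of _ "\<lambda>s. \<Sum>z\<in>fibre s0. h z s"] conjI ballI \<rho>)
    show "(\<lambda>s. \<Sum>z\<in>fibre s0. h z s) holomorphic_on ball s0 \<rho>"
      by (intro holomorphic_on_sum holomorphic_on_subset[OF h(1)]) (use \<rho>_le in \<open>auto simp: subset_ball\<close>)
    show "Re (\<Sum>z\<in>fibre s0. h z s) = fibre_sum s" if s: "s \<in> ball s0 \<rho>" for s
    proof -
      obtain z0 where "z0 \<in> fibre s0" using ne by blast
      then have sr: "s \<in> ball s0 r" using s \<rho>_le d(2) by fastforce
      have "Re (\<Sum>z\<in>fibre s0. h z s) = (\<Sum>z\<in>fibre s0. G (\<phi> z s))"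
        unfolding Re_sum by (intro sum.cong refl h(2)) (use s \<rho>_le in fastforce)+
      also have "\<dots> = fibre_sum s" by (rule \<phi>(3)[OF sr, symmetric])
      finally show ?thesis .
    qed
  qed
qed

lemma G_le_log:
  obtains C where "C \<ge> 0" "\<And>z. G z \<le> C + ln (max 1 (cmod z))"
proof -
  obtain c where "c > 0" "\<forall>\<^sub>F z in at_infinity. \<bar>G z - ln (cmod z)\<bar> \<le> c" by (rule G_log_bounds)
  then obtain R where c: "c > 0" "\<And>z. cmod z \<ge> R \<Longrightarrow> \<bar>G z - ln (cmod z)\<bar> \<le> c"
    unfolding eventually_at_infinity by blast
  have "compact (G ` cball 0 (max 1 R))"
    by (intro compact_continuous_image continuous_on_subset[OF cont_G]) auto
  then obtain M where M: "\<And>z. cmod z \<le> max 1 R \<Longrightarrow> \<bar>G z\<bar> \<le> M"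
  proof -
    assume *: "\<And>M. (\<And>z. cmod z \<le> max 1 R \<Longrightarrow> \<bar>G z\<bar> \<le> M) \<Longrightarrow> thesis"
    obtain M where "\<forall>y\<in>G ` cball 0 (max 1 R). norm y \<le> M"
      using compact_imp_bounded[OF \<open>compact _\<close>] unfolding bounded_iff by blast
    then show thesis by (intro *[of M]) auto
  qed
  have M0: "M \<ge> 0" using M[of 0] by (simp add: le_max_iff_disj)
  show ?thesis
  proof (rule that[of "M + c"])
    show "G z \<le> M + c + ln (max 1 (cmod z))" for z
    proof (cases "cmod z \<le> max 1 R")
      case True
      have "ln (max 1 (cmod z)) \<ge> 0" by simp
      then show ?thesis using M[OF True] c(1) by linarith
    next
      case False
      then have "max 1 (cmod z) = cmod z" "cmod z \<ge> R" by auto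
      moreover from this have "\<bar>G z - ln (cmod z)\<bar> \<le> c" using c(2) by blast
      ultimately show ?thesis using M0 by linarith
    qed
  qed (use M0 c(1) in simp)
qed

lemma power_le_poly:
  obtains C where "C \<ge> 1" "\<And>z. max 1 (cmod z) ^ degree T \<le> C * max 1 (cmod (poly T z))"
proof -
  have "\<forall>\<^sub>F z in at_infinity. (1 - 1 / 2) * cmod z ^ degree T \<le> cmod (poly T z)"
    by (rule monic_poly_growth(1)[OF monic]) simp
  then obtain R where R: "\<And>z. cmod z \<ge> R \<Longrightarrow> (1 - 1 / 2) * cmod z ^ degree T \<le> cmod (poly T z)"
    unfolding eventually_at_infinity by blast
  define C where "C = 2 + max 1 R ^ degree T"
  have C: "C \<ge> 2" "C \<ge> max 1 R ^ degree T" by (simp_all add: C_def)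
  show ?thesis
  proof (rule that[of C])
    fix z
    show "max 1 (cmod z) ^ degree T \<le> C * max 1 (cmod (poly T z))"
    proof (cases "cmod z \<le> max 1 R")
      case True
      then have "max 1 (cmod z) ^ degree T \<le> max 1 R ^ degree T" by (intro power_mono) auto
      also have "\<dots> \<le> C * 1" using C by simp
      also have "\<dots> \<le> C * max 1 (cmod (poly T z))" using C by (intro mult_left_mono) auto
      finally show ?thesis .
    next
      case False
      then have "max 1 (cmod z) = cmod z" by auto
      moreover have "R \<le> cmod z" using False by simp
      ultimately have "max 1 (cmod z) ^ degree T \<le> 2 * cmod (poly T z)" using R[of z] by simp
      also have "\<dots> \<le> C * max 1 (cmod (poly T z))" using C by (intro mult_mono) auto
      finally show ?thesis .
    qed
  qed (use C in simp)
qed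

lemma fibre_sum_growth:
  obtains K where "K > 0" "\<And>s. exp (fibre_sum s) \<le> K * max 1 (cmod s)"
proof -
  obtain C where C: "C \<ge> 0" "\<And>z. G z \<le> C + ln (max 1 (cmod z))" by (rule G_le_log) blast
  obtain C' where C': "C' \<ge> 1" "\<And>z. max 1 (cmod z) ^ degree T \<le> C' * max 1 (cmod (poly T z))"
    by (rule power_le_poly) blast
  define n where "n = degree T"
  have n: "real n > 0" using deg by (simp add: n_def)
  show ?thesis
  proof (rule that[of "exp (real n * C) * C' * max 1 t"])
    fix s
    define L where "L = ln (C' * max 1 (t * cmod s))"
    have pos: "C' * max 1 (t * cmod s) \<ge> 1" using C'(1) mult_mono[of 1 C' 1 "max 1 (t * cmod s)"] by simp
    then have L0: "L \<ge> 0" by (simp add: L_def)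
    have "G z \<le> C + L / real n" if z: "z \<in> fibre s" for z
    proof -
      have "cmod (poly T z) = t * cmod s" using z t_pos by (simp add: fibre_def norm_mult)
      then have "max 1 (cmod z) ^ n \<le> C' * max 1 (t * cmod s)" using C'(2)[of z] by (simp add: n_def)
      then have "ln (max 1 (cmod z) ^ n) \<le> L"
        unfolding L_def using pos by (subst ln_le_cancel_iff) (auto intro: zero_less_power simp: less_max_iff_disj)
      then have "real n * ln (max 1 (cmod z)) \<le> L" by (subst (asm) ln_realpow) auto
      then have "ln (max 1 (cmod z)) \<le> L / real n" using n by (simp add: field_simps)
      then show ?thesis using C(2)[of z] by linarith
    qed
    then have "fibre_sum s \<le> of_nat (card (fibre s)) * (C + L / real n)"
      unfolding fibre_sum_def by (rule sum_bounded_above)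
    also have "\<dots> \<le> real n * (C + L / real n)"
      using card_fibre_le[of s] C(1) L0 by (intro mult_right_mono) (auto simp: n_def)
    also have "\<dots> = real n * C + L" using n by (simp add: field_simps)
    finally have "exp (fibre_sum s) \<le> exp (real n * C) * exp L" by (simp add: mult_exp_exp)
    also have "exp L = C' * max 1 (t * cmod s)" unfolding L_def using pos by (intro exp_ln) linarith
    also have "max 1 (t * cmod s) \<le> max 1 t * max 1 (cmod s)"
      using t_pos mult_mono[of 1 "max 1 t" 1 "max 1 (cmod s)"] mult_mono[of t "max 1 t" "cmod s" "max 1 (cmod s)"] by simp
    finally show "exp (fibre_sum s) \<le> exp (real n * C) * C' * max 1 t * max 1 (cmod s)"
      using C'(1) by (simp add: mult.assoc)
  qed (use C'(1) in simp)
qed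

lemma branch_poly_growth:
  obtains D where "D > 0" "\<And>s M. M \<ge> 1 \<Longrightarrow> cmod s \<le> M \<Longrightarrow> cmod (branch_poly s) \<le> D * M ^ (degree T + 1)"
proof -
  define c where "c z = cmod (poly T z / of_real t)" for z
  define D where "D = (\<Prod>z\<in>critical. 1 + c z)"
  have c0: "c z \<ge> 0" for z by (simp add: c_def)
  then have D: "D > 0" unfolding D_def by (intro prod_pos) (simp add: add_pos_nonneg)
  show ?thesis
  proof (rule that[of "2 * D"])
    fix s :: complex and M :: real assume M: "M \<ge> 1" "cmod s \<le> M"
    have "cmod (\<Prod>z\<in>critical. s - poly T z / of_real t) \<le> (\<Prod>z\<in>critical. (1 + c z) * M)"
      unfolding prod_norm[symmetric]
    proof (intro prod_mono conjI norm_ge_zero)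
      fix z
      have "cmod (s - poly T z / of_real t) \<le> cmod s + c z" unfolding c_def by (rule norm_triangle_ineq4)
      also have "\<dots> \<le> M + c z * M" using M c0[of z] mult_left_mono[of 1 M "c z"] by simp
      finally show "cmod (s - poly T z / of_real t) \<le> (1 + c z) * M" by (simp add: algebra_simps)
    qed
    also have "\<dots> = D * M ^ card critical" by (simp add: D_def prod.distrib)
    also have "\<dots> \<le> D * M ^ (degree T - 1)"
      using D M card_critical by (intro mult_left_mono power_increasing) auto
    finally have 1: "cmod (\<Prod>z\<in>critical. s - poly T z / of_real t) \<le> D * M ^ (degree T - 1)" .
    have "cmod (s\<^sup>2 - 1) \<le> (cmod s)\<^sup>2 + 1" using norm_triangle_ineq4[of "s\<^sup>2" 1] by (simp add: norm_power)
    also have "\<dots> \<le> M\<^sup>2 + M\<^sup>2" using M by (intro add_mono power_mono one_le_power) auto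
    finally have 2: "cmod (s\<^sup>2 - 1) \<le> 2 * M\<^sup>2" by simp
    have "cmod (branch_poly s) \<le> (2 * M\<^sup>2) * (D * M ^ (degree T - 1))"
      unfolding branch_poly_def norm_mult using 1 2 M by (intro mult_mono) auto
    also have "\<dots> = 2 * D * M ^ (2 + (degree T - 1))" by (simp add: power_add power2_eq_square mult_ac)
    also have "2 + (degree T - 1) = degree T + 1" using deg by simp
    finally show "cmod (branch_poly s) \<le> 2 * D * M ^ (degree T + 1)" .
  qed (use D in simp)
qed

definition joukowsky :: "complex \<Rightarrow> complex" where
  "joukowsky w = (w + 1 / w) / 2"

lemma cmod_joukowsky_le:
  assumes "cmod w \<ge> 1"
  shows "cmod (joukowsky w) \<le> cmod w"
proof -
  have "cmod (w + 1 / w) \<le> cmod w + cmod (1 / w)" by (rule norm_triangle_ineq)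
  moreover have "cmod (1 / w) \<le> 1" using assms by (simp add: norm_divide divide_le_eq)
  ultimately show ?thesis using assms by (simp add: joukowsky_def norm_divide)
qed

lemma joukowsky_unit_circle:
  assumes "cmod w = 1"
  shows "joukowsky w = of_real (Re w)" "\<bar>Re w\<bar> \<le> 1"
proof -
  have "w * cnj w = 1" using assms by (simp add: complex_norm_square[symmetric])
  moreover have "w \<noteq> 0" using assms by auto
  ultimately have "1 / w = cnj w" by (simp add: divide_eq_eq mult.commute)
  then show "joukowsky w = of_real (Re w)" by (simp add: joukowsky_def complex_add_cnj)
  show "\<bar>Re w\<bar> \<le> 1" using abs_Re_le_cmod[of w] assms by simp
qed

lemma fibre_joukowsky_disjoint:
  assumes "cmod w > 1"
  shows "fibre (joukowsky w) \<inter> E = {}"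
proof (rule ccontr)
  assume "fibre (joukowsky w) \<inter> E \<noteq> {}"
  then obtain z where z: "poly T z = of_real t * joukowsky w" "z \<in> E" by (auto simp: fibre_def)
  obtain x where x: "poly T z = of_real x" "\<bar>x\<bar> \<le> t" using T_on_E[OF z(2)] by (auto simp: Reals_def)
  have "joukowsky w = of_real (x / t)" using z(1) x(1) t_pos by (simp add: field_simps)
  then have "joukowsky_modulus (joukowsky w) = 1"
    using joukowsky_modulus_eq_1[of "x / t"] x(2) t_pos by (simp add: abs_divide)
  moreover have "joukowsky_modulus (joukowsky w) = max (cmod w) (1 / cmod w)"
    using assms by (intro joukowsky_modulus_param) (auto simp: joukowsky_def)
  ultimately show False using assms by simp
qed

text \<open>The maximum principle on \<open>\<bar>w\<bar> \<ge> 1\<close> for \<open>exp (fibre_sum) / \<bar>w\<bar>\<close>. The critical values are removable: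
  the factor \<open>branch_poly\<close> makes the function \<open>V k\<close> below continuous and zero there, and its
  influence vanishes after taking \<open>k\<close>-th roots.\<close>

lemma fibre_sum_joukowsky_le:
  assumes P: "\<And>x. \<bar>x\<bar> \<le> 1 \<Longrightarrow> branch_poly (of_real x) \<noteq> 0 \<Longrightarrow> fibre_sum (of_real x) \<le> P"
    and w: "cmod w \<ge> 1" "branch_poly (joukowsky w) \<noteq> 0"
  shows "fibre_sum (joukowsky w) \<le> P + ln (cmod w)"
proof -
  define n where "n = degree T"
  obtain K where K: "K > 0" "\<And>s. exp (fibre_sum s) \<le> K * max 1 (cmod s)" by (rule fibre_sum_growth) blast
  obtain D where D: "D > 0" "\<And>s M. M \<ge> 1 \<Longrightarrow> cmod s \<le> M \<Longrightarrow> cmod (branch_poly s) \<le> D * M ^ (n + 1)"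
    unfolding n_def by (rule branch_poly_growth) blast
  \<comment> \<open>The polynomial factor grows like \<open>\<bar>w\<bar>\<^sup>n\<^sup>+\<^sup>1\<close> at most; 
    the exponent \<open>k + n + 2\<close> leaves one power for the decay at infinity.\<close>
  define V where "V k w = exp (fibre_sum (joukowsky w)) ^ k * cmod (branch_poly (joukowsky w)) / cmod w ^ (k + n + 2)" for k w
  have V0: "V k w \<ge> 0" for k w by (simp add: V_def)
  have jc: "isCont joukowsky v" if "v \<noteq> 0" for v
    unfolding joukowsky_def[abs_def] using that by (intro continuous_intros) auto
  have jh: "joukowsky holomorphic_on A" if "0 \<notin> A" for A
    unfolding joukowsky_def[abs_def] using that by (intro holomorphic_intros) auto
  have bc: "isCont (\<lambda>v. branch_poly (joukowsky v)) v" if "v \<noteq> 0" for v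
    unfolding branch_poly_def using t_pos by (intro continuous_intros jc that) auto
  have V_bound: "V k v \<le> (K * max 1 (cmod (joukowsky v))) ^ k * cmod (branch_poly (joukowsky v)) / cmod v ^ (k + n + 2)" for k v
    unfolding V_def using K by (intro divide_right_mono mult_right_mono power_mono) auto
  have Vc: "isCont (V k) v" if v: "v \<noteq> 0" for k v
  proof (cases "branch_poly (joukowsky v) = 0")
    case False
    have "isCont (\<lambda>v. fibre_sum (joukowsky v)) v"
      using isCont_o2[OF jc[OF v] isCont_fibre_sum[OF False]] .
    then show ?thesis unfolding V_def[abs_def] using v by (intro continuous_intros bc) auto
  next
    case True
    define U where "U v = (K * max 1 (cmod (joukowsky v))) ^ k * cmod (branch_poly (joukowsky v)) / cmod v ^ (k + n + 2)" for v
    have "isCont U v" unfolding U_def[abs_def] using v by (intro continuous_intros bc jc) auto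
    then have "(U \<longlongrightarrow> 0) (at v)" using True by (simp add: isCont_def U_def)
    then have "(V k \<longlongrightarrow> 0) (at v)"
      using V0 V_bound by (intro tendsto_sandwich[of "\<lambda>_. 0" "V k" "at v" U]) (auto simp: U_def)
    then show ?thesis using True by (simp add: isCont_def V_def)
  qed
  have circle: "V k v \<le> exp P ^ k * D" if v: "cmod v = 1" for k v
  proof (cases "branch_poly (joukowsky v) = 0")
    case True
    then show ?thesis using D(1) by (simp add: V_def)
  next
    case False
    have "fibre_sum (joukowsky v) \<le> P"
      using P[of "Re v"] joukowsky_unit_circle[OF v] False by simp
    then have "exp (fibre_sum (joukowsky v)) ^ k \<le> exp P ^ k" by (intro power_mono) auto
    moreover have "cmod (branch_poly (joukowsky v)) \<le> D"
      using D(2)[of 1 "joukowsky v"] cmod_joukowsky_le[of v] v by simp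
    ultimately show ?thesis unfolding V_def v using D(1) by (simp add: mult_mono)
  qed
  have main: "V k v \<le> exp P ^ k * D" if v: "cmod v \<ge> 1" for k v
  proof (rule field_le_epsilon)
    fix \<eta> :: real assume \<eta>: "\<eta> > 0"
    have decay: "V k v \<le> K ^ k * D * inverse (cmod v)" if v: "cmod v \<ge> 1" for v
    proof -
      have "V k v \<le> (K * cmod v) ^ k * (D * cmod v ^ (n + 1)) / cmod v ^ (k + n + 2)"
      proof (rule order.trans[OF V_bound], intro divide_right_mono mult_mono power_mono mult_left_mono)
        show "max 1 (cmod (joukowsky v)) \<le> cmod v" using cmod_joukowsky_le[OF v] v by simp
        show "cmod (branch_poly (joukowsky v)) \<le> D * cmod v ^ (n + 1)"
          by (rule D(2)[OF v cmod_joukowsky_le[OF v]])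
      qed (use K D v in auto)
      also have "\<dots> = K ^ k * D * (cmod v ^ (k + n + 1) / cmod v ^ (k + n + 2))"
        by (simp add: power_mult_distrib power_add)
      also have "cmod v ^ (k + n + 1) / cmod v ^ (k + n + 2) = inverse (cmod v)"
        using v by (simp add: field_simps)
      finally show ?thesis .
    qed
    have "((\<lambda>v::complex. K ^ k * D * inverse (cmod v)) \<longlongrightarrow> K ^ k * D * 0) at_infinity"
      by (intro tendsto_intros tendsto_inverse_0_at_top filterlim_norm_at_top)
    then have "\<forall>\<^sub>F v::complex in at_infinity. K ^ k * D * inverse (cmod v) < \<eta>"
      using order_tendstoD(2) \<eta> by fastforce
    then obtain R where R: "\<And>v. cmod v \<ge> R \<Longrightarrow> K ^ k * D * inverse (cmod v) < \<eta>"
      unfolding eventually_at_infinity by blast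
    define m where "m = exp P ^ k * D + \<eta>"
    have m: "m > \<eta>" unfolding m_def using D by simp
    have big: "V k v \<le> m" if "cmod v \<ge> R" "cmod v \<ge> 1" for v
      using decay[OF that(2)] R[OF that(1)] m by linarith
    define S where "S = cball 0 R - ball (0::complex) 1"
    have "V k v \<le> m"
    proof (cases "cmod v \<le> R")
      case True
      show ?thesis
      proof (rule modulus_dominated_max_principle[of S])
        show "compact S" unfolding S_def by (intro compact_diff) auto
        have "0 \<notin> S" by (simp add: S_def)
        then show "continuous_on S (V k)"
          by (intro continuous_at_imp_continuous_on ballI Vc) auto
        show "v \<in> S" using True v by (simp add: S_def)
        fix v0 assume v0: "v0 \<in> S" "V k v0 > m"
        then have "cmod v0 \<ge> 1" by (simp add: S_def)
        moreover have "cmod v0 \<noteq> 1" using circle[of v0 k] v0(2) \<eta> by (auto simp: m_def)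
        ultimately have gt1: "cmod v0 > 1" by simp
        have ltR: "cmod v0 < R" using big[of v0] v0(2) \<open>cmod v0 \<ge> 1\<close> by force
        have bne: "branch_poly (joukowsky v0) \<noteq> 0" using v0(2) m \<eta> by (auto simp: V_def)
        obtain r f where f: "r > 0" "f holomorphic_on ball (joukowsky v0) r"
            "\<And>s. s \<in> ball (joukowsky v0) r \<Longrightarrow> Re (f s) = fibre_sum s"
          using fibre_sum_local_completion[OF bne fibre_joukowsky_disjoint[OF gt1]] by blast
        have "v0 \<noteq> 0" using gt1 by auto
        obtain d where d: "d > 0" "joukowsky ` ball v0 d \<subseteq> ball (joukowsky v0) r"
          using jc[OF \<open>v0 \<noteq> 0\<close>] f(1) unfolding continuous_at_ball by blast
        have "open (ball 0 R - cball (0::complex) 1)" by (intro open_Diff) auto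
        then obtain d' where d': "d' > 0" "ball v0 d' \<subseteq> ball 0 R - cball 0 1"
          using gt1 ltR unfolding open_contains_ball by (metis Diff_iff dist_0_norm mem_ball mem_cball not_le)
        define e where "e = min d d'"
        have e: "e > 0" "joukowsky ` ball v0 e \<subseteq> ball (joukowsky v0) r" "ball v0 e \<subseteq> ball 0 R - cball 0 1"
          using d d' unfolding e_def by (auto simp: image_subset_iff subset_iff)
        have e0: "0 \<notin> ball v0 e" using e(3) by (metis DiffD2 centre_in_cball subsetD zero_le_one)
        define F where "F v = exp (f (joukowsky v)) ^ k * branch_poly (joukowsky v) / v ^ (k + n + 2)" for v
        have nF: "cmod (F v) = V k v" if "v \<in> ball v0 e" for v
        proof -
          have "joukowsky v \<in> ball (joukowsky v0) r" using e(2) that by blast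
          then show ?thesis using f(3) by (simp add: F_def V_def norm_divide norm_mult norm_power)
        qed
        have fj: "(\<lambda>v. f (joukowsky v)) holomorphic_on ball v0 e"
          using holomorphic_on_compose_gen[OF jh[OF e0] f(2) e(2)] by (simp add: comp_def)
        have bj: "(\<lambda>v. branch_poly (joukowsky v)) holomorphic_on ball v0 e"
          unfolding branch_poly_def by (intro holomorphic_intros jh e0) (use t_pos in auto)
        have Fh: "F holomorphic_on ball v0 e"
          unfolding F_def using e0 by (intro holomorphic_intros fj bj) auto
        have "ball v0 e \<subseteq> S" using e(3) by (auto simp: S_def)
        then show "\<exists>r>0. \<exists>F. ball v0 r \<subseteq> S \<and> F holomorphic_on ball v0 r \<and> cmod (F v0) = V k v0 \<and>
           (\<forall>z\<in>ball v0 r. cmod (F z) \<le> V k z)"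
          using e(1) Fh nF by (intro exI[of _ e] conjI exI[of _ F]) auto
      qed
    qed (use big[of v] v in auto)
    then show "V k v \<le> exp P ^ k * D + \<eta>" by (simp add: m_def)
  qed
  define b where "b = cmod (branch_poly (joukowsky w))"
  have b: "b > 0" using w(2) by (simp add: b_def)
  define H where "H = fibre_sum (joukowsky w)"
  define c where "c = ln D + real (n + 2) * ln (cmod w) - ln b"
  have "H \<le> P + ln (cmod w) + c / real k" if k: "k \<ge> 1" for k
  proof -
    have w0: "cmod w > 0" using w(1) by linarith
    have "exp H ^ k * b \<le> exp P ^ k * D * cmod w ^ (k + n + 2)"
      using main[OF w(1), of k] w0 by (simp add: V_def H_def b_def field_simps)
    then have "ln (exp H ^ k * b) \<le> ln (exp P ^ k * D * cmod w ^ (k + n + 2))"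
      using b D w0 by (subst ln_le_cancel_iff) auto
    then have "real k * H + ln b \<le> real k * P + ln D + real (k + n + 2) * ln (cmod w)"
      using b D(1) w0 by (simp add: ln_mult ln_realpow algebra_simps)
    then have "real k * H \<le> real k * (P + ln (cmod w)) + c" by (simp add: c_def algebra_simps)
    then have "real k * H / real k \<le> (real k * (P + ln (cmod w)) + c) / real k" by (intro divide_right_mono) auto
    then show ?thesis using k by (simp add: add_divide_distrib)
  qed
  moreover have "(\<lambda>k. P + ln (cmod w) + c / real k) \<longlonglongrightarrow> P + ln (cmod w) + 0"
    by (intro tendsto_intros tendsto_divide_0[OF tendsto_const] filterlim_real_sequentially filterlim_at_top_imp_at_infinity)
  ultimately show ?thesis
    unfolding H_def by (intro LIMSEQ_le_const[of _ "P + ln (cmod w)"]) auto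
qed

text \<open>Summing the hypothesis over the fibre, since the product of the \<open>n\<close> points is, up to sign, the
  constant term of \<open>T - t s\<close>.\<close>

lemma fibre_sum_lower:
  assumes s: "branch_poly s \<noteq> 0" and z: "\<And>z. z \<in> fibre s \<Longrightarrow> z \<noteq> 0 \<and> ln (cmod z) + g \<le> G z"
  shows "ln (cmod (poly T 0 - of_real t * s)) + real (degree T) * g \<le> fibre_sum s"
    and "poly T 0 - of_real t * s \<noteq> 0"
proof -
  have "poly T 0 - of_real t * s = poly (\<Prod>z\<in>fibre s. [:- z, 1:]) 0"
    unfolding noncritical_fibre(1)[OF s, symmetric] by simp
  also have "\<dots> = (\<Prod>z\<in>fibre s. - z)" by (simp add: poly_prod)
  finally have eq: "poly T 0 - of_real t * s = (\<Prod>z\<in>fibre s. - z)" .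
  show "poly T 0 - of_real t * s \<noteq> 0" unfolding eq prod_zero_iff[OF finite_fibre] using z by auto
  have "ln (cmod (poly T 0 - of_real t * s)) = ln (\<Prod>z\<in>fibre s. cmod z)"
    unfolding eq by (simp flip: prod_norm)
  also have "\<dots> = (\<Sum>z\<in>fibre s. ln (cmod z))" by (rule ln_prod) (use z finite_fibre in auto)
  finally have "ln (cmod (poly T 0 - of_real t * s)) + real (degree T) * g = (\<Sum>z\<in>fibre s. ln (cmod z) + g)"
    using noncritical_fibre(2)[OF s] by (simp add: sum.distrib)
  also have "\<dots> \<le> fibre_sum s" unfolding fibre_sum_def using z by (intro sum_mono) auto
  finally show "ln (cmod (poly T 0 - of_real t * s)) + real (degree T) * g \<le> fibre_sum s" .
qed

text \<open>The preceding bound compared with \<open>fibre_sum \<ge> log \<bar>T(0) - t s\<bar> + n (\<gamma> - \<delta>)\<close> for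
  \<open>s = (x + 1/x)/2\<close>, as the positive number \<open>x\<close> tends to infinity.\<close>

lemma sup_norm_le_exp_fibre_bound:
  assumes P: "\<And>x. \<bar>x\<bar> \<le> 1 \<Longrightarrow> branch_poly (of_real x) \<noteq> 0 \<Longrightarrow> fibre_sum (of_real x) \<le> P"
    and \<gamma>: "\<And>\<delta>. \<delta> > 0 \<Longrightarrow> \<forall>\<^sub>F z in at_infinity. ln (cmod z) + \<gamma> - \<delta> \<le> G z"
  shows "t / 2 * exp (real (degree T) * \<gamma>) \<le> exp P"
proof -
  define n where "n = degree T"
  have main: "t / 2 * exp (real n * (\<gamma> - \<delta>)) \<le> exp P" if \<delta>: "\<delta> > 0" for \<delta>
  proof -
    let ?e = "exp (real n * (\<gamma> - \<delta>))"
    obtain R0 where R0: "\<And>z. cmod z \<ge> R0 \<Longrightarrow> ln (cmod z) + \<gamma> - \<delta> \<le> G z"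
      using \<gamma>[OF \<delta>] unfolding eventually_at_infinity by blast
    define R where "R = max 1 R0"
    have "compact (poly T ` cball 0 R)" by (intro compact_continuous_image continuous_intros) auto
    then have "bounded (poly T ` cball 0 R)" by (rule compact_imp_bounded)
    then obtain M where M: "\<forall>y\<in>poly T ` cball 0 R. norm y \<le> M"
      unfolding bounded_iff by (rule exE)
    define B where "B = Max ((\<lambda>z. cmod (poly T z / of_real t)) ` critical)"
    have B: "cmod (poly T z / of_real t) \<le> B" if "z \<in> critical" for z
      unfolding B_def by (rule Max_ge) (use that finite_critical in auto)
    define T0 where "T0 = cmod (poly T 0)"
    have big: "(t / 2 - T0 / x) * ?e \<le> exp P"
      if x: "x \<ge> 1" "x / 2 > 1" "x / 2 > B" "t * (x / 2) > M" "t * (x / 2) > T0" for x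
    proof -
      define s where "s = joukowsky (of_real x)"
      have s: "s = of_real ((x + 1 / x) / 2)" by (simp add: s_def joukowsky_def)
      have "(x + 1 / x) / 2 \<ge> x / 2" using x(1) by simp
      then have s_ge: "cmod s \<ge> x / 2" unfolding s norm_of_real by linarith
      have bne: "branch_poly s \<noteq> 0"
      proof
        assume "branch_poly s = 0"
        then consider "s\<^sup>2 = 1" | z where "z \<in> critical" "s = poly T z / of_real t"
          using finite_critical by (auto simp: branch_poly_def)
        then show False
        proof cases
          case 1
          then have "s = 1 \<or> s = - 1" by (simp add: power2_eq_1_iff)
          then show False using s_ge x(2) by auto
        next
          case 2
          then show False using B[OF 2(1)] s_ge x(3) by simp
        qed
      qed
      have fib: "z \<noteq> 0 \<and> ln (cmod z) + (\<gamma> - \<delta>) \<le> G z" if z: "z \<in> fibre s" for z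
      proof -
        have "cmod (poly T z) = t * cmod s" using z t_pos by (simp add: fibre_def norm_mult)
        also have "\<dots> \<ge> t * (x / 2)" using s_ge t_pos by (intro mult_left_mono) auto
        finally have "cmod (poly T z) > M" using x(4) by linarith
        then have "z \<notin> cball 0 R" using M by force
        then have "cmod z > R" by simp
        then have "cmod z > 1" "cmod z > R0" by (simp_all add: R_def)
        then show ?thesis using R0[of z] by auto
      qed
      note low = fibre_sum_lower[OF bne fib]
      have up: "fibre_sum s \<le> P + ln x"
        using fibre_sum_joukowsky_le[OF P, of "of_real x"] bne x(1) by (simp add: s_def)
      define y where "y = cmod (poly T 0 - of_real t * s)"
      have y0: "y > 0" using low(2) by (simp add: y_def)
      have "y \<ge> t * (x / 2) - T0"
      proof -
        have "cmod (of_real t * s) - cmod (poly T 0) \<le> y"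
          unfolding y_def using norm_triangle_ineq2[of "of_real t * s" "poly T 0"] by (simp add: norm_minus_commute)
        moreover have "cmod (of_real t * s) \<ge> t * (x / 2)"
          using s_ge t_pos by (simp add: norm_mult)
        ultimately show ?thesis by (simp add: T0_def)
      qed
      have "ln y + real n * (\<gamma> - \<delta>) \<le> P + ln x" using low(1) up by (simp add: y_def n_def)
      then have "exp (ln y + real n * (\<gamma> - \<delta>)) \<le> exp (P + ln x)" by simp
      then have "y * ?e \<le> exp P * x" using y0 x(1) by (simp add: exp_add)
      then have "(t * (x / 2) - T0) * ?e \<le> exp P * x"
        using \<open>y \<ge> _\<close> by (meson exp_ge_zero mult_right_mono order_trans)
      then have "(t * (x / 2) - T0) * ?e / x \<le> exp P * x / x"
        using x(1) by (intro divide_right_mono) auto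
      moreover have "(t * (x / 2) - T0) * ?e / x = (t / 2 - T0 / x) * ?e"
        using x(1) by (simp add: field_simps)
      ultimately show ?thesis using x(1) by simp
    qed
    have "\<forall>\<^sub>F x in at_top. (t / 2 - T0 / x) * ?e \<le> exp P"
      using eventually_ge_at_top[of 1] eventually_gt_at_top[of 2] eventually_gt_at_top[of "2 * B"]
        eventually_gt_at_top[of "2 * M / t"] eventually_gt_at_top[of "2 * T0 / t"]
    proof eventually_elim
      case (elim x)
      then show ?case using t_pos by (intro big) (auto simp: field_simps)
    qed
    moreover have "((\<lambda>x. (t / 2 - T0 / x) * ?e) \<longlongrightarrow> (t / 2 - 0) * ?e) at_top"
      by (intro tendsto_intros tendsto_divide_0[OF tendsto_const] filterlim_at_top_imp_at_infinity filterlim_ident)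
    ultimately have "(t / 2 - 0) * ?e \<le> exp P"
      by (intro tendsto_upperbound[where F = at_top]) auto
    then show ?thesis by simp
  qed
  have "((\<lambda>\<delta>. t / 2 * exp (real n * (\<gamma> - \<delta>))) \<longlongrightarrow> t / 2 * exp (real n * (\<gamma> - 0))) (at_right (0::real))"
    by (intro tendsto_intros)
  moreover have "\<forall>\<^sub>F \<delta> in at_right (0::real). t / 2 * exp (real n * (\<gamma> - \<delta>)) \<le> exp P"
    unfolding eventually_at_right_field using main by (intro exI[of _ 1]) auto
  ultimately have "t / 2 * exp (real n * (\<gamma> - 0)) \<le> exp P"
    by (intro tendsto_upperbound[where F = "at_right 0"]) auto
  then show ?thesis by (simp add: n_def)
qed

end

section \<open>Gaps of the set and the bound of Totik and Widom\<close>

context real_green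
begin

text \<open>Otherwise a monic polynomial vanishes on \<open>E\<close>, hence everywhere by the Bernstein--Walsh inequality.\<close>

lemma infinite_E: "infinite E"
proof
  assume fin: "finite E"
  define P where "P = (\<Prod>e\<in>E. [:- e, 1:])"
  have lc: "lead_coeff P = 1" unfolding P_def by (subst lead_coeff_prod) simp
  have zero: "poly P z = 0" for z
  proof -
    have "cmod (poly P w) \<le> 0" if "G w = 0" for w
    proof -
      have "w \<in> E" using that G_pos[of w] by force
      then have "(\<Prod>e\<in>E. w - e) = 0" using fin by (intro prod_zero) auto
      then show ?thesis by (simp add: P_def poly_prod)
    qed
    then have "cmod (poly P z) \<le> 0 * exp (real (degree P) * (G z - 0))"
      by (intro poly_bernstein_walsh[OF lc]) (use G_nonneg in auto)
    then show ?thesis by simp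
  qed
  then have "P = 0" using poly_all_0_iff_0 by blast
  then show False using lc by simp
qed

text \<open>The maximum of \<open>G\<close> over the closed gap is attained inside, as \<open>G\<close> vanishes at the ends. The
  derivative along the real line is zero there, and the derivative across it is zero by symmetry.\<close>

lemma gap_maximum_critical:
  assumes x: "of_real x \<notin> E" and a: "of_real a \<in> E" "a < x" and b: "of_real b \<in> E" "x < b"
  shows "\<exists>c. G (of_real x) \<le> G (of_real c) \<and> of_real c \<notin> E \<and>
     (G has_derivative (\<lambda>_. 0)) (at (of_real c)) \<and> (\<forall>e\<in>{min x c..max x c}. of_real e \<notin> E)"
proof -
  define X where "X = {e::real. complex_of_real e \<in> E}"
  define u where "u e = G (of_real e)" for e :: real
  have cu: "continuous_on A u" for A
    unfolding u_def by (intro continuous_on_compose2[OF cont_G] continuous_intros) auto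
  have "closed X"
    using continuous_closed_vimage[OF compact_imp_closed[OF compact_E], of complex_of_real]
    by (simp add: X_def vimage_def)
  have ca: "compact (X \<inter> {a..x})" and cb: "compact (X \<inter> {x..b})"
    using \<open>closed X\<close> by (auto intro: closed_Int_compact)
  obtain a' where a': "a' \<in> X \<inter> {a..x}" "\<And>e. e \<in> X \<inter> {a..x} \<Longrightarrow> e \<le> a'"
  proof -
    have "a \<in> X \<inter> {a..x}" using a by (simp add: X_def)
    then show ?thesis using compact_attains_sup[OF ca] that by blast
  qed
  obtain b' where b': "b' \<in> X \<inter> {x..b}" "\<And>e. e \<in> X \<inter> {x..b} \<Longrightarrow> b' \<le> e"
  proof -
    have "b \<in> X \<inter> {x..b}" using b by (simp add: X_def)
    then show ?thesis using compact_attains_inf[OF cb] that by blast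
  qed
  have "x \<notin> X" using x by (simp add: X_def)
  then have ab: "a' < x" "x < b'" using a'(1) b'(1) by (auto simp: less_le)
  have gap: "e \<notin> X" if "a' < e" "e < b'" for e
  proof
    assume e: "e \<in> X"
    show False
    proof (cases "e \<le> x")
      case True
      then show False using a'(2)[of e] a'(1) e that by auto
    next
      case False
      then show False using b'(2)[of e] b'(1) e that by auto
    qed
  qed
  obtain c where c: "c \<in> {a'..b'}" "\<And>e. e \<in> {a'..b'} \<Longrightarrow> u e \<le> u c"
    using continuous_attains_sup[of "{a'..b'}" u] cu ab by force
  have "u x > 0" using G_pos[OF x] by (simp add: u_def)
  then have uc: "u c > 0" using c(2)[of x] ab by auto
  moreover have "u a' = 0" "u b' = 0" using a'(1) b'(1) G_zero by (auto simp: X_def u_def)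
  ultimately have c': "a' < c" "c < b'" using c(1) by (auto simp: less_le)
  have cE: "complex_of_real c \<notin> E" using gap[OF c'] by (simp add: X_def)
  obtain p q where pq: "(G has_derivative (\<lambda>h. p * Re h + q * Im h)) (at (of_real c))"
    using harmonic_G cE unfolding harmonic_on_def by blast
  have "((\<lambda>z. G (cnj z)) has_derivative (\<lambda>h. p * Re (cnj h) + q * Im (cnj h))) (at (of_real c))"
    by (rule has_derivative_compose[OF bounded_linear.has_derivative[OF bounded_linear_cnj has_derivative_ident]])
       (use pq in simp)
  then have "(G has_derivative (\<lambda>h. p * Re h - q * Im h)) (at (of_real c))"
    unfolding G_cnj by simp
  from has_derivative_unique[OF this pq] have "p * Re \<i> - q * Im \<i> = p * Re \<i> + q * Im \<i>" by (rule fun_cong)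
  then have q: "q = 0" by simp
  have "(u has_derivative (\<lambda>h. p * Re (of_real h) + q * Im (of_real h))) (at c)"
    unfolding u_def
    by (rule has_derivative_compose[OF bounded_linear.has_derivative[OF bounded_linear_of_real has_derivative_ident] pq])
  then have "(u has_real_derivative p) (at c)" by (simp add: has_field_derivative_def mult_commute_abs)
  then have p: "p = 0"
  proof (rule DERIV_local_max)
    show "0 < min (c - a') (b' - c)" using c' by simp
    show "\<forall>y. \<bar>c - y\<bar> < min (c - a') (b' - c) \<longrightarrow> u y \<le> u c"
      using c(2) by (auto simp: abs_if split: if_splits)
  qed
  have "(G has_derivative (\<lambda>_. 0)) (at (of_real c))" using pq by (simp add: p q)
  moreover have "\<forall>e\<in>{min x c..max x c}. of_real e \<notin> E"
  proof
    fix e assume "e \<in> {min x c..max x c}"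
    then have "a' < e" "e < b'" using ab c' by auto
    then show "complex_of_real e \<notin> E" using gap by (simp add: X_def)
  qed
  moreover have "G (of_real x) \<le> G (of_real c)" using c(2)[of x] ab by (simp add: u_def)
  ultimately show ?thesis using cE by blast
qed

text \<open>Two of the points \<open>x i\<close> are separated by a point of \<open>E\<close>, so they lie in different gaps and are
  assigned different critical points.\<close>

lemma gap_sum_le_critical_sum:
  fixes x y :: "nat \<Rightarrow> real"
  assumes y: "\<And>i. i \<le> n \<Longrightarrow> of_real (y i) \<in> E" and x: "\<And>i. i < n \<Longrightarrow> y i < x i \<and> x i < y (Suc i)"
    and C: "C = {w. w \<notin> E \<and> (G has_derivative (\<lambda>_. 0)) (at w)}"
    and S: "S = (\<Sum>\<^sub>\<infinity>w\<in>C. ennreal (G w))" "S < \<infinity>"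
  shows "(\<Sum>i<n. G (of_real (x i))) \<le> enn2real S"
proof -
  define I where "I = {i\<in>{..<n}. complex_of_real (x i) \<notin> E}"
  have finI: "finite I" by (simp add: I_def)
  have "\<exists>c. G (of_real (x i)) \<le> G (of_real c) \<and> of_real c \<in> C \<and> (\<forall>e\<in>{min (x i) c..max (x i) c}. of_real e \<notin> E)"
    if "i \<in> I" for i
    using gap_maximum_critical[of "x i" "y i" "y (Suc i)"] y x that unfolding I_def C by auto
  then obtain c where c: "\<And>i. i \<in> I \<Longrightarrow> G (of_real (x i)) \<le> G (of_real (c i))" "\<And>i. i \<in> I \<Longrightarrow> of_real (c i) \<in> C"
    "\<And>i e. i \<in> I \<Longrightarrow> e \<in> {min (x i) (c i)..max (x i) (c i)} \<Longrightarrow> of_real e \<notin> E" by metis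
  have y_mono: "y i \<le> y j" if "i \<le> j" "j \<le> n" for i j
    using that
  proof (induction j rule: dec_induct)
    case (step k)
    then show ?case using x[of k] by simp
  qed simp
  have lt_ne: "c i \<noteq> c j" if ij: "i \<in> I" "j \<in> I" "i < j" for i j
  proof
    assume eq: "c i = c j"
    have "j < n" using ij by (simp add: I_def)
    then have "x i < y (Suc i)" "y (Suc i) \<le> y j" "y j < x j" "of_real (y (Suc i)) \<in> E"
      using x[of i] x[of j] y_mono[of "Suc i" j] y[of "Suc i"] ij(3) by auto
    then show False
      using c(3)[OF ij(1), of "y (Suc i)"] c(3)[OF ij(2), of "y (Suc i)"] eq by (cases "y (Suc i) \<le> c i") auto
  qed
  have inj: "inj_on (\<lambda>i. complex_of_real (c i)) I"
    by (rule inj_onI) (metis lt_ne nat_neq_iff of_real_eq_iff)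
  have "(\<Sum>i<n. G (of_real (x i))) = (\<Sum>i\<in>I. G (of_real (x i)))"
    by (rule sum.mono_neutral_right) (auto simp: I_def G_zero)
  also have "\<dots> \<le> (\<Sum>i\<in>I. G (of_real (c i)))" by (intro sum_mono c)
  also have "\<dots> = (\<Sum>w\<in>(\<lambda>i. of_real (c i)) ` I. G w)" by (simp add: sum.reindex[OF inj])
  finally have le: "(\<Sum>i<n. G (of_real (x i))) \<le> (\<Sum>w\<in>(\<lambda>i. of_real (c i)) ` I. G w)" .
  have "ennreal (\<Sum>w\<in>(\<lambda>i. of_real (c i)) ` I. G w) = (\<Sum>w\<in>(\<lambda>i. of_real (c i)) ` I. ennreal (G w))"
    by (simp add: sum_ennreal G_nonneg)
  also have "\<dots> \<le> S"
    unfolding S(1) nonneg_infsum_complete[of C "\<lambda>w. ennreal (G w)", simplified]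
    using finI c(2) by (intro SUP_upper) auto
  finally have "enn2real (ennreal (\<Sum>w\<in>(\<lambda>i. of_real (c i)) ` I. G w)) \<le> enn2real S"
    using S(2) by (intro enn2real_mono) auto
  then show ?thesis using le by (simp add: sum_nonneg G_nonneg)
qed

text \<open>By the intermediate value theorem the fibre over \<open>s\<close> with \<open>\<bar>s\<bar> < 1\<close> has a point between any two
  neighbouring alternation points; these are \<open>n\<close> points, so they are the whole fibre.\<close>

lemma totik_widom_bound:
  assumes C: "C = {w. w \<notin> E \<and> (G has_derivative (\<lambda>_. 0)) (at w)}"
    and S: "S = (\<Sum>\<^sub>\<infinity>w\<in>C. ennreal (G w))" "S < \<infinity>" and n: "n \<ge> 1"
    and \<gamma>: "\<And>\<delta>. \<delta> > 0 \<Longrightarrow> \<forall>\<^sub>F z in at_infinity. ln (cmod z) + \<gamma> - \<delta> \<le> G z"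
  obtains T :: "complex poly" and t where "monic_of_degree n T" "t > 0"
    "\<And>z. z \<in> E \<Longrightarrow> poly T z \<in> \<real> \<and> cmod (poly T z) \<le> t"
    "t / 2 * exp (real n * \<gamma>) \<le> exp (enn2real S)"
proof -
  define X where "X = Re ` E"
  have E_eq: "E = complex_of_real ` X"
    using E_real unfolding X_def by (force simp: image_image subset_iff elim!: Reals_cases)
  have X: "compact X" "infinite X"
  proof -
    show "compact X" unfolding X_def using compact_E by (intro compact_continuous_image continuous_intros)
    show "infinite X" using infinite_E unfolding E_eq by (metis finite_imageI)
  qed
  obtain Q :: "real poly" and t y where Q: "degree Q = n" "lead_coeff Q = 1" "t > 0"
    "\<And>x. x \<in> X \<Longrightarrow> \<bar>poly Q x\<bar> \<le> t" "\<And>i. i \<le> n \<Longrightarrow> y i \<in> X" "\<And>i. i < n \<Longrightarrow> y i < y (Suc i)"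
    "\<And>i. i \<le> n \<Longrightarrow> \<bar>poly Q (y i)\<bar> = t" "\<And>i. i < n \<Longrightarrow> poly Q (y (Suc i)) = - poly Q (y i)"
    using real_chebyshev_alternation[OF X n] by metis
  define T where "T = map_poly complex_of_real Q"
  have T: "degree T = n" "lead_coeff T = 1"
    using Q(1,2) by (auto simp: T_def degree_map_poly coeff_map_poly)
  have TE: "poly T z \<in> \<real> \<and> cmod (poly T z) \<le> t" if "z \<in> E" for z
    using that Q(4) unfolding E_eq T_def by (auto simp: poly_map_poly_of_real)
  interpret TP: real_green_poly E G T t
    using T n Q(3) TE by unfold_locales auto
  have bound: "TP.fibre_sum (of_real s) \<le> enn2real S"
    if s: "\<bar>s\<bar> \<le> 1" "TP.branch_poly (of_real s) \<noteq> 0" for s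
  proof -
    have "s\<^sup>2 \<noteq> 1" using s(2) by (auto simp: TP.branch_poly_def power2_eq_1_iff)
    then have s1: "\<bar>s\<bar> < 1" using s(1) by (metis abs_square_eq_1 less_le power2_eq_square)
    have st: "\<bar>t * s\<bar> < t" using s1 Q(3) by (simp add: abs_mult)
    have "\<exists>x. y i < x \<and> x < y (Suc i) \<and> poly Q x = t * s" if i: "i < n" for i
    proof -
      have "poly Q (y i) = t \<or> poly Q (y i) = - t" using Q(7)[of i] i by linarith
      then have ivt: "\<exists>x. y i \<le> x \<and> x \<le> y (Suc i) \<and> poly Q x = t * s"
      proof
        assume *: "poly Q (y i) = t"
        show ?thesis
          by (rule IVT2') (use * Q(6,8)[OF i] st in \<open>auto intro!: continuous_intros\<close>)
      next
        assume *: "poly Q (y i) = - t"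
        show ?thesis
          by (rule IVT') (use * Q(6,8)[OF i] st in \<open>auto intro!: continuous_intros\<close>)
      qed
      then obtain x where x: "y i \<le> x" "x \<le> y (Suc i)" "poly Q x = t * s" by blast
      have "\<bar>poly Q (y i)\<bar> = t" "\<bar>poly Q (y (Suc i))\<bar> = t" using Q(7) i by auto
      then have "x \<noteq> y i" "x \<noteq> y (Suc i)" using x(3) st by auto
      then show ?thesis using x by (auto simp: less_le)
    qed
    then obtain x where x: "\<And>i. i < n \<Longrightarrow> y i < x i \<and> x i < y (Suc i)" "\<And>i. i < n \<Longrightarrow> poly Q (x i) = t * s"
      by metis
    have y_mono: "y i \<le> y j" if "i \<le> j" "j \<le> n" for i j
      using that
    proof (induction j rule: dec_induct)
      case (step k)
      then show ?case using Q(6)[of k] by simp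
    qed simp
    have x_lt: "x i < x j" if "i < j" "j < n" for i j
      using x(1)[of i] x(1)[of j] y_mono[of "Suc i" j] that by auto
    have inj: "inj_on (\<lambda>i. complex_of_real (x i)) {..<n}"
    proof (rule inj_onI, rule ccontr)
      fix i j assume ij: "i \<in> {..<n}" "j \<in> {..<n}" "complex_of_real (x i) = complex_of_real (x j)" "i \<noteq> j"
      then show False using x_lt[of i j] x_lt[of j i] by (cases "i < j") auto
    qed
    have "(\<lambda>i. complex_of_real (x i)) ` {..<n} = TP.fibre (of_real s)"
    proof (rule card_seteq[OF TP.finite_fibre])
      show "(\<lambda>i. complex_of_real (x i)) ` {..<n} \<subseteq> TP.fibre (of_real s)"
      proof -
        have "poly T (of_real (x i)) = of_real (t * s)" if "i < n" for i
          unfolding T_def poly_map_poly_of_real x(2)[OF that] ..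
        then show ?thesis by (auto simp: TP.fibre_def)
      qed
      show "card (TP.fibre (of_real s)) \<le> card ((\<lambda>i. complex_of_real (x i)) ` {..<n})"
        using card_image[OF inj] TP.card_fibre_le T(1) by simp
    qed
    then have "TP.fibre_sum (of_real s) = (\<Sum>i<n. G (of_real (x i)))"
      unfolding TP.fibre_sum_def by (metis (no_types, lifting) inj sum.reindex_cong)
    also have "\<dots> \<le> enn2real S"
    proof (rule gap_sum_le_critical_sum[where y = y, OF _ x(1) C S])
      show "of_real (y i) \<in> E" if "i \<le> n" for i using Q(5)[OF that] by (auto simp: E_eq)
    qed
    finally show ?thesis .
  qed
  show ?thesis
    by (rule that[of T t]) (use T Q(3) TE TP.sup_norm_le_exp_fibre_bound[OF bound \<gamma>] in \<open>auto simp: monic_of_degree_def\<close>)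
qed

end

section \<open>Chebyshev norms on level lines\<close>

theorem theorem1p6:
  fixes E :: "complex set" and \<alpha> :: real and n :: nat
  assumes "E \<subseteq> \<real>" and "compact E" and "regular_set E" and "parreau_widom E"
    and "\<alpha> > 0" and "n \<ge> 1"
  shows "chebyshev_norm (green_level_set E \<alpha>) n
           \<le> (1 + exp (- real n * \<alpha>)) * exp (enn2real (PW E))
              * log_capacity (green_level_set E \<alpha>) ^ n"
proof -
  define G where "G = greens_function E"
  interpret real_green E G
    unfolding G_def by (rule real_green_greens_function[OF assms(1-3)])
  have out: "outside E = - E" by (rule outside_of_compact_real[OF assms(1,2)])
  have PW: "PW E = (\<Sum>\<^sub>\<infinity>w\<in>green_critical_points E. ennreal (G w))" by (simp add: PW_def G_def)
  have C: "green_critical_points E = {w. w \<notin> E \<and> (G has_derivative (\<lambda>_. 0)) (at w)}"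
    by (auto simp: green_critical_points_def out G_def)
  have L: "green_level_set E \<alpha> = {z. G z = \<alpha>}" by (simp add: green_level_set_def G_def)
  obtain \<gamma> where \<gamma>: "\<And>\<delta>. \<delta> > 0 \<Longrightarrow> \<forall>\<^sub>F z in at_infinity. ln (cmod z) + \<gamma> - \<delta> \<le> G z"
    "\<And>\<delta>. \<delta> > 0 \<Longrightarrow> \<exists>\<^sub>F z in at_infinity. G z \<le> ln (cmod z) + \<gamma> + \<delta>"
    by (rule green_liminf) blast
  obtain T t where T: "monic_of_degree n T" "t > 0"
    "\<And>z. z \<in> E \<Longrightarrow> poly T z \<in> \<real> \<and> cmod (poly T z) \<le> t"
    "t / 2 * exp (real n * \<gamma>) \<le> exp (enn2real (PW E))"
    using totik_widom_bound[OF C PW _ assms(6) \<gamma>(1)] assms(4) unfolding parreau_widom_def by blast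
  have degT: "degree T = n" "lead_coeff T = 1" using T(1) by (auto simp: monic_of_degree_def)
  have ne: "{z. G z = \<alpha>} \<noteq> {}"
    using level_set_exists_large[of 1 \<alpha>, OF _ _ \<gamma>(2)] assms(5) by auto
  have "chebyshev_norm {z. G z = \<alpha>} n \<le> sup_norm_on {z. G z = \<alpha>} (poly T)"
    by (rule chebyshev_norm_le[OF compact_level_set ne T(1)])
  also have "\<dots> \<le> t / 2 * (exp (real n * \<alpha>) + exp (- (real n * \<alpha>)))"
  proof (rule sup_norm_on_least[OF ne])
    fix z assume "z \<in> {z. G z = \<alpha>}"
    then show "cmod (poly T z) \<le> t / 2 * (exp (real n * \<alpha>) + exp (- (real n * \<alpha>)))"
      using poly_bound_on_level_set[OF degT(2) T(2,3), of z] degT(1) by simp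
  qed
  \<comment> \<open>The factor \<open>1 + e\<^sup>-\<^sup>2\<^sup>n\<^sup>\<alpha>\<close> is even smaller than the one in the claim.\<close>
  also have "\<dots> = (1 + exp (- real n * \<alpha>) * exp (- real n * \<alpha>)) * (t / 2 * exp (real n * \<gamma>)) * exp (\<alpha> - \<gamma>) ^ n"
  proof -
    have gc: "exp (real n * \<gamma>) * exp (\<alpha> - \<gamma>) ^ n = exp (real n * \<alpha>)"
      by (simp add: mult_exp_exp algebra_simps flip: exp_of_nat_mult)
    have ee: "exp (- real n * \<alpha>) * exp (real n * \<alpha>) = 1" by (simp add: mult_exp_exp)
    have "(1 + e * e) * (t / 2 * g) * c = t / 2 * (g * c + e * (e * (g * c)))" for e g c :: real
      by (simp add: algebra_simps)
    then show ?thesis by (simp only: gc ee) simp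
  qed
  also have "\<dots> \<le> (1 + exp (- real n * \<alpha>)) * exp (enn2real (PW E)) * log_capacity {z. G z = \<alpha>} ^ n"
  proof (intro mult_mono power_mono)
    have "exp (- real n * \<alpha>) \<le> 1" using assms(5) by simp
    then show "1 + exp (- real n * \<alpha>) * exp (- real n * \<alpha>) \<le> 1 + exp (- real n * \<alpha>)"
      by (simp add: mult_left_le)
    show "exp (\<alpha> - \<gamma>) \<le> log_capacity {z. G z = \<alpha>}"
      using assms(5) by (intro log_capacity_level_set \<gamma>(2)) auto
  qed (use T(2,4) in auto)
  finally show ?thesis unfolding L .
qed

end
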